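(* There exists an active statistical algorithm that, for every dimension $d$ and $\epsilon\in(0,1/2]$, learns the class $\mathcal{H}_d$ of homogeneous halfspaces over $U_d$ to accuracy $1-\epsilon$, uses $(d+1)\log(1/\epsilon)$ active statistical queries with query tolerance $\Omega(1/\sqrt{d})$ and filter tolerance $\Omega(\epsilon)$, and runs in time $d\cdot\mathrm{poly}(\log(d/\epsilon))$.
   Context: $U_d$ is the uniform distribution over the unit sphere $S_{d-1}\subset\mathbb{R}^d$ (known to the learner), and $\mathcal{H}_d$ is the class of functions $h_v(x)=\mathrm{sign}(\langle v,x\rangle)$ for unit vectors $v\in\mathbb{R}^d$. Logarithms are base 2. Active statistical queries (SQs). For a distribution $D$ on $X$ and a target $f:X\to\{-1,1\}$, and for a filter $\chi:X\to[0,1]$ with $\mathbf{E}_D[\chi]>0$, let $D_{|\chi}$ have density $D(x)\chi(x)/\mathbf{E}_D[\chi]$. An active SQ is a pair $(\chi,\phi)$, $\chi:X\to[0,1]$, $\phi:X\times\{-1,1\}\to[-1,1]$, with filter tolerance $\tau_0$ and query tolerance $\tau$; a valid response is any $\mu$ such that, if $\mathbf{E}_D[\chi]\ge\tau_0$, then $|\mu-\mathbf{E}_{x\sim D_{|\chi}}[\phi(x,f(x))]|\le\tau$ (any value is valid if $\mathbf{E}_D[\chi]<\tau_0$). An active statistical algorithm accesses the target only via active SQs. It learns a class $C$ over $D$ to accuracy $1-\epsilon$ if for every target $f\in C$, whenever all queries receive valid responses, it outputs $h$ with $\mathbf{Pr}_{x\sim D}[h(x)\ne f(x)]\le\epsilon$.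 *)

theory Defs
  imports "HOL-Probability.Probability" "HOL-Computational_Algebra.Polynomial"
begin

section \<open>Homogeneous halfspaces and the uniform distribution on the sphere\<close>

text \<open>
  Vectors of \<open>\<real>\<^sup>d\<close> are functions \<open>nat \<Rightarrow> real\<close> that are extensional on \<open>{..<d}\<close>, i.e. elements of
  the space of the product measure below. This lets \<open>d\<close> be an ordinary number, as needed for one
  algorithm that works in every dimension.
\<close>

definition lborel_dim :: "nat \<Rightarrow> (nat \<Rightarrow> real) measure" where
  "lborel_dim d = (\<Pi>\<^sub>M i\<in>{..<d}. lborel)"

definition norm_dim :: "nat \<Rightarrow> (nat \<Rightarrow> real) \<Rightarrow> real" where
  "norm_dim d x = sqrt (\<Sum>i<d. (x i)\<^sup>2)"

definition unit_sphere :: "nat \<Rightarrow> (nat \<Rightarrow> real) set" where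
  "unit_sphere d = {x \<in> space (lborel_dim d). norm_dim d x = 1}"

definition unit_ball :: "nat \<Rightarrow> (nat \<Rightarrow> real) set" where
  "unit_ball d = {x \<in> space (lborel_dim d). norm_dim d x \<le> 1}"

text \<open>
  Normalised surface measure: the law of \<open>x / \<parallel>x\<parallel>\<close> for \<open>x\<close> uniform in the unit ball. The origin,
  which is the only point not sent to the sphere, is a null set.
\<close>

definition uniform_sphere :: "nat \<Rightarrow> (nat \<Rightarrow> real) measure" where
  "uniform_sphere d =
     restrict_space
       (distr (uniform_measure (lborel_dim d) (unit_ball d)) (lborel_dim d)
          (\<lambda>x. \<lambda>i\<in>{..<d}. x i / norm_dim d x))
       (unit_sphere d)"

text \<open>The value at \<open>0\<close> is a convention; targets take values in \<open>{-1, 1}\<close>.\<close>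

definition sign_pm :: "real \<Rightarrow> real" where
  "sign_pm t = (if t \<ge> 0 then 1 else - 1)"

definition halfspace :: "nat \<Rightarrow> (nat \<Rightarrow> real) \<Rightarrow> (nat \<Rightarrow> real) \<Rightarrow> real" where
  "halfspace d v = (\<lambda>x. sign_pm (\<Sum>i<d. v i * x i))"

definition halfspaces :: "nat \<Rightarrow> ((nat \<Rightarrow> real) \<Rightarrow> real) set" where
  "halfspaces d = halfspace d ` unit_sphere d"


section \<open>Active statistical queries\<close>

text \<open>
  A filter is a function on the domain \<open>X = space D\<close> and a query function is a function on
  \<open>X \<times> {-1, 1}\<close>. Both are kept extensional, so that a responder cannot depend on
  meaningless values outside the domain.
\<close>

definition is_filter :: "'a measure \<Rightarrow> ('a \<Rightarrow> real) \<Rightarrow> bool" where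
  "is_filter D chi \<longleftrightarrow> chi \<in> space D \<rightarrow>\<^sub>E {0..1} \<and> chi \<in> borel_measurable D"

definition is_query_fun :: "'a measure \<Rightarrow> ('a \<times> real \<Rightarrow> real) \<Rightarrow> bool" where
  "is_query_fun D \<phi> \<longleftrightarrow> \<phi> \<in> space D \<times> {-1, 1} \<rightarrow>\<^sub>E {-1..1} \<and>
     (\<forall>l\<in>{-1, 1}. (\<lambda>x. \<phi> (x, l)) \<in> borel_measurable D)"

definition filtered :: "'a measure \<Rightarrow> ('a \<Rightarrow> real) \<Rightarrow> 'a measure" where
  "filtered D chi = density D (\<lambda>x. ennreal (chi x / (LINT y|D. chi y)))"

definition valid_response ::
  "'a measure \<Rightarrow> ('a \<Rightarrow> real) \<Rightarrow> real \<Rightarrow> real \<Rightarrow> ('a \<Rightarrow> real) \<Rightarrow> ('a \<times> real \<Rightarrow> real) \<Rightarrow> real \<Rightarrow> bool"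
where
  "valid_response D f \<tau>0 \<tau> chi \<phi> \<mu> \<longleftrightarrow>
     ((LINT x|D. chi x) \<ge> \<tau>0 \<longrightarrow> \<bar>\<mu> - (LINT x|filtered D chi. \<phi> (x, f x))\<bar> \<le> \<tau>)"

text \<open>
  The responder also sees the position of the query in the run. Since the learner is deterministic,
  its earlier queries and answers are fixed by the responder itself, so quantifying over these
  responders covers every adaptive choice of valid responses, including different answers to a
  repeated query.
\<close>

type_synonym 'a responder = "nat \<Rightarrow> ('a \<Rightarrow> real) \<Rightarrow> ('a \<times> real \<Rightarrow> real) \<Rightarrow> real"

definition valid_responder ::
  "'a measure \<Rightarrow> ('a \<Rightarrow> real) \<Rightarrow> real \<Rightarrow> real \<Rightarrow> 'a responder \<Rightarrow> bool" where
  "valid_responder D f \<tau>0 \<tau> resp \<longleftrightarrow>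
     (\<forall>n chi \<phi>. is_filter D chi \<and> is_query_fun D \<phi> \<longrightarrow> valid_response D f \<tau>0 \<tau> chi \<phi> (resp n chi \<phi>))"


section \<open>Real RAM programs\<close>

text \<open>
  Algorithms are programs of a real RAM: natural-number variables (used for counting and
  addressing), real variables and a real memory, with exact unit-cost arithmetic. There is no
  multiplication of naturals and no rounding from reals to naturals, and constants are rational; this
  rules out the usual abuses of unit cost by packing data into large numbers or constants.

  Besides its own store a program can read \<open>Point\<close> and \<open>Label\<close>; these hold the example while a
  filter, query function or hypothesis is being evaluated, and are \<open>0\<close> in the learner itself.
\<close>

datatype iexp = INum nat | IVar nat | IAdd iexp iexp | ISub iexp iexp

datatype rexp = RNum rat | RVar nat | Mem iexp | Point iexp | Label | OfNat iexp
  | RAdd rexp rexp | RSub rexp rexp | RMul rexp rexp | RDiv rexp rexp | RSqrt rexp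

datatype bexp = ILess iexp iexp | RLess rexp rexp | Neg bexp | Conj bexp bexp

text \<open>\<open>Ask r q\<close> puts the answer to the query \<open>q\<close> into the real variable \<open>r\<close>.\<close>

datatype 'q com = Skip
  | ISet nat iexp
  | RSet nat rexp
  | Store iexp rexp
  | Seq "'q com" "'q com"
  | If bexp "'q com" "'q com"
  | While bexp "'q com"
  | Ask nat 'q

text \<open>\<open>asked\<close> counts the queries made so far; programs have no access to it.\<close>

record state =
  ivar :: "nat \<Rightarrow> nat"
  rvar :: "nat \<Rightarrow> real"
  mem :: "nat \<Rightarrow> real"
  point :: "nat \<Rightarrow> real"
  label :: real
  asked :: nat

primrec ieval :: "iexp \<Rightarrow> state \<Rightarrow> nat" where
  "ieval (INum n) s = n"
| "ieval (IVar i) s = ivar s i"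
| "ieval (IAdd a b) s = ieval a s + ieval b s"
| "ieval (ISub a b) s = ieval a s - ieval b s"

primrec reval :: "rexp \<Rightarrow> state \<Rightarrow> real" where
  "reval (RNum c) s = of_rat c"
| "reval (RVar i) s = rvar s i"
| "reval (Mem a) s = mem s (ieval a s)"
| "reval (Point a) s = point s (ieval a s)"
| "reval Label s = label s"
| "reval (OfNat a) s = real (ieval a s)"
| "reval (RAdd a b) s = reval a s + reval b s"
| "reval (RSub a b) s = reval a s - reval b s"
| "reval (RMul a b) s = reval a s * reval b s"
| "reval (RDiv a b) s = reval a s / reval b s"
| "reval (RSqrt a) s = sqrt (reval a s)"

primrec beval :: "bexp \<Rightarrow> state \<Rightarrow> bool" where
  "beval (ILess a b) s \<longleftrightarrow> ieval a s < ieval b s"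
| "beval (RLess a b) s \<longleftrightarrow> reval a s < reval b s"
| "beval (Neg b) s \<longleftrightarrow> \<not> beval b s"
| "beval (Conj a b) s \<longleftrightarrow> beval a s \<and> beval b s"

text \<open>
  \<open>exec ans c s t s'\<close>: started in \<open>s\<close>, the program \<open>c\<close> halts in \<open>s'\<close> after \<open>t\<close> steps, where \<open>ans q s \<mu>\<close>
  says that \<open>\<mu>\<close> is the answer to \<open>q\<close> in state \<open>s\<close>. One step is one basic command or test;
  the expressions of a program have fixed size, so counting single operations
  would change the time only by a constant factor.
\<close>

inductive exec :: "('q \<Rightarrow> state \<Rightarrow> real \<Rightarrow> bool) \<Rightarrow> 'q com \<Rightarrow> state \<Rightarrow> nat \<Rightarrow> state \<Rightarrow> bool"
  for ans :: "'q \<Rightarrow> state \<Rightarrow> real \<Rightarrow> bool"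
where
  Skip: "exec ans Skip s 1 s"
| ISet: "exec ans (ISet i a) s 1 (s\<lparr>ivar := (ivar s)(i := ieval a s)\<rparr>)"
| RSet: "exec ans (RSet i a) s 1 (s\<lparr>rvar := (rvar s)(i := reval a s)\<rparr>)"
| Store: "exec ans (Store a b) s 1 (s\<lparr>mem := (mem s)(ieval a s := reval b s)\<rparr>)"
| Seq: "exec ans c1 s t1 s1 \<Longrightarrow> exec ans c2 s1 t2 s2 \<Longrightarrow> exec ans (Seq c1 c2) s (t1 + t2) s2"
| IfTrue: "beval b s \<Longrightarrow> exec ans c1 s t s' \<Longrightarrow> exec ans (If b c1 c2) s (t + 1) s'"
| IfFalse: "\<not> beval b s \<Longrightarrow> exec ans c2 s t s' \<Longrightarrow> exec ans (If b c1 c2) s (t + 1) s'"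
| WhileTrue: "beval b s \<Longrightarrow> exec ans c s t1 s1 \<Longrightarrow> exec ans (While b c) s1 t2 s2 \<Longrightarrow>
    exec ans (While b c) s (t1 + t2 + 1) s2"
| WhileFalse: "\<not> beval b s \<Longrightarrow> exec ans (While b c) s 1 s"
| Ask: "ans q s \<mu> \<Longrightarrow>
    exec ans (Ask i q) s 1 (s\<lparr>rvar := (rvar s)(i := \<mu>), asked := Suc (asked s)\<rparr>)"

lemma exec_deterministic:
  assumes det: "\<And>q s \<mu> \<nu>. ans q s \<mu> \<Longrightarrow> ans q s \<nu> \<Longrightarrow> \<mu> = \<nu>"
  shows "exec ans c s t s' \<Longrightarrow> exec ans c s u s'' \<Longrightarrow> t = u \<and> s' = s''"
proof (induction arbitrary: u s'' rule: exec.induct)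
  case (Ask q s \<mu> i)
  from Ask.prems Ask.hyps show ?case by cases (auto dest: det)
next
  case (Seq c1 s t1 s1 c2 t2 s2)
  from Seq.prems show ?case by cases (metis Seq.IH)
next
  case (IfTrue b s c1 t s' c2)
  from IfTrue.prems show ?case by cases (use IfTrue in blast)+
next
  case (IfFalse b s c2 t s' c1)
  from IfFalse.prems show ?case by cases (use IfFalse in blast)+
next
  case (WhileTrue b s c t1 s1 t2 s2)
  note IH1 = WhileTrue.IH(1) and IH2 = WhileTrue.IH(2)
  from WhileTrue.prems show ?case
  proof cases
    case (WhileTrue u1 r1 u2)
    then show ?thesis by (metis IH1 IH2)
  qed (use WhileTrue.hyps(1) in blast)
next
  case (WhileFalse b s c)
  from WhileFalse.prems show ?case by cases (use WhileFalse.hyps in blast)+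
qed (erule exec.cases; simp)+


section \<open>Active statistical algorithms\<close>

text \<open>
  Filters, query functions and hypotheses are given by programs without queries, evaluated on
  a snapshot of the learner's store and the example; the result is read from real variable \<open>0\<close>.
  Posting a query therefore takes one step, as the function refers to the current store
  instead of being written out. Each single evaluation must halt within the bound \<open>B\<close>,
  which prevents the learner from moving its computation into these functions.
\<close>

type_synonym func = "unit com"

definition returns ::
  "real \<Rightarrow> func \<Rightarrow> state \<Rightarrow> (nat \<Rightarrow> real) \<Rightarrow> real \<Rightarrow> real \<Rightarrow> bool" where
  "returns B F s x l y \<longleftrightarrow>
     (\<exists>t s'. exec (\<lambda>_ _ _. False) F (s\<lparr>point := x, label := l\<rparr>) t s' \<and> real t \<le> B \<and> rvar s' 0 = y)"

definition answer ::
  "(nat \<Rightarrow> real) measure \<Rightarrow> real \<Rightarrow> (nat \<Rightarrow> real) responder \<Rightarrow> func \<times> func \<Rightarrow> state \<Rightarrow> real \<Rightarrow> bool"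
where
  "answer D B resp q s \<mu> \<longleftrightarrow>
     (\<exists>chi \<phi>. is_filter D chi \<and> (\<forall>x\<in>space D. returns B (fst q) s x 0 (chi x)) \<and>
        is_query_fun D \<phi> \<and> (\<forall>x\<in>space D. \<forall>l\<in>{-1, 1}. returns B (snd q) s x l (\<phi> (x, l))) \<and>
        \<mu> = resp (asked s) chi \<phi>)"

lemma returns_unique: "returns B F s x l y \<Longrightarrow> returns B F s x l z \<Longrightarrow> y = z"
  unfolding returns_def by (blast dest: exec_deterministic[rotated])

lemma answer_unique:
  assumes "answer D B resp q s \<mu>" "answer D B resp q s \<nu>"
  shows "\<mu> = \<nu>"
proof -
  obtain chi \<phi> where 1: "is_filter D chi" "\<forall>x\<in>space D. returns B (fst q) s x 0 (chi x)"
    "is_query_fun D \<phi>" "\<forall>x\<in>space D. \<forall>l\<in>{-1, 1}. returns B (snd q) s x l (\<phi> (x, l))"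
    "\<mu> = resp (asked s) chi \<phi>" using assms(1) unfolding answer_def by blast
  obtain chi' \<phi>' where 2: "is_filter D chi'" "\<forall>x\<in>space D. returns B (fst q) s x 0 (chi' x)"
    "is_query_fun D \<phi>'" "\<forall>x\<in>space D. \<forall>l\<in>{-1, 1}. returns B (snd q) s x l (\<phi>' (x, l))"
    "\<nu> = resp (asked s) chi' \<phi>'" using assms(2) unfolding answer_def by blast
  have "chi = chi'"
    using 1(1) 2(1) 1(2) 2(2) unfolding is_filter_def
    by (metis PiE_ext returns_unique)
  moreover have "\<phi> z = \<phi>' z" if "z \<in> space D \<times> {-1, 1}" for z
    using that 1(4) 2(4) returns_unique by fast
  then have "\<phi> = \<phi>'"
    using 1(3) 2(3) unfolding is_query_fun_def by (metis PiE_ext)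
  ultimately show ?thesis using 1(5) 2(5) by simp
qed

text \<open>A learner is a program asking queries \<open>(filter, query function)\<close>, with an output hypothesis.\<close>

type_synonym active_SQ_alg = "(func \<times> func) com \<times> func"

definition init_state :: "nat \<Rightarrow> real \<Rightarrow> state" where
  "init_state d \<epsilon> = \<lparr>ivar = (\<lambda>_. 0)(0 := d), rvar = (\<lambda>_. 0)(0 := \<epsilon>), mem = (\<lambda>_. 0),
     point = (\<lambda>_. 0), label = 0, asked = 0\<rparr>"

text \<open>
  On input \<open>d\<close>, \<open>\<epsilon>\<close> the algorithm learns \<open>C\<close> over \<open>D\<close> to accuracy \<open>1 - \<epsilon>\<close> with filter tolerance \<open>\<tau>0\<close>,
  query tolerance \<open>\<tau>\<close>, at most \<open>q\<close> queries and time at most \<open>T\<close>. A run that poses an ill-formed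
  query has no continuation, so the existence of a halting run excludes this; the run is unique by
  \<open>exec_deterministic\<close> and \<open>answer_unique\<close>.
\<close>

definition learns ::
  "active_SQ_alg \<Rightarrow> nat \<Rightarrow> (nat \<Rightarrow> real) measure \<Rightarrow> ((nat \<Rightarrow> real) \<Rightarrow> real) set \<Rightarrow>
    real \<Rightarrow> real \<Rightarrow> real \<Rightarrow> real \<Rightarrow> real \<Rightarrow> bool"
where
  "learns A d D C \<epsilon> \<tau>0 \<tau> q T \<longleftrightarrow>
     (\<forall>f\<in>C. \<forall>resp. valid_responder D f \<tau>0 \<tau> resp \<longrightarrow>
        (\<exists>t s h. exec (answer D T resp) (fst A) (init_state d \<epsilon>) t s \<and>
           real t \<le> T \<and> real (asked s) \<le> q \<and>
           h \<in> space D \<rightarrow> {-1, 1} \<and> h \<in> borel_measurable D \<and>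
           (\<forall>x\<in>space D. returns T (snd A) s x 0 (h x)) \<and>
           measure D {x \<in> space D. h x \<noteq> f x} \<le> \<epsilon>))"

end

theory Submission imports Defs begin

text \<open>
  The hypothesis \<open>w\<close> is improved in rounds of \<open>d\<close> queries, one per coordinate. A round filters the
  sphere to a band of half-width of order \<open>e / sqrt d\<close> around the equator of \<open>w\<close>, where \<open>e\<close> is
  the current accuracy, and asks for the correlations of the label with the coordinates of \<open>y\<close>, the
  normalised projection of the point orthogonal to \<open>w\<close>, scaled by \<open>sqrt d\<close> and clipped to a
  constant. Write \<open>x = (t w + y) / sqrt (1 + t\<^sup>2)\<close>: then \<open>t\<close> and \<open>y\<close> are independent and \<open>t\<close>
  has density proportional to \<open>(1 + t\<^sup>2) powr (-d / 2)\<close>, nearly constant on the band, so averaging the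
  label over \<open>t\<close> gives nearly a linear function of \<open>y\<close>. The answers are therefore nearly
  proportional, with a known factor, to \<open>v / cos \<theta> - w\<close> for the target \<open>v\<close> at angle \<open>\<theta>\<close>. Errors of
  order \<open>1 / sqrt d\<close> in each answer add up to a small multiple of \<open>e\<close>, and adding the rescaled
  answers to \<open>w\<close> and normalising halves the distance to \<open>v\<close>.

  The clipping is harmless because the law of \<open>y\<close> is invariant under reflections: symmetrising in the
  part of a coordinate uncorrelated with the label leaves an error controlled by fourth moments.
\<close>


text \<open>Query functions are bounded by one and the tolerance is of order
  \<open>1 / sqrt d\<close>, the typical size of a coordinate. A coordinate therefore has to be
  scaled up to constant size, where it is unbounded, and clipping is forced. Every systematic error
  is then proved relative to the true correlation of the same coordinate, so that passing to norms
  costs no power of \<open>d\<close>; only the tolerance enters as an absolute error. In the first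
  round there is no hypothesis and no band. Its answers are proportional to the target with a factor
  that is never computed, only bounded below; normalising removes it. In later rounds the division
  by the band mass cancels the normalising constant of the law of \<open>t\<close>, which leaves a
  factor that the learner knows. The query budget has no room for spare rounds: \<open>e\<close>
  starts at 1 and the loop ends once \<open>e < 2 * \<epsilon>\<close>, which is at most
  \<open>log 2 (1 / \<epsilon>)\<close> rounds. The invariant is a distance of at most
  \<open>e / 10 ^ 4\<close>, far below the band width \<open>e / 10\<close> (in units of
  \<open>1 / sqrt n\<close>), so that the averaged label is rarely saturated.\<close>

section \<open>Inner products, norms and reflections of extensional vectors\<close>

definition dot :: "nat \<Rightarrow> (nat \<Rightarrow> real) \<Rightarrow> (nat \<Rightarrow> real) \<Rightarrow> real" where
  "dot d a x = (\<Sum>i<d. a i * x i)"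

text \<open>The map in the definition of \<open>uniform_sphere\<close>. Division by zero sends the
  origin to the zero vector, off the sphere; in positive dimension this concerns a null set
  only.\<close>

definition direction :: "nat \<Rightarrow> (nat \<Rightarrow> real) \<Rightarrow> nat \<Rightarrow> real" where
  "direction d x = (\<lambda>i\<in>{..<d}. x i / norm_dim d x)"

text \<open>Reflections stand in for the orthogonal group: a single one carries a unit vector to any
  other, and each is self-adjoint, so it can be moved from one argument of \<open>dot\<close> to the
  other.\<close>

definition reflection :: "nat \<Rightarrow> (nat \<Rightarrow> real) \<Rightarrow> (nat \<Rightarrow> real) \<Rightarrow> nat \<Rightarrow> real" where
  "reflection d a x = (\<lambda>i\<in>{..<d}. x i - 2 * a i * dot d a x)"

lemma dot_commute: "dot d a b = dot d b a"
  by (simp add: dot_def mult.commute)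

lemma dot_cong: "(\<And>i. i < d \<Longrightarrow> a i = a' i) \<Longrightarrow> (\<And>i. i < d \<Longrightarrow> b i = b' i) \<Longrightarrow> dot d a b = dot d a' b'"
  by (simp add: dot_def)

lemma dot_add_left: "dot d (\<lambda>i. a i + b i) x = dot d a x + dot d b x"
  by (simp add: dot_def sum.distrib ring_distribs)

lemma dot_diff_left: "dot d (\<lambda>i. a i - b i) x = dot d a x - dot d b x"
  by (simp add: dot_def sum_subtractf ring_distribs)

lemma dot_scale_left: "dot d (\<lambda>i. c * a i) x = c * dot d a x"
  by (simp add: dot_def sum_distrib_left mult.assoc)

lemma dot_add_right: "dot d x (\<lambda>i. a i + b i) = dot d x a + dot d x b"
  by (simp add: dot_def sum.distrib ring_distribs)

lemma dot_diff_right: "dot d x (\<lambda>i. a i - b i) = dot d x a - dot d x b"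
  by (simp add: dot_def sum_subtractf ring_distribs)

lemma dot_scale_right: "dot d x (\<lambda>i. c * a i) = c * dot d x a"
  by (simp add: dot_def sum_distrib_left mult_ac)

lemma dot_divide_right: "dot d x (\<lambda>i. a i / c) = dot d x a / c"
  by (simp add: dot_def sum_divide_distrib)

lemmas dot_linear = dot_add_left dot_diff_left dot_scale_left dot_add_right dot_diff_right
  dot_scale_right dot_divide_right

lemma dot_restrict [simp]: "dot d a (restrict b {..<d}) = dot d a b"
  "dot d (restrict a {..<d}) b = dot d a b"
  by (simp_all add: dot_def)

lemma dot_self_nonneg [simp]: "dot d a a \<ge> 0"
  by (simp add: dot_def sum_nonneg)

lemma norm_dim_eq: "norm_dim d x = sqrt (dot d x x)"
  by (simp add: norm_dim_def dot_def power2_eq_square)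

lemma norm_dim_nonneg [simp]: "norm_dim d x \<ge> 0"
  by (simp add: norm_dim_eq)

lemma norm_dim_square: "(norm_dim d x)\<^sup>2 = dot d x x"
  by (simp add: norm_dim_eq)

lemma norm_dim_eq_1_iff: "norm_dim d x = 1 \<longleftrightarrow> dot d x x = 1"
  by (simp add: norm_dim_eq)

lemma norm_dim_restrict [simp]: "norm_dim d (restrict x {..<d}) = norm_dim d x"
  by (simp add: norm_dim_eq)

lemma dot_direction: "dot d a (direction d x) = dot d a x / norm_dim d x"
  by (simp add: direction_def dot_divide_right)

lemma norm_dim_scale: "norm_dim d (\<lambda>i. c * x i) = \<bar>c\<bar> * norm_dim d x"
  by (simp add: norm_dim_eq dot_linear real_sqrt_mult)

lemma abs_dot_le: "\<bar>dot d a b\<bar> \<le> norm_dim d a * norm_dim d b"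
proof -
  have "\<bar>dot d a b\<bar> \<le> (\<Sum>i<d. \<bar>a i\<bar> * \<bar>b i\<bar>)"
    unfolding dot_def by (rule order_trans[OF sum_abs]) (simp add: abs_mult)
  also have "\<dots> \<le> L2_set a {..<d} * L2_set b {..<d}"
    by (rule L2_set_mult_ineq)
  finally show ?thesis by (simp add: norm_dim_def L2_set_def)
qed

lemma norm_dim_triangle: "norm_dim d (\<lambda>i. x i + y i) \<le> norm_dim d x + norm_dim d y"
  using L2_set_triangle_ineq[of x y "{..<d}"] by (simp add: norm_dim_def L2_set_def)

lemma norm_dim_zero_iff: "norm_dim d x = 0 \<longleftrightarrow> (\<forall>i<d. x i = 0)"
  by (auto simp: norm_dim_def sum_nonneg_eq_0_iff)

lemma abs_le_norm_dim: "i < d \<Longrightarrow> \<bar>x i\<bar> \<le> norm_dim d x"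
  using member_le_L2_set[of "{..<d}" i "\<lambda>i. \<bar>x i\<bar>"] by (simp add: norm_dim_def L2_set_def)

lemma norm_direction: "norm_dim d x \<noteq> 0 \<Longrightarrow> norm_dim d (direction d x) = 1"
  unfolding direction_def norm_dim_restrict
  using norm_dim_scale[of d "1 / norm_dim d x" x] by simp

section \<open>Invariance of Lebesgue measure under reflections\<close>

lemma sets_lborel_dim [measurable_cong]: "sets (lborel_dim d) = sets (\<Pi>\<^sub>M i\<in>{..<d}. borel)"
  unfolding lborel_dim_def by (intro sets_PiM_cong) auto

lemma space_lborel_dim: "space (lborel_dim d) = extensional {..<d}"
  by (simp add: lborel_dim_def space_PiM PiE_UNIV_domain extensional_def PiE_def)

lemma measurable_component_lborel_dim [measurable]: "i < d \<Longrightarrow> (\<lambda>x. x i) \<in> borel_measurable (lborel_dim d)"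
  unfolding lborel_dim_def by measurable

lemma measurable_dot [measurable]: "(\<lambda>x. dot d a x) \<in> borel_measurable (lborel_dim d)"
  unfolding dot_def by measurable

lemma measurable_norm_dim [measurable]: "norm_dim d \<in> borel_measurable (lborel_dim d)"
  unfolding norm_dim_def[abs_def] by measurable

lemma measurable_restrict_lborel_dim:
  "(\<And>i. i < d \<Longrightarrow> (\<lambda>x. f x i) \<in> borel_measurable M) \<Longrightarrow> (\<lambda>x. \<lambda>i\<in>{..<d}. f x i) \<in> measurable M (lborel_dim d)"
  unfolding lborel_dim_def by (intro measurable_restrict) auto

lemma measurable_direction [measurable]: "direction d \<in> measurable (lborel_dim d) (lborel_dim d)"
  unfolding direction_def[abs_def] by (intro measurable_restrict_lborel_dim) measurable

lemma measurable_reflection [measurable]: "reflection d a \<in> measurable (lborel_dim d) (lborel_dim d)"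
  unfolding reflection_def[abs_def] by (intro measurable_restrict_lborel_dim) measurable

interpretation PL: product_sigma_finite "\<lambda>_::nat. lborel :: real measure"
  by standard

lemma sigma_finite_lborel_dim: "sigma_finite_measure (lborel_dim d)"
  unfolding lborel_dim_def by (rule PL.sigma_finite) simp

lemma nn_integral_lborel_dim_fun_upd:
  assumes "j < d" and f: "f \<in> borel_measurable (lborel_dim d)"
  shows "(\<integral>\<^sup>+x. f x \<partial>lborel_dim d) =
    (\<integral>\<^sup>+x. (\<integral>\<^sup>+t. f (x(j := t)) \<partial>lborel) \<partial>(\<Pi>\<^sub>M i\<in>{..<d} - {j}. lborel))"
proof -
  have "{..<d} = insert j ({..<d} - {j})" using assms by auto
  then show ?thesis
    using PL.product_nn_integral_insert[of "{..<d} - {j}" j f] f by (simp add: lborel_dim_def)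
qed

lemma measurable_fun_upd_lborel_dim:
  assumes "j < d" "x \<in> space (\<Pi>\<^sub>M i\<in>{..<d} - {j}. (lborel :: real measure))"
  shows "(\<lambda>t. x(j := t)) \<in> measurable borel (lborel_dim d)"
proof -
  have *: "x(j := t) = (\<lambda>i\<in>{..<d}. if i = j then t else x i)" for t
    using assms by (auto simp: fun_eq_iff space_PiM PiE_def extensional_def)
  show ?thesis unfolding * by (intro measurable_restrict_lborel_dim) auto
qed

definition preserves_lborel :: "nat \<Rightarrow> ((nat \<Rightarrow> real) \<Rightarrow> (nat \<Rightarrow> real)) \<Rightarrow> bool" where
  "preserves_lborel d S \<longleftrightarrow> S \<in> measurable (lborel_dim d) (lborel_dim d) \<and>
     distr (lborel_dim d) (lborel_dim d) S = lborel_dim d"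

lemma preserves_lborel_comp:
  assumes "preserves_lborel d S" "preserves_lborel d T"
  shows "preserves_lborel d (S \<circ> T)"
  using assms distr_distr[of S "lborel_dim d" "lborel_dim d" T "lborel_dim d"]
  by (auto simp: preserves_lborel_def intro: measurable_comp)

lemma preserves_lborel_cong:
  assumes "preserves_lborel d S" "\<And>x. x \<in> extensional {..<d} \<Longrightarrow> S x = T x"
  shows "preserves_lborel d T"
  using assms measurable_cong[of "lborel_dim d" S T "lborel_dim d"]
    distr_cong[of "lborel_dim d" "lborel_dim d" "lborel_dim d" "lborel_dim d" S T]
  by (auto simp: preserves_lborel_def space_lborel_dim)

text \<open>With the other coordinates fixed, the map is affine in coordinate \<open>j\<close> with
  slope \<open>c\<close> of modulus one, since \<open>g\<close> ignores that coordinate. Isolating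
  this coordinate by Tonelli reduces the claim to one-dimensional Lebesgue measure.\<close>

lemma preserves_lborel_shear:
  assumes "j < d" and c: "\<bar>c\<bar> = 1" and g: "g \<in> borel_measurable (lborel_dim d)"
    and indep: "\<And>x t. g (x(j := t)) = g x"
  shows "preserves_lborel d (\<lambda>x. x(j := c * x j + g x))" (is "preserves_lborel d ?S")
proof -
  have *: "?S x = (\<lambda>i\<in>{..<d}. if i = j then c * x j + g x else x i)" if "x \<in> extensional {..<d}" for x
    using that \<open>j < d\<close> by (auto simp: fun_eq_iff extensional_def)
  have "(\<lambda>x. \<lambda>i\<in>{..<d}. if i = j then c * x j + g x else x i) \<in> measurable (lborel_dim d) (lborel_dim d)"
    by (rule measurable_restrict_lborel_dim) (use \<open>j < d\<close> g in measurable)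
  then have [measurable]: "?S \<in> measurable (lborel_dim d) (lborel_dim d)"
    by (subst measurable_cong[where g="\<lambda>x. \<lambda>i\<in>{..<d}. if i = j then c * x j + g x else x i"])
      (auto simp: * space_lborel_dim)
  have "distr (lborel_dim d) (lborel_dim d) ?S = lborel_dim d"
  proof (rule measure_eqI)
    fix A assume "A \<in> sets (distr (lborel_dim d) (lborel_dim d) ?S)"
    then have A [measurable]: "A \<in> sets (lborel_dim d)" by simp
    let ?f = "indicator A :: _ \<Rightarrow> ennreal"
    have "emeasure (distr (lborel_dim d) (lborel_dim d) ?S) A =
        (\<integral>\<^sup>+x. ?f x \<partial>distr (lborel_dim d) (lborel_dim d) ?S)" by simp
    also have "\<dots> = (\<integral>\<^sup>+x. ?f (?S x) \<partial>lborel_dim d)"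
      by (rule nn_integral_distr) simp_all
    also have "\<dots> = (\<integral>\<^sup>+x. (\<integral>\<^sup>+t. ?f (x(j := g x + c * t)) \<partial>lborel) \<partial>(\<Pi>\<^sub>M i\<in>{..<d} - {j}. lborel))"
      by (subst nn_integral_lborel_dim_fun_upd[OF \<open>j < d\<close>], measurable) (simp add: indep add.commute)
    also have "\<dots> = (\<integral>\<^sup>+x. (\<integral>\<^sup>+t. ?f (x(j := t)) \<partial>lborel) \<partial>(\<Pi>\<^sub>M i\<in>{..<d} - {j}. lborel))"
    proof (rule nn_integral_cong)
      fix x assume x: "x \<in> space (\<Pi>\<^sub>M i\<in>{..<d} - {j}. (lborel :: real measure))"
      have [measurable]: "(\<lambda>t. ?f (x(j := t))) \<in> borel_measurable borel"
        using measurable_fun_upd_lborel_dim[OF \<open>j < d\<close> x] by measurable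
      show "(\<integral>\<^sup>+t. ?f (x(j := g x + c * t)) \<partial>lborel) = (\<integral>\<^sup>+t. ?f (x(j := t)) \<partial>lborel)"
        using nn_integral_real_affine[of "\<lambda>t. ?f (x(j := t))" c "g x"] c by (cases "c = 0") auto
    qed
    also have "\<dots> = emeasure (lborel_dim d) A"
      by (subst nn_integral_lborel_dim_fun_upd[OF \<open>j < d\<close>, symmetric]) simp_all
    finally show "emeasure (distr (lborel_dim d) (lborel_dim d) ?S) A = emeasure (lborel_dim d) A" .
  qed simp
  then show ?thesis by (simp add: preserves_lborel_def)
qed

text \<open>A composition of single shears: none of them changes coordinate \<open>j\<close>, the
  only one they read besides their own.\<close>

lemma preserves_lborel_shears:
  assumes "j < d" "finite J" "J \<subseteq> {..<d} - {j}"
  shows "preserves_lborel d (\<lambda>x i. if i \<in> J then x i + c i * x j else x i)"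
  using assms(2,3)
proof induction
  case empty
  then show ?case by (simp add: preserves_lborel_def distr_id)
next
  case (insert k J)
  have k: "k < d" "k \<noteq> j" "j \<notin> J" using insert by auto
  have "preserves_lborel d (\<lambda>x. x(k := 1 * x k + c k * x j))"
    by (rule preserves_lborel_shear) (use k \<open>j < d\<close> in auto)
  from preserves_lborel_comp[OF this insert.IH] insert.prems
  have "preserves_lborel d ((\<lambda>x. x(k := 1 * x k + c k * x j)) \<circ> (\<lambda>x i. if i \<in> J then x i + c i * x j else x i))"
    by auto
  moreover have "(\<lambda>x. x(k := 1 * x k + c k * x j)) \<circ> (\<lambda>x i. if i \<in> J then x i + c i * x j else x i) =
     (\<lambda>x i. if i \<in> insert k J then x i + c i * x j else x i)"
    using k insert.hyps by (auto simp: fun_eq_iff)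
  ultimately show ?case by simp
qed

text \<open>With \<open>a j \<noteq> 0\<close>, the shear subtracting multiples of coordinate \<open>j\<close> from the others sends \<open>a\<close>
  to a multiple of the \<open>j\<close>-th unit vector, so it conjugates the reflection into a map that only
  changes coordinate \<open>j\<close>.\<close>

lemma preserves_lborel_reflection:
  assumes a: "norm_dim d a = 1"
  shows "preserves_lborel d (reflection d a)"
proof -
  obtain j where j: "j < d" "a j \<noteq> 0"
    using a norm_dim_zero_iff[of d a] by auto
  have split: "dot d a x = a j * x j + (\<Sum>i\<in>{..<d} - {j}. a i * x i)" for x
    unfolding dot_def using j by (subst sum.remove[of _ j]) auto
  have sq: "(\<Sum>i\<in>{..<d} - {j}. a i * a i) = 1 - a j * a j"
    using split[of a] a by (simp add: norm_dim_eq_1_iff)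
  define S where "S c = (\<lambda>x i. if i \<in> {..<d} - {j} then x i + c * (a i / a j) * x j else (x i :: real))" for c
  \<comment> \<open>Obtained by solving \<open>reflection d a = S 1 o T o S (-1)\<close> for
    \<open>T\<close>: because \<open>a\<close> has norm one, the inner product of \<open>a\<close>
    with \<open>S 1 x\<close> is the sum below plus \<open>x j / a j\<close>, and subtracting
    \<open>2 * a j\<close> times this from \<open>x j\<close> leaves slope -1.\<close>
  define T where "T = (\<lambda>x. x(j := -1 * x j + -2 * a j * (\<Sum>i\<in>{..<d} - {j}. a i * x i)))"
  have S: "preserves_lborel d (S c)" for c
    unfolding S_def using preserves_lborel_shears[OF j(1), of "{..<d} - {j}" "\<lambda>i. c * (a i / a j)"] by simp
  have T: "preserves_lborel d T"
    unfolding T_def by (rule preserves_lborel_shear) (use j in auto)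
  have "preserves_lborel d (S 1 \<circ> T \<circ> S (-1))"
    by (intro preserves_lborel_comp S T)
  moreover have "(S 1 \<circ> T \<circ> S (-1)) x = reflection d a x" if x: "x \<in> extensional {..<d}" for x
  proof -
    let ?s = "\<Sum>i\<in>{..<d} - {j}. a i * x i"
    have "(\<Sum>i\<in>{..<d} - {j}. a i * S (-1) x i) = (\<Sum>i\<in>{..<d} - {j}. a i * x i - x j / a j * (a i * a i))"
      by (rule sum.cong) (auto simp: S_def algebra_simps)
    also have "\<dots> = ?s - x j / a j * (1 - a j * a j)"
      by (simp only: sum_subtractf sum_distrib_left[symmetric] sq)
    finally have 1: "(\<Sum>i\<in>{..<d} - {j}. a i * S (-1) x i) = ?s - x j / a j * (1 - a j * a j)" .
    have 2: "T (S (-1) x) = (S (-1) x)(j := x j - 2 * a j * dot d a x)"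
      unfolding T_def 1 split using j by (auto simp: S_def fun_eq_iff field_simps)
    show ?thesis
    proof
      fix i show "(S 1 \<circ> T \<circ> S (-1)) x i = reflection d a x i"
        using x j unfolding o_def 2
        by (cases "i = j"; cases "i < d") (auto simp: S_def reflection_def extensional_def field_simps)
    qed
  qed
  ultimately show ?thesis by (rule preserves_lborel_cong)
qed

lemma dot_reflection_left: "dot d b (reflection d a x) = dot d b x - 2 * dot d a b * dot d a x"
proof -
  have "dot d b (reflection d a x) = dot d b (\<lambda>i. x i - (2 * dot d a x) * a i)"
    unfolding reflection_def dot_restrict by (simp add: mult_ac)
  then show ?thesis by (simp only: dot_linear) (simp add: dot_commute[of d a b] mult_ac)
qed

lemma dot_reflection_move: "dot d b (reflection d a x) = dot d (reflection d a b) x"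
  by (simp add: dot_reflection_left dot_commute[of d "reflection d a b"] dot_commute)

lemma dot_reflection_reflection:
  assumes "norm_dim d a = 1"
  shows "dot d (reflection d a x) (reflection d a y) = dot d x y"
  using assms unfolding dot_reflection_left dot_commute[of d _ y]
  by (simp add: dot_reflection_left norm_dim_eq_1_iff dot_commute algebra_simps)

lemma norm_reflection: "norm_dim d a = 1 \<Longrightarrow> norm_dim d (reflection d a x) = norm_dim d x"
  by (simp add: norm_dim_eq[of d x] norm_dim_eq[of d "reflection d a x"] dot_reflection_reflection)

text \<open>The mirror is the perpendicular bisector of \<open>v\<close> and \<open>w\<close>. Both
  have norm one, so the component of \<open>v\<close> along the normal is half their
  distance.\<close>

lemma exists_reflection:
  assumes "norm_dim d v = 1" "norm_dim d w = 1" "v \<in> extensional {..<d}" "w \<in> extensional {..<d}" "v \<noteq> w"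
  obtains a where "norm_dim d a = 1" "reflection d a v = w"
proof -
  let ?n = "norm_dim d (\<lambda>i. v i - w i)"
  define a where "a = (\<lambda>i. 1 / ?n * (v i - w i))"
  have n0: "?n \<noteq> 0"
    using assms(3-5) extensionalityI[of v "{..<d}" w] by (auto simp: norm_dim_zero_iff)
  have n: "?n\<^sup>2 = 2 - 2 * dot d v w"
    unfolding norm_dim_square dot_linear using assms(1,2) by (simp add: norm_dim_eq_1_iff dot_commute)
  have "norm_dim d a = 1" unfolding a_def norm_dim_scale using n0 by simp
  moreover have "dot d a v = ?n / 2"
  proof -
    have "dot d a v = (1 - dot d v w) / ?n"
      unfolding a_def dot_linear using assms(1) by (simp add: norm_dim_eq_1_iff dot_commute)
    also have "\<dots> = ?n\<^sup>2 / 2 / ?n" unfolding n by (simp add: diff_divide_distrib)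
    also have "\<dots> = ?n / 2" using n0 by (simp add: power2_eq_square)
    finally show ?thesis .
  qed
  then have "reflection d a v = (\<lambda>i\<in>{..<d}. v i - a i * ?n)"
    unfolding reflection_def by (auto simp: fun_eq_iff)
  then have "reflection d a v = w"
    using n0 assms(3,4) by (auto simp: fun_eq_iff a_def extensional_def)
  ultimately show ?thesis using that by blast
qed

lemma direction_reflection:
  assumes "norm_dim d a = 1"
  shows "direction d (reflection d a x) = reflection d a (direction d x)"
proof
  fix i show "direction d (reflection d a x) i = reflection d a (direction d x) i"
    unfolding direction_def[of d "reflection d a x"] reflection_def[of d a "direction d x"]
      norm_reflection[OF assms] dot_direction
    by (auto simp: direction_def reflection_def diff_divide_distrib)
qed

section \<open>Rotation-invariant laws on the sphere\<close>

definition unit_vec :: "nat \<Rightarrow> nat \<Rightarrow> real" where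
  "unit_vec i = (\<lambda>j. if j = i then 1 else 0)"

lemma dot_unit_vec: assumes "i < n" shows "dot n (unit_vec i) x = x i"
proof -
  have "dot n (unit_vec i) x = (\<Sum>j<n. if j = i then x j else 0)"
    unfolding dot_def unit_vec_def by (intro sum.cong) auto
  then show ?thesis using \<open>i < n\<close> by simp
qed

lemma norm_unit_vec: "i < n \<Longrightarrow> norm_dim n (unit_vec i) = 1"
  by (simp add: norm_dim_eq_1_iff dot_unit_vec) (simp add: unit_vec_def)

text \<open>What the law of the sphere and the law of its equator share, so that moments and
  clipping estimates are proved once for both. The laws live on the whole product space, hence the
  norm condition only almost everywhere.\<close>

locale rotation_invariant = prob_space M for M :: "(nat \<Rightarrow> real) measure" and n :: nat +
  assumes sets_eq [measurable_cong]: "sets M = sets (lborel_dim n)"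
    and AE_norm: "AE x in M. norm_dim n x = 1"
    and distr_reflection: "norm_dim n a = 1 \<Longrightarrow> distr M M (reflection n a) = M"

lemma AE_lborel_dim_norm: 
  assumes "n \<ge> 1"
  shows "AE x in lborel_dim n. norm_dim n x \<noteq> 0"
proof (rule AE_I')
  have "emeasure (lborel_dim n) (Pi\<^sub>E {..<n} (\<lambda>_. {0})) = 0"
    unfolding lborel_dim_def using assms by (subst PL.emeasure_PiM) (auto simp: prod_zero_iff)
  moreover have "Pi\<^sub>E {..<n} (\<lambda>_. {0::real}) \<in> sets (lborel_dim n)"
    unfolding lborel_dim_def by (intro sets_PiM_I_finite) auto
  ultimately show "Pi\<^sub>E {..<n} (\<lambda>_. {0}) \<in> null_sets (lborel_dim n)" by auto
  show "{x \<in> space (lborel_dim n). \<not> norm_dim n x \<noteq> 0} \<subseteq> Pi\<^sub>E {..<n} (\<lambda>_. {0})"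
    by (auto simp: space_lborel_dim norm_dim_zero_iff extensional_def fun_eq_iff)
qed

text \<open>A radial density is unchanged by reflections, and \<open>direction\<close> commutes with
  them. A general weight \<open>\<rho>\<close> is allowed because the equator law is not uniform on
  its ball but weighted by the length.\<close>

lemma rotation_invariant_direction:
  assumes "n \<ge> 1" and [measurable]: "\<rho> \<in> borel_measurable borel"
    and Z: "(\<integral>\<^sup>+x. \<rho> (norm_dim n x) \<partial>lborel_dim n) = 1"
  shows "rotation_invariant
    (distr (density (lborel_dim n) (\<lambda>x. \<rho> (norm_dim n x))) (lborel_dim n) (direction n)) n"
    (is "rotation_invariant (distr ?N ?L _) n")
proof -
  interpret N: prob_space ?N
    by (rule prob_spaceI) (simp add: emeasure_density Z cong: nn_integral_cong)
  have dir: "direction n \<in> measurable ?N ?L" by measurable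
  interpret D: prob_space "distr ?N ?L (direction n)"
    by (rule N.prob_space_distr[OF dir])
  show ?thesis
  proof
    show "AE x in distr ?N ?L (direction n). norm_dim n x = 1"
      using AE_lborel_dim_norm[OF assms(1)]
      by (subst AE_distr_iff[OF dir]) (auto simp: AE_density intro: norm_direction)
    fix a assume a: "norm_dim n a = 1"
    let ?R = "reflection n a"
    have inv: "distr ?L ?L ?R = ?L"
      using preserves_lborel_reflection[OF a] by (simp add: preserves_lborel_def)
    have N: "distr ?N ?L ?R = ?N"
      using density_distr[of "\<lambda>x. \<rho> (norm_dim n x)" ?L ?R ?L]
      by (simp add: norm_reflection[OF a] inv)
    have "distr (distr ?N ?L (direction n)) ?L ?R = distr ?N ?L (?R \<circ> direction n)"
      by (rule distr_distr) measurable
    also have "?R \<circ> direction n = direction n \<circ> ?R"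
      by (auto simp: direction_reflection[OF a])
    also have "distr ?N ?L (direction n \<circ> ?R) = distr (distr ?N ?L ?R) ?L (direction n)"
      by (rule distr_distr[symmetric]) measurable
    finally show "distr (distr ?N ?L (direction n)) (distr ?N ?L (direction n)) ?R = distr ?N ?L (direction n)"
      unfolding N by (simp cong: distr_cong)
  qed simp
qed

context rotation_invariant
begin

lemma AE_dot_le: "AE x in M. \<bar>dot n a x\<bar> \<le> norm_dim n a"
  using AE_norm by eventually_elim (metis abs_dot_le mult.right_neutral)

lemma integrable_bounded:
  fixes f :: "(nat \<Rightarrow> real) \<Rightarrow> real"
  assumes "f \<in> borel_measurable M" "AE x in M. \<bar>f x\<bar> \<le> B"
  shows "integrable M f"
  using assms by (intro integrable_const_bound[of _ B]) auto

lemma integrable_polynomial [simp]: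
  "integrable M (\<lambda>x. (dot n a x) ^ i)"
  "integrable M (\<lambda>x. (dot n a x) ^ i * (dot n b x) ^ j)"
  "integrable M (\<lambda>x. \<bar>dot n a x\<bar>)"
proof -
  have [measurable]: "(\<lambda>x. dot n a x) \<in> borel_measurable M" for a by measurable
  have "AE x in M. \<bar>(dot n a x) ^ i * (dot n b x) ^ j\<bar> \<le> norm_dim n a ^ i * norm_dim n b ^ j" for a i b j
    using AE_dot_le[of a] AE_dot_le[of b]
    by eventually_elim (auto simp: power_abs abs_mult intro!: mult_mono power_mono)
  then show *: "integrable M (\<lambda>x. (dot n a x) ^ i * (dot n b x) ^ j)" for a i b j
    by (intro integrable_bounded[of _ "norm_dim n a ^ i * norm_dim n b ^ j"]) measurable
  show "integrable M (\<lambda>x. (dot n a x) ^ i)"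
    using *[of a i a 0] by simp
  show "integrable M (\<lambda>x. \<bar>dot n a x\<bar>)"
    using *[of a 1 a 0] by simp
qed

lemma integral_reflection:
  assumes "norm_dim n a = 1" and f: "f \<in> borel_measurable M"
  shows "(LINT x|M. f (reflection n a x)) = (LINT x|M. (f x :: real))"
proof -
  have "(LINT x|M. f (reflection n a x)) = (LINT x|distr M M (reflection n a). f x)"
    by (rule integral_distr[symmetric]) (use f in measurable)
  then show ?thesis by (simp add: distr_reflection[OF assms(1)])
qed

text \<open>The reflection that carries \<open>a\<close> to \<open>b\<close> is moved from the
  random point onto the vector.\<close>

lemma integral_power_dot_eq:
  assumes "norm_dim n a = 1" "norm_dim n b = 1"
  shows "(LINT x|M. dot n a x ^ k) = (LINT x|M. dot n b x ^ k)"
proof (cases "restrict a {..<n} = restrict b {..<n}")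
  case True
  then have "dot n a x = dot n b x" for x
    by (metis dot_restrict(2))
  then show ?thesis by simp
next
  case False
  then obtain c where c: "norm_dim n c = 1" "reflection n c (restrict a {..<n}) = restrict b {..<n}"
    using exists_reflection[of n "restrict a {..<n}" "restrict b {..<n}"] assms by auto
  have "(LINT x|M. dot n a x ^ k) = (LINT x|M. dot n a (reflection n c x) ^ k)"
    by (rule integral_reflection[OF c(1), symmetric]) measurable
  also have "\<dots> = (LINT x|M. dot n b x ^ k)"
    by (metis dot_reflection_move c(2) dot_restrict(2))
  finally show ?thesis .
qed

lemma integrable_coord [simp]:
  "i < n \<Longrightarrow> integrable M (\<lambda>x. x i ^ k)"
  "i < n \<Longrightarrow> j < n \<Longrightarrow> integrable M (\<lambda>x. x i ^ k * x j ^ l)"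
  using integrable_polynomial(1)[of "unit_vec i" k] 
    integrable_polynomial(2)[of "unit_vec i" k "unit_vec j" l] by (simp_all add: dot_unit_vec)

lemma AE_sum_squares: "AE x in M. (\<Sum>i<n. x i ^ 2) = 1"
  using AE_norm by eventually_elim (simp add: norm_dim_eq_1_iff dot_def power2_eq_square)

lemma second_moment_unit:
  assumes "norm_dim n a = 1" "n \<ge> 1"
  shows "(LINT x|M. dot n a x ^ 2) = 1 / n"
proof -
  have "(LINT x|M. dot n a x ^ 2) = (LINT x|M. x i ^ 2)" if "i < n" for i
    using integral_power_dot_eq[OF assms(1) norm_unit_vec[OF that], of 2] that by (simp add: dot_unit_vec)
  then have "(\<Sum>i<n. (LINT x|M. dot n a x ^ 2)) = (\<Sum>i<n. (LINT x|M. x i ^ 2))"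
    by (intro sum.cong) auto
  then have "n * (LINT x|M. dot n a x ^ 2) = (\<Sum>i<n. (LINT x|M. x i ^ 2))"
    by simp
  also have "\<dots> = (LINT x|M. (\<Sum>i<n. x i ^ 2))"
    by (simp add: Bochner_Integration.integral_sum)
  also have "\<dots> = (LINT x|M. 1)"
    by (rule integral_cong_AE) (use AE_sum_squares in auto)
  finally show ?thesis using assms(2) by (simp add: field_simps prob_space)
qed

text \<open>The unit vectors \<open>(e_i + e_j) / sqrt 2\<close> and
  \<open>(e_i - e_j) / sqrt 2\<close> have the same fourth moment \<open>m\<close> as a coordinate,
  which forces the mixed moment of two coordinates to be \<open>m / 3\<close>. Expanding the square
  of the sum of squares, which is 1, then bounds \<open>m\<close>. Lowering the diagonal terms to
  \<open>m / 3\<close> too only weakens the exact value \<open>3 / (n * (n + 2))\<close> to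
  \<open>3 / n^2\<close>.\<close>

lemma fourth_moment_unit:
  assumes a: "norm_dim n a = 1" and n: "n \<ge> 1"
  shows "(LINT x|M. dot n a x ^ 4) \<le> 3 / n\<^sup>2"
proof -
  define m where "m = (LINT x|M. dot n a x ^ 4)"
  have m: "(LINT x|M. dot n b x ^ 4) = m" if "norm_dim n b = 1" for b
    unfolding m_def by (rule integral_power_dot_eq[OF that a])
  have mi: "(LINT x|M. x i ^ 4) = m" if "i < n" for i
    using m[OF norm_unit_vec[OF that]] that by (simp add: dot_unit_vec)
  have mij: "(LINT x|M. x i ^ 2 * x j ^ 2) = m / 3" if "i < n" "j < n" "i \<noteq> j" for i j
  proof -
    define b where "b c = (\<lambda>k. 1 / sqrt 2 * (unit_vec i k + c * unit_vec j k))" for c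
    have db: "dot n (b c) x = 1 / sqrt 2 * (x i + c * x j)" for c x
      using that unfolding b_def by (simp only: dot_linear dot_unit_vec)
    have "norm_dim n (b c) = 1" if "c\<^sup>2 = 1" for c
      using that \<open>i \<noteq> j\<close> unfolding norm_dim_eq_1_iff db
      by (simp add: b_def unit_vec_def field_simps power2_eq_square)
    then have "2 * m = (LINT x|M. dot n (b 1) x ^ 4) + (LINT x|M. dot n (b (-1)) x ^ 4)"
      by (subst (1 2) m) auto
    also have "\<dots> = (LINT x|M. dot n (b 1) x ^ 4 + dot n (b (-1)) x ^ 4)"
      by (rule Bochner_Integration.integral_add[symmetric]) simp_all
    also have "\<dots> = (LINT x|M. (x i ^ 4 + x j ^ 4 + 6 * (x i ^ 2 * x j ^ 2)) / 2)"
    proof (rule Bochner_Integration.integral_cong[OF refl])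
      fix x
      have "sqrt 2 ^ 4 = (4 :: real)" by (simp add: power4_eq_xxxx)
      then show "dot n (b 1) x ^ 4 + dot n (b (-1)) x ^ 4 = (x i ^ 4 + x j ^ 4 + 6 * (x i ^ 2 * x j ^ 2)) / 2"
        unfolding db power_mult_distrib power_one_over by (simp add: field_simps) (simp add: power4_eq_xxxx power2_eq_square algebra_simps)
    qed
    also have "\<dots> = (m + m + 6 * (LINT x|M. x i ^ 2 * x j ^ 2)) / 2"
      using that by (simp add: mi)
    finally show ?thesis by simp
  qed
  have "1 = (LINT x|M. (\<Sum>i<n. \<Sum>j<n. x i ^ 2 * x j ^ 2))"
  proof -
    have "(LINT x|M. (\<Sum>i<n. \<Sum>j<n. x i ^ 2 * x j ^ 2)) = (LINT x|M. 1)"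
      by (rule integral_cong_AE)
        (use AE_sum_squares in \<open>auto simp: sum_distrib_left[symmetric] sum_distrib_right[symmetric]\<close>)
    then show ?thesis by (simp add: prob_space)
  qed
  also have "\<dots> = (\<Sum>i<n. LINT x|M. (\<Sum>j<n. x i ^ 2 * x j ^ 2))"
    by (rule Bochner_Integration.integral_sum) (auto intro!: Bochner_Integration.integrable_sum)
  also have "\<dots> = (\<Sum>i<n. \<Sum>j<n. LINT x|M. x i ^ 2 * x j ^ 2)"
    by (intro sum.cong refl Bochner_Integration.integral_sum) auto
  also have "\<dots> \<ge> (\<Sum>i<n. \<Sum>j<n. m / 3)"
  proof (intro sum_mono)
    fix i j assume "i \<in> {..<n}" "j \<in> {..<n}"
    moreover have "m \<ge> 0" unfolding m_def by (rule Bochner_Integration.integral_nonneg) simp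
    ultimately show "m / 3 \<le> (LINT x|M. x i ^ 2 * x j ^ 2)"
      using mij[of i j] mi[of i] by (cases "i = j") (auto simp: power_add[symmetric])
  qed
  finally have "real n * (real n * m) \<le> 3" by simp
  then show ?thesis unfolding m_def[symmetric] using n by (simp add: field_simps power2_eq_square)
qed

lemma norm_dim_cases: obtains "\<forall>x. dot n a x = 0" "norm_dim n a = 0"
  | b where "norm_dim n b = 1" "\<And>x. dot n a x = norm_dim n a * dot n b x"
proof (cases "norm_dim n a = 0")
  case True
  then show ?thesis using that(1) by (auto simp: norm_dim_zero_iff dot_def)
next
  case False
  have "norm_dim n (\<lambda>i. 1 / norm_dim n a * a i) = 1"
    unfolding norm_dim_scale using False by simp
  then show ?thesis using that(2)[of "\<lambda>i. 1 / norm_dim n a * a i"] False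
    unfolding dot_linear by simp
qed

lemma second_moment:
  assumes "n \<ge> 1"
  shows "(LINT x|M. dot n a x ^ 2) = norm_dim n a ^ 2 / n"
  by (rule norm_dim_cases[of a]) (use assms in \<open>auto simp: power_mult_distrib second_moment_unit\<close>)

lemma fourth_moment:
  assumes "n \<ge> 1"
  shows "(LINT x|M. dot n a x ^ 4) \<le> norm_dim n a ^ 4 * (3 / n\<^sup>2)"
proof (rule norm_dim_cases[of a])
  fix b assume "norm_dim n b = 1" and *: "\<And>x. dot n a x = norm_dim n a * dot n b x"
  then show ?thesis using fourth_moment_unit[of b] assms
    unfolding * power_mult_distrib by (subst integral_mult_right_zero) (rule mult_left_mono, auto)
qed auto

text \<open>For unit vectors the product of two squares is at most the mean of the fourth powers;
  the general case follows by scaling.\<close>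

lemma mixed_moment:
  assumes "n \<ge> 1"
  shows "(LINT x|M. dot n a x ^ 2 * dot n b x ^ 2) \<le> norm_dim n a ^ 2 * norm_dim n b ^ 2 * (3 / n\<^sup>2)"
proof (rule norm_dim_cases[of a])
  fix a' assume a: "norm_dim n a' = 1" "\<And>x. dot n a x = norm_dim n a * dot n a' x"
  show ?thesis
  proof (rule norm_dim_cases[of b])
    fix b' assume b: "norm_dim n b' = 1" "\<And>x. dot n b x = norm_dim n b * dot n b' x"
    have "(LINT x|M. dot n a' x ^ 2 * dot n b' x ^ 2) \<le> (LINT x|M. (dot n a' x ^ 4 + dot n b' x ^ 4) / 2)"
    proof (rule integral_mono)
      fix x show "dot n a' x ^ 2 * dot n b' x ^ 2 \<le> (dot n a' x ^ 4 + dot n b' x ^ 4) / 2"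
        using sum_squares_bound[of "dot n a' x ^ 2" "dot n b' x ^ 2"] by (simp add: power_mult[symmetric])
    qed simp_all
    also have "\<dots> \<le> 3 / n\<^sup>2"
      using fourth_moment_unit[OF a(1) assms] fourth_moment_unit[OF b(1) assms] by simp
    finally have *: "(LINT x|M. dot n a' x ^ 2 * dot n b' x ^ 2) \<le> 3 / n\<^sup>2" .
    have "(LINT x|M. dot n a x ^ 2 * dot n b x ^ 2) =
        (LINT x|M. (norm_dim n a ^ 2 * norm_dim n b ^ 2) * (dot n a' x ^ 2 * dot n b' x ^ 2))"
      unfolding a(2) b(2) by (simp add: power_mult_distrib mult_ac)
    also have "\<dots> \<le> norm_dim n a ^ 2 * norm_dim n b ^ 2 * (3 / n\<^sup>2)"
      using * by (subst integral_mult_right_zero) (rule mult_left_mono, auto)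
    finally show ?thesis .
  qed auto
qed auto

end

section \<open>Correlations with clipped linear functions\<close>

definition clip :: "real \<Rightarrow> real \<Rightarrow> real" where
  "clip K x = max (- K) (min K x)"

lemma measurable_clip [measurable]: "clip K \<in> borel_measurable borel"
  unfolding clip_def[abs_def] by measurable

lemma abs_clip_le: "K \<ge> 0 \<Longrightarrow> \<bar>clip K x\<bar> \<le> K"
  by (auto simp: clip_def)

text \<open>Here \<open>p\<close> is the part of a scaled coordinate that correlates with the label
  and \<open>m\<close> the part that a reflection negates. If nothing is clipped, the mean is
  exactly \<open>p\<close>. Otherwise \<open>K^2\<close> is at most \<open>2 * (p^2 + m^2)\<close>,
  while the error never exceeds |p|. Keeping the factor |p| is what makes the clipping error
  relative to the correlation.\<close>

lemma clip_symmetrized_error: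
  assumes "K > 0"
  shows "\<bar>(clip K (p + m) + clip K (p - m)) / 2 - p\<bar> \<le> 2 / K\<^sup>2 * (\<bar>p\<bar> * (p\<^sup>2 + m\<^sup>2))"
proof (cases "\<bar>p\<bar> + \<bar>m\<bar> \<le> K")
  case True
  then have "clip K (p + m) = p + m" "clip K (p - m) = p - m" by (auto simp: clip_def)
  then show ?thesis by simp
next
  case False
  have "K\<^sup>2 \<le> (\<bar>p\<bar> + \<bar>m\<bar>)\<^sup>2"
    using False assms by (intro power_mono) auto
  also have "\<dots> \<le> 2 * (p\<^sup>2 + m\<^sup>2)"
    using sum_squares_bound[of "\<bar>p\<bar>" "\<bar>m\<bar>"] by (simp add: power2_sum)
  finally have "1 \<le> 2 / K\<^sup>2 * (p\<^sup>2 + m\<^sup>2)"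
    using assms by (simp add: field_simps)
  from mult_left_mono[OF this, of "\<bar>p\<bar>"]
  have "\<bar>p\<bar> \<le> 2 / K\<^sup>2 * (\<bar>p\<bar> * (p\<^sup>2 + m\<^sup>2))" by (simp add: mult_ac)
  moreover have "\<bar>(clip K (p + m) + clip K (p - m)) / 2 - p\<bar> \<le> \<bar>p\<bar>"
    using assms by (auto simp: clip_def max_def min_def abs_if)
  ultimately show ?thesis by linarith
qed

lemma abs_sign_pm [simp]: "\<bar>sign_pm x\<bar> = 1"
  by (simp add: sign_pm_def)

lemma measurable_sign_pm [measurable]: "sign_pm \<in> borel_measurable borel"
  unfolding sign_pm_def[abs_def] by measurable

context rotation_invariant
begin

text \<open>Split \<open>a\<close> into \<open>\<alpha> * v\<close> and a vector \<open>u\<close>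
  orthogonal to \<open>v\<close>. The law does not distinguish \<open>u\<close> from
  \<open>-u\<close> given \<open>dot n v x\<close>, so the clipped function may be replaced by its
  symmetrisation. The main term is the unclipped correlation, and the error carries the factor
  \<open>\<alpha>\<close>.\<close>

lemma clip_correlation:
  fixes a v :: "nat \<Rightarrow> real"
  assumes K: "K > 0" and v: "norm_dim n v \<noteq> 0"
    and H [measurable]: "H \<in> borel_measurable borel" and HB: "\<And>x. \<bar>H x\<bar> \<le> B"
  defines "\<alpha> \<equiv> dot n a v / dot n v v"
  defines "u \<equiv> (\<lambda>i. a i - \<alpha> * v i)"
  shows "\<bar>(LINT x|M. H (dot n v x) * clip K (\<sigma> * dot n a x)) - \<sigma> * \<alpha> * (LINT x|M. H (dot n v x) * dot n v x)\<bar>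
    \<le> 2 / K\<^sup>2 * (\<bar>\<sigma>\<bar> ^ 3 * \<bar>\<alpha>\<bar> *
        (LINT x|M. \<bar>H (dot n v x)\<bar> * \<bar>dot n v x\<bar> * (\<alpha>\<^sup>2 * (dot n v x)\<^sup>2 + (dot n u x)\<^sup>2)))"
proof -
  let ?X = "dot n v" and ?U = "dot n u"
  define P where "P x = \<sigma> * \<alpha> * ?X x" for x
  define Q where "Q x = \<sigma> * ?U x" for x
  have [measurable]: "?X \<in> borel_measurable M" "?U \<in> borel_measurable M" "P \<in> borel_measurable M" "Q \<in> borel_measurable M"
    unfolding P_def[abs_def] Q_def[abs_def] by measurable
  have vv: "dot n v v \<noteq> 0" using v by (simp add: norm_dim_eq)
  have uv: "dot n u v = 0"
    unfolding u_def dot_linear \<alpha>_def using vv by simp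
  have a: "\<sigma> * dot n a x = P x + Q x" for x
    unfolding P_def Q_def u_def dot_linear by (simp add: algebra_simps)
  have bnd: "\<bar>H y * clip K z\<bar> \<le> B * K" for y z
    unfolding abs_mult by (intro mult_mono HB abs_clip_le) (use HB[of 0] K in auto)
  have int1: "integrable M (\<lambda>x. H (?X x) * clip K (P x + Q x))" "integrable M (\<lambda>x. H (?X x) * clip K (P x - Q x))"
    by (rule integrable_bounded[of _ "B * K"]; use bnd in simp)+
  have int2: "integrable M (\<lambda>x. H (?X x) * P x)"
  proof (rule integrable_bounded[of _ "B * (\<bar>\<sigma> * \<alpha>\<bar> * norm_dim n v)"])
    show "AE x in M. \<bar>H (?X x) * P x\<bar> \<le> B * (\<bar>\<sigma> * \<alpha>\<bar> * norm_dim n v)"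
      using AE_dot_le[of v]
    proof eventually_elim
      case (elim x)
      then show ?case unfolding abs_mult P_def
        by (intro mult_mono HB) (use HB[of 0] in auto)
    qed
  qed measurable
  have int3: "integrable M (\<lambda>x. \<bar>H (?X x)\<bar> * \<bar>?X x\<bar> * (\<alpha>\<^sup>2 * (?X x)\<^sup>2 + (?U x)\<^sup>2))"
  proof (rule integrable_bounded[of _ "B * norm_dim n v * (\<alpha>\<^sup>2 * (norm_dim n v)\<^sup>2 + (norm_dim n u)\<^sup>2)"])
    show "AE x in M. \<bar>\<bar>H (?X x)\<bar> * \<bar>?X x\<bar> * (\<alpha>\<^sup>2 * (?X x)\<^sup>2 + (?U x)\<^sup>2)\<bar> \<le> 
        B * norm_dim n v * (\<alpha>\<^sup>2 * (norm_dim n v)\<^sup>2 + (norm_dim n u)\<^sup>2)"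
      using AE_dot_le[of v] AE_dot_le[of u]
    proof eventually_elim
      case (elim x)
      have "(?X x)\<^sup>2 \<le> (norm_dim n v)\<^sup>2" "(?U x)\<^sup>2 \<le> (norm_dim n u)\<^sup>2"
        using power_mono[OF elim(1) abs_ge_zero, of 2] power_mono[OF elim(2) abs_ge_zero, of 2] by auto
      then show ?case unfolding abs_mult
        by (intro mult_mono HB) (use HB order_trans[OF abs_ge_zero HB[of 0]] elim in \<open>auto intro!: add_mono mult_left_mono\<close>)
    qed
  qed measurable
  \<comment> \<open>The reflection along \<open>u\<close> fixes \<open>dot n v x\<close> and negates
    \<open>dot n u x\<close>; it exchanges \<open>P + Q\<close> and \<open>P - Q\<close>.\<close>
  have flip: "(LINT x|M. H (?X x) * clip K (P x + Q x)) = (LINT x|M. H (?X x) * clip K (P x - Q x))"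
  proof (rule norm_dim_cases[of u])
    fix b assume b: "norm_dim n b = 1" and ub: "\<And>x. ?U x = norm_dim n u * dot n b x"
    show ?thesis
    proof (cases "norm_dim n u = 0")
      case True
      then show ?thesis unfolding Q_def ub by simp
    next
      case False
      then have "dot n b v = 0" using ub[of v] uv by simp
      then have "?X (reflection n b x) = ?X x" "?U (reflection n b x) = - ?U x" for x
        using b unfolding ub by (simp_all add: dot_reflection_left norm_dim_eq_1_iff dot_commute)
      then have *: "?X (reflection n b x) = ?X x" "P (reflection n b x) = P x" "Q (reflection n b x) = - Q x" for x
        by (simp_all add: P_def Q_def)
      show ?thesis
        using integral_reflection[OF b, of "\<lambda>x. H (?X x) * clip K (P x + Q x)"] by (simp add: *)
    qed
  qed (simp add: Q_def)
  have "\<bar>(LINT x|M. H (?X x) * clip K (\<sigma> * dot n a x)) - \<sigma> * \<alpha> * (LINT x|M. H (?X x) * ?X x)\<bar> = 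
     \<bar>(LINT x|M. H (?X x) * ((clip K (P x + Q x) + clip K (P x - Q x)) / 2 - P x))\<bar>"
  proof -
    have "(LINT x|M. H (?X x) * ((clip K (P x + Q x) + clip K (P x - Q x)) / 2 - P x)) = 
      (LINT x|M. (H (?X x) * clip K (P x + Q x) + H (?X x) * clip K (P x - Q x)) / 2 - H (?X x) * P x)"
      by (rule Bochner_Integration.integral_cong) (auto simp: algebra_simps)
    also have "\<dots> = (LINT x|M. H (?X x) * clip K (P x + Q x)) - (LINT x|M. H (?X x) * P x)"
      using int1 int2 by (simp add: flip)
    also have "(LINT x|M. H (?X x) * P x) = (LINT x|M. (\<sigma> * \<alpha>) * (H (?X x) * ?X x))"
      by (rule Bochner_Integration.integral_cong) (auto simp: P_def)
    also have "\<dots> = \<sigma> * \<alpha> * (LINT x|M. H (?X x) * ?X x)"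
      by (rule integral_mult_right_zero)
    finally show ?thesis by (simp add: a)
  qed
  also have "\<dots> \<le> (LINT x|M. 2 / K\<^sup>2 * (\<bar>\<sigma>\<bar> ^ 3 * \<bar>\<alpha>\<bar> *
        (\<bar>H (?X x)\<bar> * \<bar>?X x\<bar> * (\<alpha>\<^sup>2 * (?X x)\<^sup>2 + (?U x)\<^sup>2))))"
  proof (rule integral_abs_bound[THEN order_trans], rule integral_mono)
    show "integrable M (\<lambda>x. \<bar>H (?X x) * ((clip K (P x + Q x) + clip K (P x - Q x)) / 2 - P x)\<bar>)"
    proof (rule integrable_abs)
      have "integrable M (\<lambda>x. (H (?X x) * clip K (P x + Q x) + H (?X x) * clip K (P x - Q x)) / 2 - H (?X x) * P x)"
        using int1 int2 by auto
      then show "integrable M (\<lambda>x. H (?X x) * ((clip K (P x + Q x) + clip K (P x - Q x)) / 2 - P x))"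
        by (rule Bochner_Integration.integrable_cong[THEN iffD1, rotated -1]) (auto simp: algebra_simps)
    qed
    show "integrable M (\<lambda>x. 2 / K\<^sup>2 * (\<bar>\<sigma>\<bar> ^ 3 * \<bar>\<alpha>\<bar> *
        (\<bar>H (?X x)\<bar> * \<bar>?X x\<bar> * (\<alpha>\<^sup>2 * (?X x)\<^sup>2 + (?U x)\<^sup>2))))"
      using int3 by auto
    fix x
    have "\<bar>H (?X x) * ((clip K (P x + Q x) + clip K (P x - Q x)) / 2 - P x)\<bar> \<le>
        \<bar>H (?X x)\<bar> * (2 / K\<^sup>2 * (\<bar>P x\<bar> * ((P x)\<^sup>2 + (Q x)\<^sup>2)))"
      unfolding abs_mult by (intro mult_left_mono clip_symmetrized_error[OF K]) auto
    also have "\<bar>P x\<bar> * ((P x)\<^sup>2 + (Q x)\<^sup>2) = \<bar>\<sigma>\<bar> ^ 3 * \<bar>\<alpha>\<bar> * (\<bar>?X x\<bar> * (\<alpha>\<^sup>2 * (?X x)\<^sup>2 + (?U x)\<^sup>2))"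
    proof -
      have "\<bar>\<sigma>\<bar> ^ 3 = \<bar>\<sigma>\<bar> * \<sigma>\<^sup>2" by (simp add: power3_eq_cube power2_eq_square)
      then show ?thesis unfolding P_def Q_def abs_mult by (simp add: power_mult_distrib algebra_simps)
    qed
    finally show "\<bar>H (?X x) * ((clip K (P x + Q x) + clip K (P x - Q x)) / 2 - P x)\<bar> \<le>
      2 / K\<^sup>2 * (\<bar>\<sigma>\<bar> ^ 3 * \<bar>\<alpha>\<bar> * (\<bar>H (?X x)\<bar> * \<bar>?X x\<bar> * (\<alpha>\<^sup>2 * (?X x)\<^sup>2 + (?U x)\<^sup>2)))"
      by (simp add: mult_ac)
  qed
  also have "\<dots> = 2 / K\<^sup>2 * (\<bar>\<sigma>\<bar> ^ 3 * \<bar>\<alpha>\<bar> *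
        (LINT x|M. \<bar>H (?X x)\<bar> * \<bar>?X x\<bar> * (\<alpha>\<^sup>2 * (?X x)\<^sup>2 + (?U x)\<^sup>2)))"
    by (simp only: integral_mult_right_zero)
  finally show ?thesis .
qed

lemma norm_dim_orthogonal_split:
  assumes "norm_dim n v \<noteq> 0"
  shows "(dot n a v / dot n v v)\<^sup>2 * (norm_dim n v)\<^sup>2 + (norm_dim n (\<lambda>i. a i - dot n a v / dot n v v * v i))\<^sup>2 = (norm_dim n a)\<^sup>2"
proof -
  have vv: "dot n v v \<noteq> 0" using assms by (simp add: norm_dim_eq)
  show ?thesis unfolding norm_dim_square dot_linear using vv
    by (simp add: power2_eq_square dot_commute[of n v a] field_simps)
qed

text \<open>Linear growth of \<open>H\<close> raises the cubic integrand to fourth moments, of order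
  \<open>1 / n^2\<close>. By Pythagoras these combine to \<open>norm_dim n v ^ 2\<close> times a
  bound for the norm of \<open>a\<close>, and the square of the norm cancels the denominator of
  \<open>\<alpha>\<close>, which leaves a multiple of \<open>dot n a v\<close>.\<close>

lemma clip_correlation_linear_bound:
  assumes K: "K > 0" and v: "norm_dim n v \<noteq> 0" and n: "n \<ge> 1"
    and H [measurable]: "H \<in> borel_measurable borel" and HB: "\<And>x. \<bar>H x\<bar> \<le> B"
    and HL: "\<And>x. \<bar>H x\<bar> \<le> L * \<bar>x\<bar>" and a: "norm_dim n a \<le> 1"
  shows "\<bar>(LINT x|M. H (dot n v x) * clip K (sqrt n * dot n a x))
      - sqrt n * (dot n a v / dot n v v) * (LINT x|M. H (dot n v x) * dot n v x)\<bar>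
    \<le> 6 / K\<^sup>2 * (L / sqrt n) * \<bar>dot n a v\<bar>"
proof -
  define \<alpha> where "\<alpha> = dot n a v / dot n v v"
  define u where "u = (\<lambda>i. a i - \<alpha> * v i)"
  let ?X = "dot n v" and ?U = "dot n u"
  have L: "L \<ge> 0" using order_trans[OF abs_ge_zero HL[of 1]] by simp
  have "(LINT x|M. \<bar>H (?X x)\<bar> * \<bar>?X x\<bar> * (\<alpha>\<^sup>2 * (?X x)\<^sup>2 + (?U x)\<^sup>2)) \<le>
     (LINT x|M. L * (\<alpha>\<^sup>2 * ?X x ^ 4 + ?X x ^ 2 * ?U x ^ 2))"
  proof (rule integral_mono_AE')
    show "AE x in M. \<bar>H (?X x)\<bar> * \<bar>?X x\<bar> * (\<alpha>\<^sup>2 * (?X x)\<^sup>2 + (?U x)\<^sup>2) \<le> L * (\<alpha>\<^sup>2 * ?X x ^ 4 + ?X x ^ 2 * ?U x ^ 2)"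
    proof (rule AE_I2)
      fix x
      have "\<bar>H (?X x)\<bar> * \<bar>?X x\<bar> * (\<alpha>\<^sup>2 * (?X x)\<^sup>2 + (?U x)\<^sup>2) \<le> (L * \<bar>?X x\<bar>) * \<bar>?X x\<bar> * (\<alpha>\<^sup>2 * (?X x)\<^sup>2 + (?U x)\<^sup>2)"
        by (intro mult_right_mono HL) auto
      then show "\<bar>H (?X x)\<bar> * \<bar>?X x\<bar> * (\<alpha>\<^sup>2 * (?X x)\<^sup>2 + (?U x)\<^sup>2) \<le> L * (\<alpha>\<^sup>2 * ?X x ^ 4 + ?X x ^ 2 * ?U x ^ 2)"
        by (simp add: power2_eq_square power4_eq_xxxx algebra_simps)
    qed
  qed (use L in auto)
  also have "\<dots> = L * (\<alpha>\<^sup>2 * (LINT x|M. ?X x ^ 4) + (LINT x|M. ?X x ^ 2 * ?U x ^ 2))"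
    by simp
  also have "\<dots> \<le> L * (\<alpha>\<^sup>2 * (norm_dim n v ^ 4 * (3 / n\<^sup>2)) + norm_dim n v ^ 2 * norm_dim n u ^ 2 * (3 / n\<^sup>2))"
    by (intro mult_left_mono add_mono fourth_moment[OF n] mixed_moment[OF n] L) auto
  also have "\<dots> = L * (norm_dim n v ^ 2 * (\<alpha>\<^sup>2 * (norm_dim n v)\<^sup>2 + (norm_dim n u)\<^sup>2) * (3 / n\<^sup>2))"
    by (simp add: power4_eq_xxxx power2_eq_square algebra_simps)
  also have "\<dots> = L * (norm_dim n v ^ 2 * (norm_dim n a)\<^sup>2 * (3 / n\<^sup>2))"
    using norm_dim_orthogonal_split[OF v, of a] by (simp add: \<alpha>_def u_def)
  also have "\<dots> \<le> L * (norm_dim n v ^ 2 * 1 * (3 / n\<^sup>2))"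
    using a L by (intro mult_left_mono mult_right_mono power_le_one) auto
  finally have *: "(LINT x|M. \<bar>H (?X x)\<bar> * \<bar>?X x\<bar> * (\<alpha>\<^sup>2 * (?X x)\<^sup>2 + (?U x)\<^sup>2)) \<le> L * norm_dim n v ^ 2 * (3 / n\<^sup>2)"
    by simp
  have "\<bar>(LINT x|M. H (dot n v x) * clip K (sqrt n * dot n a x)) - sqrt n * \<alpha> * (LINT x|M. H (dot n v x) * dot n v x)\<bar>
    \<le> 2 / K\<^sup>2 * (\<bar>sqrt n\<bar> ^ 3 * \<bar>\<alpha>\<bar> *
        (LINT x|M. \<bar>H (?X x)\<bar> * \<bar>?X x\<bar> * (\<alpha>\<^sup>2 * (?X x)\<^sup>2 + (?U x)\<^sup>2)))"
    unfolding \<alpha>_def u_def by (rule clip_correlation[OF K v H HB])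
  also have "\<dots> \<le> 2 / K\<^sup>2 * (\<bar>sqrt n\<bar> ^ 3 * \<bar>\<alpha>\<bar> * (L * norm_dim n v ^ 2 * (3 / n\<^sup>2)))"
    using * by (intro mult_left_mono) auto
  also have "\<dots> = 6 / K\<^sup>2 * (L / sqrt n) * (\<bar>\<alpha>\<bar> * norm_dim n v ^ 2)"
  proof -
    have "\<bar>sqrt n\<bar> ^ 3 * (3 / n\<^sup>2) = 3 / sqrt n"
    proof -
      have "(real n)\<^sup>2 = sqrt n ^ 4" by (simp add: power4_eq_xxxx power2_eq_square)
      then show ?thesis using n by (simp add: field_simps power4_eq_xxxx power3_eq_cube)
    qed
    then have "2 / K\<^sup>2 * (L * norm_dim n v ^ 2 * \<bar>\<alpha>\<bar>) * (\<bar>sqrt n\<bar> ^ 3 * (3 / n\<^sup>2)) = 2 / K\<^sup>2 * (L * norm_dim n v ^ 2 * \<bar>\<alpha>\<bar>) * (3 / sqrt n)"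
      by simp
    then show ?thesis by (simp add: mult_ac)
  qed
  also have "\<bar>\<alpha>\<bar> * norm_dim n v ^ 2 = \<bar>dot n a v\<bar>"
    using v unfolding \<alpha>_def norm_dim_square by (simp add: norm_dim_eq abs_mult)
  finally show ?thesis by (simp add: \<alpha>_def)
qed

text \<open>For \<open>z >= 0\<close> one has \<open>z >= 3/4 * z^2 - z^4 / 16\<close>, with contact
  at \<open>z = 2\<close>. Applied to \<open>z = sqrt n * |dot n v x|\<close>, with second moment 1
  and fourth moment at most 3, it gives \<open>3/4 - 3/16 = 9/16\<close>.\<close>

lemma expectation_abs_dot:
  assumes v: "norm_dim n v = 1" and n: "n \<ge> 1"
  shows "(LINT x|M. \<bar>dot n v x\<bar>) \<ge> 9 / 16 / sqrt n"
proof -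
  let ?X = "dot n v"
  have "9 / 16 \<le> (3 / 4 * real n * (1 / n) - 1 / 16 * (real n)\<^sup>2 * (3 / n\<^sup>2))"
    using n by simp
  also have "\<dots> \<le> 3 / 4 * real n * (LINT x|M. ?X x ^ 2) - 1 / 16 * (real n)\<^sup>2 * (LINT x|M. ?X x ^ 4)"
    unfolding second_moment_unit[OF v n] using fourth_moment_unit[OF v n]
    by (intro diff_mono mult_left_mono) auto
  also have "\<dots> = (LINT x|M. 3 / 4 * real n * ?X x ^ 2 - 1 / 16 * (real n)\<^sup>2 * ?X x ^ 4)"
    by simp
  also have "\<dots> \<le> (LINT x|M. sqrt n * \<bar>?X x\<bar>)"
  proof (rule integral_mono)
    fix x
    define z where "z = sqrt n * \<bar>?X x\<bar>"
    have z: "z \<ge> 0" by (simp add: z_def)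
    have "16 * z - 12 * z\<^sup>2 + z ^ 4 = z * (z - 2)\<^sup>2 * (z + 4)"
      by (simp add: power2_eq_square power4_eq_xxxx algebra_simps)
    moreover have "z * (z - 2)\<^sup>2 * (z + 4) \<ge> 0" using z by simp
    moreover have "z\<^sup>2 = real n * ?X x ^ 2" "z ^ 4 = (real n)\<^sup>2 * ?X x ^ 4"
      unfolding z_def power_mult_distrib by (simp_all add: power4_eq_xxxx power2_eq_square)
    ultimately show "3 / 4 * real n * ?X x ^ 2 - 1 / 16 * (real n)\<^sup>2 * ?X x ^ 4 \<le> sqrt n * \<bar>?X x\<bar>"
      unfolding z_def[symmetric] by (simp add: field_simps)
  qed simp_all
  finally show ?thesis using n by (simp add: field_simps)
qed

text \<open>For the first round, where the label is bounded but not small near zero. In place of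
  linear growth, \<open>2 * sqrt n * |X| <= 1 + n * X^2\<close> reduces the odd moment to second and
  fourth moments; the 4 in the bound is 1 + 3 from these.\<close>

lemma sign_correlation:
  assumes K: "K > 0" and v: "norm_dim n v = 1" and n: "n \<ge> 1" and \<sigma>: "0 \<le> \<sigma>" "\<sigma> \<le> sqrt n"
    and a: "norm_dim n a = 1"
  shows "\<bar>(LINT x|M. sign_pm (dot n v x) * clip K (\<sigma> * dot n a x)) - \<sigma> * (LINT x|M. \<bar>dot n v x\<bar>) * dot n a v\<bar>
    \<le> 4 / K\<^sup>2 * (\<sigma> / sqrt n) * \<bar>dot n a v\<bar>"
proof -
  define \<alpha> where "\<alpha> = dot n a v / dot n v v"
  have \<alpha>: "\<alpha> = dot n a v" using v by (simp add: \<alpha>_def norm_dim_eq_1_iff)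
  define u where "u = (\<lambda>i. a i - \<alpha> * v i)"
  let ?X = "dot n v" and ?U = "dot n u"
  have "(LINT x|M. \<bar>sign_pm (?X x)\<bar> * \<bar>?X x\<bar> * (\<alpha>\<^sup>2 * (?X x)\<^sup>2 + (?U x)\<^sup>2)) \<le>
     (LINT x|M. 1 / (2 * sqrt n) * (\<alpha>\<^sup>2 * ?X x ^ 2 + ?U x ^ 2 + n * (\<alpha>\<^sup>2 * ?X x ^ 4 + ?X x ^ 2 * ?U x ^ 2)))"
  proof (rule integral_mono_AE')
    show "AE x in M. \<bar>sign_pm (?X x)\<bar> * \<bar>?X x\<bar> * (\<alpha>\<^sup>2 * (?X x)\<^sup>2 + (?U x)\<^sup>2) \<le> 
      1 / (2 * sqrt n) * (\<alpha>\<^sup>2 * ?X x ^ 2 + ?U x ^ 2 + n * (\<alpha>\<^sup>2 * ?X x ^ 4 + ?X x ^ 2 * ?U x ^ 2))"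
    proof (rule AE_I2)
      fix x
      have "2 * sqrt n * \<bar>?X x\<bar> \<le> 1 + n * ?X x ^ 2"
        using sum_squares_bound[of 1 "sqrt n * \<bar>?X x\<bar>"] by (simp add: power_mult_distrib)
      then have "\<bar>?X x\<bar> \<le> 1 / (2 * sqrt n) * (1 + n * ?X x ^ 2)"
        using n by (simp add: field_simps)
      then have "\<bar>?X x\<bar> * (\<alpha>\<^sup>2 * (?X x)\<^sup>2 + (?U x)\<^sup>2) \<le> 1 / (2 * sqrt n) * (1 + n * ?X x ^ 2) * (\<alpha>\<^sup>2 * (?X x)\<^sup>2 + (?U x)\<^sup>2)"
        by (rule mult_right_mono) auto
      moreover have "(1 + n * ?X x ^ 2) * (\<alpha>\<^sup>2 * (?X x)\<^sup>2 + (?U x)\<^sup>2) = 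
          (\<alpha>\<^sup>2 * ?X x ^ 2 + ?U x ^ 2 + n * (\<alpha>\<^sup>2 * ?X x ^ 4 + ?X x ^ 2 * ?U x ^ 2))"
        by (simp add: algebra_simps power2_eq_square power4_eq_xxxx)
      ultimately show "\<bar>sign_pm (?X x)\<bar> * \<bar>?X x\<bar> * (\<alpha>\<^sup>2 * (?X x)\<^sup>2 + (?U x)\<^sup>2) \<le> 
          1 / (2 * sqrt n) * (\<alpha>\<^sup>2 * ?X x ^ 2 + ?U x ^ 2 + n * (\<alpha>\<^sup>2 * ?X x ^ 4 + ?X x ^ 2 * ?U x ^ 2))"
        by (simp only: abs_sign_pm mult_1 mult.assoc)
    qed
  qed auto
  also have "\<dots> = 1 / (2 * sqrt n) * (\<alpha>\<^sup>2 * (LINT x|M. ?X x ^ 2) + (LINT x|M. ?U x ^ 2) +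
      n * (\<alpha>\<^sup>2 * (LINT x|M. ?X x ^ 4) + (LINT x|M. ?X x ^ 2 * ?U x ^ 2)))"
    by simp
  also have "\<dots> \<le> 1 / (2 * sqrt n) * (\<alpha>\<^sup>2 * (norm_dim n v ^ 2 / n) + norm_dim n u ^ 2 / n +
      n * (\<alpha>\<^sup>2 * (norm_dim n v ^ 4 * (3 / n\<^sup>2)) + norm_dim n v ^ 2 * norm_dim n u ^ 2 * (3 / n\<^sup>2)))"
    by (intro mult_left_mono add_mono fourth_moment[OF n] mixed_moment[OF n])
      (simp_all add: second_moment[OF n])
  also have "\<dots> = 1 / (2 * sqrt n) * ((\<alpha>\<^sup>2 * (norm_dim n v)\<^sup>2 + (norm_dim n u)\<^sup>2) * (4 / n))"
    using n v by (simp add: field_simps power2_eq_square)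
  also have "\<dots> = 1 / (2 * sqrt n) * (4 / n)"
    using norm_dim_orthogonal_split[of v a] v a by (simp add: \<alpha>_def u_def)
  finally have *: "(LINT x|M. \<bar>sign_pm (?X x)\<bar> * \<bar>?X x\<bar> * (\<alpha>\<^sup>2 * (?X x)\<^sup>2 + (?U x)\<^sup>2)) \<le> 1 / (2 * sqrt n) * (4 / n)" .
  have "\<bar>(LINT x|M. sign_pm (dot n v x) * clip K (\<sigma> * dot n a x)) - \<sigma> * \<alpha> * (LINT x|M. sign_pm (dot n v x) * dot n v x)\<bar>
    \<le> 2 / K\<^sup>2 * (\<bar>\<sigma>\<bar> ^ 3 * \<bar>\<alpha>\<bar> *
        (LINT x|M. \<bar>sign_pm (?X x)\<bar> * \<bar>?X x\<bar> * (\<alpha>\<^sup>2 * (?X x)\<^sup>2 + (?U x)\<^sup>2)))"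
    unfolding \<alpha>_def u_def by (rule clip_correlation[OF K, where B=1]) (auto simp: v sign_pm_def)
  also have "\<dots> \<le> 2 / K\<^sup>2 * (\<bar>\<sigma>\<bar> ^ 3 * \<bar>\<alpha>\<bar> * (1 / (2 * sqrt n) * (4 / n)))"
    using * by (intro mult_left_mono) auto
  also have "\<dots> = 4 / K\<^sup>2 * (\<sigma> / sqrt n) * \<bar>\<alpha>\<bar> * (\<sigma>\<^sup>2 / n)"
    using \<sigma> by (simp add: field_simps power3_eq_cube power2_eq_square)
  also have "\<dots> \<le> 4 / K\<^sup>2 * (\<sigma> / sqrt n) * \<bar>\<alpha>\<bar> * 1"
  proof (rule mult_left_mono)
    have "\<sigma>\<^sup>2 \<le> (sqrt n)\<^sup>2" using \<sigma> by (rule power_mono[rotated])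
    then show "\<sigma>\<^sup>2 / n \<le> 1" using n by simp
  qed (use \<sigma> in auto)
  also have "(\<lambda>x. sign_pm (?X x) * ?X x) = (\<lambda>x. \<bar>?X x\<bar>)"
    by (auto simp: sign_pm_def fun_eq_iff)
  finally show ?thesis by (simp add: \<alpha> mult_ac)
qed

end

section \<open>Slicing the sphere along a direction\<close>

lemma measurable_unit_ball [measurable]: "unit_ball d \<in> sets (lborel_dim d)"
  unfolding unit_ball_def by measurable

lemma measurable_unit_sphere [measurable]: "unit_sphere d \<in> sets (lborel_dim d)"
  unfolding unit_sphere_def by measurable

lemma emeasure_unit_ball_finite: "emeasure (lborel_dim d) (unit_ball d) < \<infinity>"
proof -
  have "unit_ball d \<subseteq> Pi\<^sub>E {..<d} (\<lambda>_. {-1..1})"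
  proof
    fix x assume x: "x \<in> unit_ball d"
    have "\<bar>x i\<bar> \<le> 1" if "i < d" for i
      using abs_le_norm_dim[OF that, of x] x by (simp add: unit_ball_def)
    then show "x \<in> Pi\<^sub>E {..<d} (\<lambda>_. {-1..1})"
      using x by (auto simp: unit_ball_def space_lborel_dim PiE_iff abs_le_iff)
  qed
  then have "emeasure (lborel_dim d) (unit_ball d) \<le> emeasure (lborel_dim d) (Pi\<^sub>E {..<d} (\<lambda>_. {-1..1}))"
    unfolding lborel_dim_def by (intro emeasure_mono sets_PiM_I_finite) auto
  also have "\<dots> < \<infinity>"
    unfolding lborel_dim_def by (subst PL.emeasure_PiM) (auto simp: power_less_top_ennreal)
  finally show ?thesis .
qed

lemma emeasure_unit_ball_pos: "emeasure (lborel_dim d) (unit_ball d) > 0"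
proof (cases "d = 0")
  case True
  then show ?thesis
    by (simp add: unit_ball_def lborel_dim_def norm_dim_def PL.emeasure_PiM[of "{}" "\<lambda>_. {}", simplified] space_PiM)
next
  case False
  let ?B = "Pi\<^sub>E {..<d} (\<lambda>_. {0..1 / real d})"
  have "?B \<subseteq> unit_ball d"
  proof
    fix x assume x: "x \<in> ?B"
    have "(\<Sum>i<d. (x i)\<^sup>2) \<le> (\<Sum>i<d. (1 / real d)\<^sup>2)"
      by (intro sum_mono power_mono) (use x in \<open>auto simp: PiE_iff\<close>)
    also have "\<dots> \<le> 1"
      using False by (simp add: power2_eq_square field_simps)
    finally show "x \<in> unit_ball d"
      using x by (auto simp: unit_ball_def space_lborel_dim norm_dim_def PiE_iff)
  qed
  then have "emeasure (lborel_dim d) ?B \<le> emeasure (lborel_dim d) (unit_ball d)"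
    by (intro emeasure_mono) auto
  moreover have "emeasure (lborel_dim d) ?B = ennreal (1 / d) ^ d"
    unfolding lborel_dim_def by (subst PL.emeasure_PiM) auto
  moreover have "\<dots> > 0" using False by (simp add: ennreal_power)
  ultimately show ?thesis by simp
qed

section \<open>The laws of the sphere and of its equator\<close>

text \<open>\<open>uniform_sphere\<close> before the restriction to the sphere. Keeping the whole
  product space as the carrier lets it be an instance of \<open>rotation_invariant\<close>.\<close>

definition sphere_law :: "nat \<Rightarrow> (nat \<Rightarrow> real) measure" where
  "sphere_law d = distr (uniform_measure (lborel_dim d) (unit_ball d)) (lborel_dim d) (direction d)"

lemma uniform_sphere_eq: "uniform_sphere d = restrict_space (sphere_law d) (unit_sphere d)"
  by (simp add: uniform_sphere_def sphere_law_def direction_def[abs_def])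

lemma sphere_law_density: "sphere_law d = distr (density (lborel_dim d) 
    (\<lambda>x. indicator {..1} (norm_dim d x) / emeasure (lborel_dim d) (unit_ball d))) (lborel_dim d) (direction d)"
proof -
  have "uniform_measure (lborel_dim d) (unit_ball d) = density (lborel_dim d) 
    (\<lambda>x. indicator {..1} (norm_dim d x) / emeasure (lborel_dim d) (unit_ball d))"
    unfolding uniform_measure_def
    by (intro density_cong) (auto intro!: AE_I2 simp: unit_ball_def indicator_def)
  then show ?thesis by (simp add: sphere_law_def)
qed

lemma rotation_invariant_sphere_law:
  assumes "d \<ge> 1" shows "rotation_invariant (sphere_law d) d"
  unfolding sphere_law_density
proof (rule rotation_invariant_direction[OF assms, where \<rho>="\<lambda>r. indicator {..1} r / emeasure (lborel_dim d) (unit_ball d)"])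
  have "(\<integral>\<^sup>+x. indicator {..1} (norm_dim d x) / emeasure (lborel_dim d) (unit_ball d) \<partial>lborel_dim d) =
     (\<integral>\<^sup>+x. indicator {..1} (norm_dim d x) \<partial>lborel_dim d) / emeasure (lborel_dim d) (unit_ball d)"
    by (rule nn_integral_divide) measurable
  also have "(\<integral>\<^sup>+x. indicator {..1} (norm_dim d x) \<partial>lborel_dim d) = 
      (\<integral>\<^sup>+x. indicator (unit_ball d) x \<partial>lborel_dim d)"
    by (intro nn_integral_cong) (auto simp: unit_ball_def indicator_def)
  also have "\<dots> / emeasure (lborel_dim d) (unit_ball d) = 1"
    using emeasure_unit_ball_finite[of d] emeasure_unit_ball_pos[of d]
    by (simp add: ennreal_divide_self)
  finally show "(\<integral>\<^sup>+x. indicator {..1} (norm_dim d x) / emeasure (lborel_dim d) (unit_ball d) \<partial>lborel_dim d) = 1" .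
qed simp

definition cone_mass :: "nat \<Rightarrow> ennreal" where
  "cone_mass n = (\<integral>\<^sup>+x. ennreal (norm_dim n x) * indicator {..1} (norm_dim n x) \<partial>lborel_dim n)"

text \<open>The weight is the length of \<open>x\<close>: it is the Jacobian of \<open>s = t * norm x\<close>, so that this is the law
  of the equatorial direction of a uniform point of the ball one dimension higher.\<close>

definition equator_law :: "nat \<Rightarrow> (nat \<Rightarrow> real) measure" where
  "equator_law n = distr (density (lborel_dim n)
     (\<lambda>x. ennreal (norm_dim n x) * indicator {..1} (norm_dim n x) / cone_mass n)) (lborel_dim n) (direction n)"

lemma cone_mass_finite: "cone_mass n < \<infinity>"
proof -
  have "cone_mass n \<le> (\<integral>\<^sup>+x. indicator (unit_ball n) x \<partial>lborel_dim n)"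
    unfolding cone_mass_def by (intro nn_integral_mono) (auto simp: unit_ball_def indicator_def)
  then show ?thesis using emeasure_unit_ball_finite[of n] by (simp add: order.strict_trans1)
qed

lemma cone_mass_pos: assumes "n \<ge> 1" shows "cone_mass n > 0"
proof (rule ccontr)
  assume "\<not> ?thesis"
  then have 0: "(\<integral>\<^sup>+x. ennreal (norm_dim n x) * indicator {..1} (norm_dim n x) \<partial>lborel_dim n) = 0"
    by (simp add: cone_mass_def zero_less_iff_neq_zero)
  have "(\<lambda>x. ennreal (norm_dim n x) * indicator {..1} (norm_dim n x)) \<in> borel_measurable (lborel_dim n)"
    by measurable
  from nn_integral_0_iff_AE[OF this] 0
  have "AE x in lborel_dim n. ennreal (norm_dim n x) * indicator {..1} (norm_dim n x) = 0"
    by simp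
  with AE_lborel_dim_norm[OF assms]
  have "AE x in lborel_dim n. \<not> norm_dim n x \<le> 1"
  proof eventually_elim
    case (elim x)
    have "norm_dim n x > 0" using elim(1) norm_dim_nonneg[of n x] by linarith
    then show ?case using elim(2) by auto
  qed
  from emeasure_eq_0_AE[OF this] have "emeasure (lborel_dim n) (unit_ball n) = 0"
    by (simp add: unit_ball_def)
  then show False using emeasure_unit_ball_pos[of n] by simp
qed

lemma rotation_invariant_equator_law:
  assumes "n \<ge> 1" shows "rotation_invariant (equator_law n) n"
  unfolding equator_law_def
proof (rule rotation_invariant_direction[OF assms, where \<rho>="\<lambda>r. ennreal r * indicator {..1} r / cone_mass n"])
  have "(\<integral>\<^sup>+x. ennreal (norm_dim n x) * indicator {..1} (norm_dim n x) / cone_mass n \<partial>lborel_dim n) = cone_mass n / cone_mass n"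
    unfolding cone_mass_def by (rule nn_integral_divide) measurable
  then show "(\<integral>\<^sup>+x. ennreal (norm_dim n x) * indicator {..1} (norm_dim n x) / cone_mass n \<partial>lborel_dim n) = 1"
    using cone_mass_pos[OF assms] cone_mass_finite[of n] by (simp add: ennreal_divide_self)
qed simp

lemma nn_integral_lborel_dim_Suc:
  assumes f: "f \<in> borel_measurable (lborel_dim (Suc n))"
  shows "(\<integral>\<^sup>+x. f x \<partial>lborel_dim (Suc n)) = (\<integral>\<^sup>+x. (\<integral>\<^sup>+t. f (x(n := t)) \<partial>lborel) \<partial>lborel_dim n)"
  using PL.product_nn_integral_insert[of "{..<n}" n f] f by (simp add: lborel_dim_def lessThan_Suc)

lemma measurable_fun_upd_Suc [measurable]:
  "(\<lambda>(x, t). x(n := t)) \<in> measurable (lborel_dim n \<Otimes>\<^sub>M borel) (lborel_dim (Suc n))"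
  unfolding lborel_dim_def lessThan_Suc
  using measurable_add_dim[of n "{..<n}" "\<lambda>_. lborel :: real measure"]
  by (subst measurable_cong_sets[OF sets_pair_measure_cong[OF refl, of borel lborel] refl]) (simp_all add: insert_commute)

lemma nn_integral_lborel_dim_scale:
  assumes "c > 0" "f \<in> borel_measurable (lborel_dim n)"
  shows "(\<integral>\<^sup>+x. f x \<partial>lborel_dim n) = ennreal (c ^ n) * (\<integral>\<^sup>+x. f (\<lambda>i\<in>{..<n}. c * x i) \<partial>lborel_dim n)"
  using assms(2)
proof (induction n arbitrary: f)
  case 0
  show ?case
    by (simp add: lborel_dim_def PiM_empty nn_integral_count_space_finite restrict_def)
next
  case (Suc n)
  note [measurable] = Suc.prems
  let ?g = "\<lambda>x. \<integral>\<^sup>+t. f (x(n := c * t)) \<partial>lborel"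
  have [measurable]: "(\<lambda>(x, t). f (x(n := t))) \<in> borel_measurable (lborel_dim n \<Otimes>\<^sub>M borel)"
    using measurable_compose[OF measurable_fun_upd_Suc Suc.prems] by (simp add: case_prod_beta')
  have [measurable]: "(\<lambda>(x, t). f (x(n := c * t))) \<in> borel_measurable (lborel_dim n \<Otimes>\<^sub>M borel)"
    using measurable_compose[of "\<lambda>(x, t). (x, c * t)" _ "lborel_dim n \<Otimes>\<^sub>M borel" "\<lambda>(x, t). f (x(n := t))"]
    by (simp add: case_prod_beta')
  have g [measurable]: "?g \<in> borel_measurable (lborel_dim n)"
    by measurable
  have "(\<integral>\<^sup>+x. f x \<partial>lborel_dim (Suc n)) = (\<integral>\<^sup>+x. (\<integral>\<^sup>+t. f (x(n := t)) \<partial>lborel) \<partial>lborel_dim n)"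
    by (rule nn_integral_lborel_dim_Suc) measurable
  also have "\<dots> = (\<integral>\<^sup>+x. ennreal c * ?g x \<partial>lborel_dim n)"
  proof (rule nn_integral_cong)
    fix x assume x: "x \<in> space (lborel_dim n)"
    have "(\<lambda>t. f (x(n := t))) \<in> borel_measurable borel"
      using measurable_Pair2[of "\<lambda>(x, t). f (x(n := t))" "lborel_dim n" borel, OF _ x] by simp
    from nn_integral_real_affine[OF this, of c 0] assms(1)
    show "(\<integral>\<^sup>+t. f (x(n := t)) \<partial>lborel) = ennreal c * ?g x" by simp
  qed
  also have "\<dots> = ennreal c * (\<integral>\<^sup>+x. ?g x \<partial>lborel_dim n)"
    by (rule nn_integral_cmult) measurable
  also have "(\<integral>\<^sup>+x. ?g x \<partial>lborel_dim n) = ennreal (c ^ n) * (\<integral>\<^sup>+x. ?g (\<lambda>i\<in>{..<n}. c * x i) \<partial>lborel_dim n)"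
    by (rule Suc.IH[OF g])
  also have "(\<integral>\<^sup>+x. ?g (\<lambda>i\<in>{..<n}. c * x i) \<partial>lborel_dim n) = 
      (\<integral>\<^sup>+x. (\<integral>\<^sup>+t. f (\<lambda>i\<in>{..<Suc n}. c * (x(n := t)) i) \<partial>lborel) \<partial>lborel_dim n)"
    by (intro nn_integral_cong arg_cong[of _ _ f]) (auto simp: fun_eq_iff less_Suc_eq)
  also have "\<dots> = (\<integral>\<^sup>+x. f (\<lambda>i\<in>{..<Suc n}. c * x i) \<partial>lborel_dim (Suc n))"
    by (rule nn_integral_lborel_dim_Suc[symmetric], rule measurable_compose[OF measurable_restrict_lborel_dim Suc.prems])
      measurable
  finally have "(\<integral>\<^sup>+x. f x \<partial>lborel_dim (Suc n)) =
      ennreal c * (ennreal (c ^ n) * (\<integral>\<^sup>+x. f (\<lambda>i\<in>{..<Suc n}. c * x i) \<partial>lborel_dim (Suc n)))" .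
  moreover have "ennreal (c ^ Suc n) = ennreal c * ennreal (c ^ n)"
    using assms(1) by (simp add: ennreal_mult)
  ultimately show ?case by (simp only: mult.assoc)
qed

section \<open>Slopes over the equator\<close>

text \<open>For \<open>h\<close> on the equator this is the point whose latitude has tangent
  \<open>t\<close>. With the tangent instead of the sine, the sign of an inner product is the sign
  of an affine function of \<open>t\<close>.\<close>

definition tilt :: "nat \<Rightarrow> real \<Rightarrow> (nat \<Rightarrow> real) \<Rightarrow> nat \<Rightarrow> real" where
  "tilt n t h = (\<lambda>i\<in>{..<Suc n}. (if i = n then t else h i) / sqrt (1 + t\<^sup>2))"

lemma measurable_tilt [measurable]: "(\<lambda>(t, h). tilt n t h) \<in> measurable (borel \<Otimes>\<^sub>M lborel_dim n) (lborel_dim (Suc n))"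
  unfolding tilt_def[abs_def] case_prod_beta'
proof (rule measurable_restrict_lborel_dim)
  fix i assume "i < Suc n"
  then consider "i = n" | "i < n" "i \<noteq> n" by linarith
  then show "(\<lambda>x. (if i = n then fst x else snd x i) / sqrt (1 + (fst x)\<^sup>2)) \<in> borel_measurable (borel \<Otimes>\<^sub>M lborel_dim n)"
    by cases simp_all
qed

lemma dot_tilt: "dot (Suc n) b (tilt n t h) = (dot n b h + b n * t) / sqrt (1 + t\<^sup>2)"
proof -
  have "dot (Suc n) b (tilt n t h) = dot (Suc n) b (\<lambda>i. (if i = n then t else h i) / sqrt (1 + t\<^sup>2))"
    by (simp only: tilt_def dot_restrict)
  also have "\<dots> = dot (Suc n) b (\<lambda>i. if i = n then t else h i) / sqrt (1 + t\<^sup>2)"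
    by (rule dot_divide_right)
  also have "dot (Suc n) b (\<lambda>i. if i = n then t else h i) = dot n b h + b n * t"
    by (simp add: dot_def)
  finally show ?thesis .
qed

text \<open>The last coordinate is written as slope times length of the others, the order of
  integration is exchanged, and the others are rescaled so that the ball of dimension
  \<open>Suc n\<close> becomes the ball of dimension \<open>n\<close> at every slope.\<close>

lemma nn_integral_ball_slices:
  assumes F [measurable]: "F \<in> borel_measurable (lborel_dim (Suc n))" and n: "n \<ge> 1"
  shows "(\<integral>\<^sup>+x. indicator {..1} (norm_dim (Suc n) x) * F (direction (Suc n) x) \<partial>lborel_dim (Suc n)) =
    (\<integral>\<^sup>+t. ennreal (1 / sqrt (1 + t\<^sup>2) ^ Suc n) * 
      (\<integral>\<^sup>+h. ennreal (norm_dim n h) * indicator {..1} (norm_dim n h) * F (tilt n t (direction n h)) \<partial>lborel_dim n) \<partial>lborel)"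
proof -
  let ?G = "\<lambda>x. indicator {..1} (norm_dim (Suc n) x) * F (direction (Suc n) x)"
  let ?L = "lborel_dim n"
  let ?s = "\<lambda>t. sqrt (1 + t\<^sup>2)"
  let ?Q = "\<lambda>(t, h). ennreal (norm_dim n h) * (indicator {..1} (norm_dim n h * ?s t) * F (tilt n t (direction n h)))"
  have tm [measurable]: "(\<lambda>(t, h). tilt n t (direction n h)) \<in> measurable (borel \<Otimes>\<^sub>M ?L) (lborel_dim (Suc n))"
    using measurable_compose[of "\<lambda>(t, h). (t, direction n h)" "borel \<Otimes>\<^sub>M ?L" "borel \<Otimes>\<^sub>M ?L" "\<lambda>(t, h). tilt n t h"]
    by (simp add: case_prod_beta')
  have Ft [measurable]: "(\<lambda>(t, h). F (tilt n t (direction n h))) \<in> borel_measurable (borel \<Otimes>\<^sub>M ?L)"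
    using measurable_compose[OF tm F] by (simp add: case_prod_beta')
  have Q [measurable]: "?Q \<in> borel_measurable (borel \<Otimes>\<^sub>M ?L)"
    by measurable
  have Qs: "(\<lambda>(h, t). ?Q (t, h)) \<in> borel_measurable (?L \<Otimes>\<^sub>M borel)"
    using measurable_compose[OF measurable_pair_swap'[of ?L borel] Q] by (simp add: case_prod_beta')
  have norm: "norm_dim (Suc n) (h(n := norm_dim n h * t)) = norm_dim n h * ?s t" for h t
  proof -
    have "(norm_dim (Suc n) (h(n := norm_dim n h * t)))\<^sup>2 = (norm_dim n h * ?s t)\<^sup>2"
      unfolding norm_dim_square[of "Suc n"] power_mult_distrib norm_dim_square[of n]
      by (simp add: dot_def power2_eq_square algebra_simps norm_dim_square[of n h, unfolded dot_def power2_eq_square])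
    then show ?thesis by (rule power2_eq_imp_eq) auto
  qed
  have dir: "direction (Suc n) (h(n := norm_dim n h * t)) = tilt n t (direction n h)" if "norm_dim n h \<noteq> 0" for h t
    using that unfolding direction_def[of "Suc n"] norm by (auto simp: fun_eq_iff tilt_def direction_def)
  have "(\<integral>\<^sup>+x. ?G x \<partial>lborel_dim (Suc n)) = (\<integral>\<^sup>+h. (\<integral>\<^sup>+t. ?G (h(n := t)) \<partial>lborel) \<partial>?L)"
    by (rule nn_integral_lborel_dim_Suc) measurable
  also have "\<dots> = (\<integral>\<^sup>+h. (\<integral>\<^sup>+t. ?Q (t, h) \<partial>lborel) \<partial>?L)"
  proof (rule nn_integral_cong_AE)
    \<comment> \<open>The substitution degenerates at \<open>h = 0\<close>, a null set because
      \<open>n >= 1\<close>.\<close>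
    show "AE h in ?L. (\<integral>\<^sup>+t. ?G (h(n := t)) \<partial>lborel) = (\<integral>\<^sup>+t. ?Q (t, h) \<partial>lborel)"
      using AE_lborel_dim_norm[OF n] AE_space
    proof eventually_elim
      case (elim h)
      have "(\<lambda>(x, t). ?G (x(n := t))) \<in> borel_measurable (?L \<Otimes>\<^sub>M borel)"
        using measurable_compose[OF measurable_fun_upd_Suc, of ?G n borel] by (simp add: case_prod_beta')
      from measurable_Pair2[OF this elim(2)]
      have G: "(\<lambda>t. ?G (h(n := t))) \<in> borel_measurable borel" by simp
      have "(\<integral>\<^sup>+t. ?G (h(n := t)) \<partial>lborel) = ennreal (norm_dim n h) * (\<integral>\<^sup>+t. ?G (h(n := norm_dim n h * t)) \<partial>lborel)"
        using nn_integral_real_affine[OF G, of "norm_dim n h" 0] elim by simp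
      also have "\<dots> = (\<integral>\<^sup>+t. ennreal (norm_dim n h) * ?G (h(n := norm_dim n h * t)) \<partial>lborel)"
      proof (rule nn_integral_cmult[symmetric])
        show "(\<lambda>t. ?G (h(n := norm_dim n h * t))) \<in> borel_measurable lborel"
          using measurable_compose[of "\<lambda>t. norm_dim n h * t" borel borel, OF _ G] by simp
      qed
      also have "\<dots> = (\<integral>\<^sup>+t. ?Q (t, h) \<partial>lborel)"
        unfolding norm dir[OF elim(1)] by simp
      finally show ?case .
    qed
  qed
  also have "\<dots> = (\<integral>\<^sup>+t. (\<integral>\<^sup>+h. ?Q (t, h) \<partial>?L) \<partial>lborel)"
  proof -
    interpret pair_sigma_finite ?L "lborel :: real measure"
      by (intro pair_sigma_finite.intro sigma_finite_lborel_dim lborel.sigma_finite_measure_axioms)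
    have "(\<lambda>(h, t). ?Q (t, h)) \<in> borel_measurable (?L \<Otimes>\<^sub>M lborel)"
      using Qs by (subst measurable_cong_sets[OF sets_pair_measure_cong[OF refl, of lborel borel] refl]) simp_all
    from Fubini'[OF this] show ?thesis by simp
  qed
  also have "\<dots> = (\<integral>\<^sup>+t. ennreal (1 / ?s t ^ Suc n) * 
      (\<integral>\<^sup>+h. ennreal (norm_dim n h) * indicator {..1} (norm_dim n h) * F (tilt n t (direction n h)) \<partial>lborel_dim n) \<partial>lborel)"
  proof (rule nn_integral_cong)
    fix t :: real
    \<comment> \<open>Rescaling \<open>h\<close> by \<open>c\<close> frees the indicator from
      \<open>t\<close>. The volume contributes \<open>c ^ n\<close> and the weight
      \<open>norm_dim n h\<close> one more factor, hence the exponent \<open>Suc n\<close>.\<close>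
    define c where "c = 1 / ?s t"
    have s: "?s t > 0" by (simp add: add_pos_nonneg)
    have c: "c > 0" using s by (simp add: c_def)
    have sc: "norm_dim n (\<lambda>i\<in>{..<n}. c * h i) = c * norm_dim n h" for h
      unfolding norm_dim_restrict norm_dim_scale using c by simp
    have dc: "direction n (\<lambda>i\<in>{..<n}. c * h i) = direction n h" for h
      using c unfolding direction_def[of n "\<lambda>i\<in>{..<n}. c * h i"] sc by (auto simp: direction_def fun_eq_iff)
    have Qt: "(\<lambda>h. ?Q (t, h)) \<in> borel_measurable ?L"
      using measurable_Pair2[OF Q, of t] by simp
    have Ftt [measurable]: "(\<lambda>h. F (tilt n t (direction n h))) \<in> borel_measurable ?L"
      using measurable_Pair2[OF Ft, of t] by simp
    have "(\<integral>\<^sup>+h. ?Q (t, h) \<partial>?L) = ennreal (c ^ n) * (\<integral>\<^sup>+h. ?Q (t, \<lambda>i\<in>{..<n}. c * h i) \<partial>?L)"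
      by (rule nn_integral_lborel_dim_scale[OF c Qt])
    also have "(\<lambda>h. ?Q (t, \<lambda>i\<in>{..<n}. c * h i)) = 
       (\<lambda>h. ennreal c * (ennreal (norm_dim n h) * indicator {..1} (norm_dim n h) * F (tilt n t (direction n h))))"
    proof
      fix h
      have "c * norm_dim n h * ?s t = norm_dim n h" using s by (simp add: c_def)
      moreover have "ennreal (c * norm_dim n h) = ennreal c * ennreal (norm_dim n h)"
        using c by (intro ennreal_mult) auto
      ultimately show "?Q (t, \<lambda>i\<in>{..<n}. c * h i) =
         ennreal c * (ennreal (norm_dim n h) * indicator {..1} (norm_dim n h) * F (tilt n t (direction n h)))"
        unfolding case_prod_conv sc dc by (simp only: mult.assoc)
    qed
    also have "(\<integral>\<^sup>+h. ennreal c * (ennreal (norm_dim n h) * indicator {..1} (norm_dim n h) * F (tilt n t (direction n h))) \<partial>?L) =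
      ennreal c * (\<integral>\<^sup>+h. ennreal (norm_dim n h) * indicator {..1} (norm_dim n h) * F (tilt n t (direction n h)) \<partial>?L)"
      by (rule nn_integral_cmult) measurable
    finally have "(\<integral>\<^sup>+h. ?Q (t, h) \<partial>?L) = ennreal (c ^ n) * (ennreal c *
      (\<integral>\<^sup>+h. ennreal (norm_dim n h) * indicator {..1} (norm_dim n h) * F (tilt n t (direction n h)) \<partial>?L))" .
    moreover have "ennreal (1 / ?s t ^ Suc n) = ennreal (c ^ n) * ennreal c"
      using c by (simp add: ennreal_mult[symmetric] c_def power_one_over)
    ultimately show "(\<integral>\<^sup>+h. ?Q (t, h) \<partial>?L) = ennreal (1 / ?s t ^ Suc n) * 
      (\<integral>\<^sup>+h. ennreal (norm_dim n h) * indicator {..1} (norm_dim n h) * F (tilt n t (direction n h)) \<partial>lborel_dim n)"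
      by (simp only: mult.assoc)
  qed
  finally show ?thesis .
qed

section \<open>The one-dimensional law of the slope\<close>

text \<open>Unnormalised, and indexed by the ambient dimension, whereas \<open>slice_const\<close>
  and \<open>slice_law\<close> are indexed by \<open>n\<close>, one less.\<close>

definition slice_density :: "nat \<Rightarrow> real \<Rightarrow> real" where
  "slice_density d t = 1 / sqrt (1 + t\<^sup>2) ^ d"

definition slice_const :: "nat \<Rightarrow> real" where
  "slice_const n = enn2real (cone_mass n / emeasure (lborel_dim (Suc n)) (unit_ball (Suc n)))"

definition slice_law :: "nat \<Rightarrow> real measure" where
  "slice_law n = density lborel (\<lambda>t. ennreal (slice_const n * slice_density (Suc n) t))"

lemma measurable_slice_density [measurable]: "slice_density d \<in> borel_measurable borel"
  unfolding slice_density_def[abs_def] by measurable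

lemma sets_slice_law [measurable_cong]: "sets (slice_law n) = sets borel"
  by (simp add: slice_law_def)

lemma space_slice_law [simp]: "space (slice_law n) = UNIV"
  by (simp add: slice_law_def)

lemma slice_density_pos: "slice_density d t > 0"
  by (simp add: slice_density_def add_pos_nonneg)

lemma slice_density_le_1: "slice_density d t \<le> 1"
  by (simp add: slice_density_def divide_le_eq_1_pos add_pos_nonneg one_le_power)

lemma slice_density_minus [simp]: "slice_density d (- t) = slice_density d t"
  by (simp add: slice_density_def)

lemma slice_density_antimono: "\<bar>s\<bar> \<le> \<bar>t\<bar> \<Longrightarrow> slice_density d t \<le> slice_density d s"
  unfolding slice_density_def
  by (intro divide_left_mono power_mono mult_pos_pos zero_less_power)
    (auto simp: add_pos_nonneg abs_le_square_iff)

text \<open>Bernoulli's inequality applied to \<open>1 / sqrt (1 + x) >= 1 - x / 2\<close>.\<close>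

lemma slice_density_ge:
  assumes "t\<^sup>2 \<le> 1"
  shows "slice_density d t \<ge> 1 - d * t\<^sup>2 / 2"
proof -
  let ?x = "t\<^sup>2"
  have "(1 - ?x / 2) * sqrt (1 + ?x) \<le> 1"
  proof (rule power2_le_imp_le)
    have "((1 - ?x / 2) * sqrt (1 + ?x))\<^sup>2 = (1 - ?x / 2)\<^sup>2 * (1 + ?x)"
      by (simp add: power_mult_distrib)
    also have "\<dots> = 1 - ?x\<^sup>2 * (3 - ?x) / 4"
      by (simp add: power2_eq_square field_simps)
    also have "\<dots> \<le> 1\<^sup>2"
      using assms by simp
    finally show "((1 - ?x / 2) * sqrt (1 + ?x))\<^sup>2 \<le> 1\<^sup>2" .
  qed simp
  then have *: "1 - ?x / 2 \<le> 1 / sqrt (1 + ?x)"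
    by (simp add: pos_le_divide_eq add_pos_nonneg)
  have "1 - d * ?x / 2 \<le> (1 + (- (?x / 2))) ^ d"
    using Bernoulli_inequality[of "- (?x / 2)" d] assms by simp
  also have "\<dots> \<le> (1 / sqrt (1 + ?x)) ^ d"
    using * assms by (intro power_mono) auto
  finally show ?thesis by (simp add: slice_density_def power_one_over)
qed

text \<open>A Cauchy density as majorant, whose integral is known. The square of
  \<open>1 + d * x / 2\<close> is dominated by the binomial expansion of \<open>(1 + x) ^ d\<close>
  up to degree two, as \<open>d^2 / 4 <= d * (d - 1) / 2\<close> for \<open>d >= 2\<close>.\<close>

lemma slice_density_le:
  assumes "d \<ge> 2"
  shows "slice_density d t \<le> 1 / (1 + d * t\<^sup>2 / 2)"
proof -
  have *: "(1 + x) ^ d \<ge> 1 + d * x + d * (d - 1) / 2 * x\<^sup>2" if "x \<ge> 0" for x :: real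
  proof (induction d)
    case (Suc d)
    have "1 + Suc d * x + Suc d * (Suc d - 1) / 2 * x\<^sup>2 \<le> (1 + x) * (1 + d * x + d * (d - 1) / 2 * x\<^sup>2)"
    proof -
      have "(1 + x) * (1 + d * x + d * (d - 1) / 2 * x\<^sup>2) - (1 + Suc d * x + Suc d * (Suc d - 1) / 2 * x\<^sup>2) =
        real d * (real d - 1) / 2 * x ^ 3"
        by (cases d) (simp_all add: field_simps power2_eq_square power3_eq_cube)
      moreover have "real d * (real d - 1) / 2 * x ^ 3 \<ge> 0"
        using that by (cases d) auto
      ultimately show ?thesis by linarith
    qed
    also have "\<dots> \<le> (1 + x) * (1 + x) ^ d"
      by (rule mult_left_mono[OF Suc.IH]) (use that in simp)
    finally show ?case by simp
  qed simp
  have "(1 + d * t\<^sup>2 / 2)\<^sup>2 = 1 + d * t\<^sup>2 + (real d)\<^sup>2 / 4 * (t\<^sup>2)\<^sup>2"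
    by (simp add: power2_eq_square field_simps)
  also have "\<dots> \<le> 1 + d * t\<^sup>2 + d * (d - 1) / 2 * (t\<^sup>2)\<^sup>2"
  proof -
    have "(real d)\<^sup>2 / 4 \<le> d * (d - 1) / 2"
      using assms by (simp add: of_nat_diff power2_eq_square field_simps)
    then show ?thesis by (intro add_left_mono mult_right_mono) auto
  qed
  also have "\<dots> \<le> (1 + t\<^sup>2) ^ d" by (rule *) simp
  also have "\<dots> = (sqrt (1 + t\<^sup>2) ^ d)\<^sup>2"
    by (simp add: power_mult[symmetric] mult.commute[of d] power_mult)
  finally have "1 + d * t\<^sup>2 / 2 \<le> sqrt (1 + t\<^sup>2) ^ d"
    by (rule power2_le_imp_le) simp
  then show ?thesis unfolding slice_density_def
    by (intro divide_left_mono mult_pos_pos) (auto simp: add_pos_nonneg)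
qed

lemma slice_ratio_finite: "cone_mass n / emeasure (lborel_dim d) (unit_ball d) \<noteq> \<top>"
  using cone_mass_finite[of n] emeasure_unit_ball_pos[of d] by (auto simp: ennreal_divide_eq_top_iff)

lemma slice_const_pos: assumes "n \<ge> 1" shows "slice_const n > 0"
proof -
  have "cone_mass n / emeasure (lborel_dim (Suc n)) (unit_ball (Suc n)) > 0"
    using cone_mass_pos[OF assms] emeasure_unit_ball_finite[of "Suc n"] by (auto simp: ennreal_zero_less_divide)
  then show ?thesis
    unfolding slice_const_def enn2real_positive_iff using slice_ratio_finite[of n "Suc n"] by (simp add: less_top)
qed

lemma ennreal_slice_const:
  "ennreal (slice_const n) = cone_mass n / emeasure (lborel_dim (Suc n)) (unit_ball (Suc n))"
  unfolding slice_const_def using slice_ratio_finite[of n "Suc n"] by (simp add: less_top)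

lemma nn_integral_equator_law:
  assumes n: "n \<ge> 1" and G [measurable]: "G \<in> borel_measurable (lborel_dim n)"
  shows "(\<integral>\<^sup>+h. ennreal (norm_dim n h) * indicator {..1} (norm_dim n h) * G (direction n h) \<partial>lborel_dim n) =
    cone_mass n * (\<integral>\<^sup>+h. G h \<partial>equator_law n)"
proof -
  have "(\<integral>\<^sup>+h. G h \<partial>equator_law n) = 
    (\<integral>\<^sup>+h. ennreal (norm_dim n h) * indicator {..1} (norm_dim n h) / cone_mass n * G (direction n h) \<partial>lborel_dim n)"
    unfolding equator_law_def by (subst nn_integral_distr) (measurable, simp add: nn_integral_density)
  also have "\<dots> = (\<integral>\<^sup>+h. (ennreal (norm_dim n h) * indicator {..1} (norm_dim n h) * G (direction n h)) / cone_mass n \<partial>lborel_dim n)"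
    by (simp add: divide_ennreal_def mult_ac)
  also have "\<dots> = (\<integral>\<^sup>+h. ennreal (norm_dim n h) * indicator {..1} (norm_dim n h) * G (direction n h) \<partial>lborel_dim n) / cone_mass n"
    by (rule nn_integral_divide) measurable
  finally show ?thesis
    using cone_mass_pos[OF n] cone_mass_finite[of n]
    by (simp add: ennreal_times_divide mult.commute[of "cone_mass n"] ennreal_mult_divide_eq mult_divide_eq_ennreal)
qed

lemma nn_integral_sphere_law:
  assumes n: "n \<ge> 1" and F [measurable]: "F \<in> borel_measurable (lborel_dim (Suc n))"
  shows "(\<integral>\<^sup>+x. F x \<partial>sphere_law (Suc n)) = (\<integral>\<^sup>+t. (\<integral>\<^sup>+h. F (tilt n t h) \<partial>equator_law n) \<partial>slice_law n)"
proof -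
  let ?V = "emeasure (lborel_dim (Suc n)) (unit_ball (Suc n))"
  interpret E: rotation_invariant "equator_law n" n by (rule rotation_invariant_equator_law[OF n])
  have tF: "(\<lambda>h. F (tilt n t h)) \<in> borel_measurable (lborel_dim n)" for t
    using measurable_Pair2[OF measurable_compose[OF measurable_tilt F], of t] by simp
  have "(\<lambda>(t, h). F (tilt n t h)) \<in> borel_measurable (borel \<Otimes>\<^sub>M lborel_dim n)"
    using measurable_compose[OF measurable_tilt F] by (simp add: case_prod_beta')
  then have "(\<lambda>(t, h). F (tilt n t h)) \<in> borel_measurable (borel \<Otimes>\<^sub>M equator_law n)"
    by (subst measurable_cong_sets[OF sets_pair_measure_cong[OF refl E.sets_eq] refl])
  then have im [measurable]: "(\<lambda>t. \<integral>\<^sup>+h. F (tilt n t h) \<partial>equator_law n) \<in> borel_measurable borel"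
    by (rule E.borel_measurable_nn_integral)
  then have iml: "(\<lambda>t. \<integral>\<^sup>+h. F (tilt n t h) \<partial>equator_law n) \<in> borel_measurable lborel" by simp
  have sd: "(\<lambda>t. ennreal (r * slice_density (Suc n) t)) \<in> borel_measurable lborel" for r
    by simp
  have "(\<integral>\<^sup>+x. F x \<partial>sphere_law (Suc n)) = 
    (\<integral>\<^sup>+x. indicator {..1} (norm_dim (Suc n) x) / ?V * F (direction (Suc n) x) \<partial>lborel_dim (Suc n))"
    unfolding sphere_law_density by (subst nn_integral_distr) (measurable, simp add: nn_integral_density)
  also have "\<dots> = (\<integral>\<^sup>+x. (indicator {..1} (norm_dim (Suc n) x) * F (direction (Suc n) x)) / ?V \<partial>lborel_dim (Suc n))"
    by (simp add: divide_ennreal_def mult_ac)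
  also have "\<dots> = (\<integral>\<^sup>+x. indicator {..1} (norm_dim (Suc n) x) * F (direction (Suc n) x) \<partial>lborel_dim (Suc n)) / ?V"
    by (rule nn_integral_divide) measurable
  also have "\<dots> = (\<integral>\<^sup>+t. ennreal (slice_density (Suc n) t) * 
      (cone_mass n * (\<integral>\<^sup>+h. F (tilt n t h) \<partial>equator_law n)) \<partial>lborel) / ?V"
    unfolding nn_integral_ball_slices[OF F n] slice_density_def
    by (simp only: nn_integral_equator_law[OF n tF])
  also have "\<dots> = (\<integral>\<^sup>+t. ennreal (slice_density (Suc n) t) * 
      (cone_mass n * (\<integral>\<^sup>+h. F (tilt n t h) \<partial>equator_law n)) / ?V \<partial>lborel)"
    by (intro nn_integral_divide[symmetric] borel_measurable_times_ennreal
        iml sd[of 1, simplified]) auto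
  also have "\<dots> = (\<integral>\<^sup>+t. ennreal (slice_const n * slice_density (Suc n) t) * (\<integral>\<^sup>+h. F (tilt n t h) \<partial>equator_law n) \<partial>lborel)"
    using slice_const_pos[OF n] slice_density_pos[of "Suc n"]
    by (intro nn_integral_cong)
      (simp add: ennreal_mult less_imp_le ennreal_slice_const divide_ennreal_def mult_ac)
  also have "\<dots> = (\<integral>\<^sup>+t. (\<integral>\<^sup>+h. F (tilt n t h) \<partial>equator_law n) \<partial>slice_law n)"
    unfolding slice_law_def by (rule nn_integral_density[symmetric, OF sd iml])
  finally show ?thesis .
qed

text \<open>The total mass is read off the slicing identity for the constant function 1, with no
  integral to evaluate.\<close>

lemma prob_space_slice_law:
  assumes n: "n \<ge> 1" shows "prob_space (slice_law n)"
proof (rule prob_spaceI)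
  interpret E: rotation_invariant "equator_law n" n by (rule rotation_invariant_equator_law[OF n])
  interpret S: rotation_invariant "sphere_law (Suc n)" "Suc n" by (rule rotation_invariant_sphere_law) simp
  show "emeasure (slice_law n) (space (slice_law n)) = 1"
    using nn_integral_sphere_law[OF n, of "\<lambda>_. 1"] by (simp add: E.emeasure_space_1 S.emeasure_space_1)
qed

lemma sphere_law_eq_distr:
  assumes n: "n \<ge> 1"
  shows "sphere_law (Suc n) = distr (slice_law n \<Otimes>\<^sub>M equator_law n) (lborel_dim (Suc n)) (\<lambda>(t, h). tilt n t h)"
proof (rule measure_eqI)
  interpret E: rotation_invariant "equator_law n" n by (rule rotation_invariant_equator_law[OF n])
  interpret S: rotation_invariant "sphere_law (Suc n)" "Suc n" by (rule rotation_invariant_sphere_law) simp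
  have sets: "sets (slice_law n \<Otimes>\<^sub>M equator_law n) = sets (borel \<Otimes>\<^sub>M lborel_dim n)"
    by (intro sets_pair_measure_cong E.sets_eq sets_slice_law)
  have t: "(\<lambda>(t, h). tilt n t h) \<in> measurable (slice_law n \<Otimes>\<^sub>M equator_law n) (lborel_dim (Suc n))"
    by (subst measurable_cong_sets[OF sets refl]) (rule measurable_tilt)
  show "sets (sphere_law (Suc n)) = sets (distr (slice_law n \<Otimes>\<^sub>M equator_law n) (lborel_dim (Suc n)) (\<lambda>(t, h). tilt n t h))"
    by (simp add: S.sets_eq)
  fix A assume "A \<in> sets (sphere_law (Suc n))"
  then have A [measurable]: "A \<in> sets (lborel_dim (Suc n))" by (simp add: S.sets_eq)
  have "emeasure (sphere_law (Suc n)) A = (\<integral>\<^sup>+x. indicator A x \<partial>sphere_law (Suc n))"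
    by (simp add: S.sets_eq)
  also have "\<dots> = (\<integral>\<^sup>+t. (\<integral>\<^sup>+h. indicator A (tilt n t h) \<partial>equator_law n) \<partial>slice_law n)"
    by (rule nn_integral_sphere_law[OF n]) measurable
  also have "\<dots> = (\<integral>\<^sup>+z. indicator A ((\<lambda>(t, h). tilt n t h) z) \<partial>(slice_law n \<Otimes>\<^sub>M equator_law n))"
    using measurable_compose[OF t, of "indicator A :: _ \<Rightarrow> ennreal"]
    by (subst E.nn_integral_fst[symmetric]) auto
  also have "\<dots> = (\<integral>\<^sup>+x. indicator A x \<partial>distr (slice_law n \<Otimes>\<^sub>M equator_law n) (lborel_dim (Suc n)) (\<lambda>(t, h). tilt n t h))"
    by (rule nn_integral_distr[symmetric, OF t]) simp
  finally show "emeasure (sphere_law (Suc n)) A = emeasure (distr (slice_law n \<Otimes>\<^sub>M equator_law n) (lborel_dim (Suc n)) (\<lambda>(t, h). tilt n t h)) A"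
    by simp
qed

text \<open>Coordinates adapted to a unit vector \<open>w\<close>: \<open>R\<close> is an isometry taking the last basis vector to \<open>w\<close>
  (it is its own adjoint), and a point of the sphere is \<open>R (tilt n t h)\<close> with \<open>t\<close> and \<open>h\<close> independent.\<close>

lemma sphere_law_slices:
  assumes n: "n \<ge> 1" and w: "norm_dim (Suc n) w = 1" "w \<in> extensional {..<Suc n}"
  obtains R where
    "R \<in> measurable (lborel_dim (Suc n)) (lborel_dim (Suc n))"
    "sphere_law (Suc n) = distr (slice_law n \<Otimes>\<^sub>M equator_law n) (lborel_dim (Suc n)) (\<lambda>(t, h). R (tilt n t h))"
    "\<And>b t h. dot (Suc n) b (R (tilt n t h)) = (dot n (R b) h + dot (Suc n) w b * t) / sqrt (1 + t\<^sup>2)"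
    "\<And>a b. dot n (R a) (R b) = dot (Suc n) a b - dot (Suc n) w a * dot (Suc n) w b"
proof -
  interpret E: rotation_invariant "equator_law n" n by (rule rotation_invariant_equator_law[OF n])
  interpret S: rotation_invariant "sphere_law (Suc n)" "Suc n" by (rule rotation_invariant_sphere_law) simp
  let ?d = "Suc n" and ?L = "lborel_dim (Suc n)"
  have sets: "sets (slice_law n \<Otimes>\<^sub>M equator_law n) = sets (borel \<Otimes>\<^sub>M lborel_dim n)"
    by (intro sets_pair_measure_cong E.sets_eq sets_slice_law)
  have t: "(\<lambda>(t, h). tilt n t h) \<in> measurable (slice_law n \<Otimes>\<^sub>M equator_law n) (lborel_dim (Suc n))"
    by (subst measurable_cong_sets[OF sets refl]) (rule measurable_tilt)
  have dote: "dot ?d (restrict (unit_vec n) {..<?d}) x = x n" for x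
    using dot_unit_vec[of n "Suc n" x] by (simp only: dot_restrict lessI)
  obtain R where R: "R \<in> measurable ?L ?L" "distr (sphere_law ?d) ?L R = sphere_law ?d"
    "\<And>b x. dot ?d b (R x) = dot ?d (R b) x" "\<And>a b. dot ?d (R a) (R b) = dot ?d a b" 
    "\<And>b. (R b) n = dot ?d w b"
  \<comment> \<open>If \<open>w\<close> is already the last basis vector, there is no normal to
    reflect along, and the identity, written as a restriction, takes the place of the
    reflection.\<close>
  proof (cases "restrict (unit_vec n) {..<?d} = w")
    case True
    show ?thesis
    proof (rule that[of "\<lambda>x. restrict x {..<?d}"])
      show m: "(\<lambda>x. restrict x {..<?d}) \<in> measurable ?L ?L"
        by (rule measurable_restrict_lborel_dim) measurable
      have "distr (sphere_law ?d) ?L (\<lambda>x. restrict x {..<?d}) = distr (sphere_law ?d) (sphere_law ?d) (\<lambda>x. x)"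
        using sets_eq_imp_space_eq[OF S.sets_eq]
        by (intro distr_cong) (auto simp: S.sets_eq space_lborel_dim extensional_restrict)
      then show "distr (sphere_law ?d) ?L (\<lambda>x. restrict x {..<?d}) = sphere_law ?d"
        by (simp add: distr_id)
      show "restrict b {..<?d} n = dot ?d w b" for b
        unfolding True[symmetric] dote by simp
    qed simp_all
  next
    case False
    have "norm_dim ?d (restrict (unit_vec n) {..<?d}) = 1"
      using norm_unit_vec[of n "Suc n"] by simp
    then obtain a where a: "norm_dim ?d a = 1" "reflection ?d a (restrict (unit_vec n) {..<?d}) = w"
      using exists_reflection[of ?d "restrict (unit_vec n) {..<?d}" w] False w by auto
    show ?thesis
    proof (rule that[of "reflection ?d a"])
      show "distr (sphere_law ?d) ?L (reflection ?d a) = sphere_law ?d"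
        using S.distr_reflection[OF a(1)] distr_cong[OF refl S.sets_eq[symmetric], of "sphere_law ?d" "reflection ?d a" "reflection ?d a"] by simp
      show "dot ?d b (reflection ?d a x) = dot ?d (reflection ?d a b) x" for b x
        by (rule dot_reflection_move)
      show "dot ?d (reflection ?d a x) (reflection ?d a y) = dot ?d x y" for x y
        by (rule dot_reflection_reflection[OF a(1)])
      show "reflection ?d a b n = dot ?d w b" for b
        using dote[of "reflection ?d a b"] unfolding dot_reflection_move a(2) by simp
    qed simp
  qed
  show ?thesis
  proof (rule that[OF R(1)])
    have "sphere_law ?d = distr (distr (slice_law n \<Otimes>\<^sub>M equator_law n) ?L (\<lambda>(t, h). tilt n t h)) ?L R"
      using R(2) by (simp add: sphere_law_eq_distr[OF n])
    also have "\<dots> = distr (slice_law n \<Otimes>\<^sub>M equator_law n) ?L (\<lambda>(t, h). R (tilt n t h))"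
      by (subst distr_distr[OF R(1) t]) (simp add: o_def case_prod_beta')
    finally show "sphere_law ?d = distr (slice_law n \<Otimes>\<^sub>M equator_law n) ?L (\<lambda>(t, h). R (tilt n t h))" .
    show "dot ?d b (R (tilt n t h)) = (dot n (R b) h + dot ?d w b * t) / sqrt (1 + t\<^sup>2)" for b t h
      unfolding R(3) dot_tilt R(5) ..
    show "dot n (R a) (R b) = dot ?d a b - dot ?d w a * dot ?d w b" for a b
      using R(4)[of a b] by (simp add: dot_def[of ?d "R a"] R(5) dot_def[of n])
  qed
qed

declare measurable_component_lborel_dim [measurable del]

section \<open>Mass of symmetric intervals and size of the slice constant\<close>

lemma emeasure_slice_law:
  assumes "A \<in> sets borel"
  shows "emeasure (slice_law n) A = (\<integral>\<^sup>+t. ennreal (slice_const n * slice_density (Suc n) t) * indicator A t \<partial>lborel)"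
  unfolding slice_law_def using assms by (intro emeasure_density) auto

lemma slice_const_nonneg [simp]: "slice_const n \<ge> 0"
  by (simp add: slice_const_def)

text \<open>\<open>S\<close> is only bounded below by an open interval because it is applied to the
  set in \<open>slice_sign_eq\<close>, whose endpoints depend on the convention for the sign of
  0.\<close>

lemma measure_slice_law_ge:
  assumes n: "n \<ge> 1" and S: "S \<in> sets borel" "{-m<..<m} \<subseteq> S" and m: "0 \<le> m" 
  shows "measure (slice_law n) S \<ge> 2 * m * slice_const n * slice_density (Suc n) m"
proof -
  interpret prob_space "slice_law n" by (rule prob_space_slice_law[OF n])
  have "ennreal (2 * m * slice_const n * slice_density (Suc n) m) =
      (\<integral>\<^sup>+t. ennreal (slice_const n * slice_density (Suc n) m) * indicator {-m<..<m} t \<partial>lborel)"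
    using m slice_density_pos[of "Suc n" m]
    by (subst nn_integral_cmult_indicator) (auto simp: ennreal_mult[symmetric] mult_ac)
  also have "\<dots> \<le> (\<integral>\<^sup>+t. ennreal (slice_const n * slice_density (Suc n) t) * indicator {-m<..<m} t \<partial>lborel)"
    by (intro nn_integral_mono) (auto simp: indicator_def intro!: ennreal_leI mult_left_mono slice_density_antimono)
  also have "\<dots> = emeasure (slice_law n) {-m<..<m}"
    by (rule emeasure_slice_law[symmetric]) simp
  also have "\<dots> \<le> emeasure (slice_law n) S"
    using S by (intro emeasure_mono) (auto simp: sets_slice_law)
  finally show ?thesis by (simp add: emeasure_eq_measure)
qed

lemma measure_slice_law_le:
  assumes n: "n \<ge> 1" and S: "S \<subseteq> {-m..m}" and m: "0 \<le> m" 
  shows "measure (slice_law n) S \<le> 2 * m * slice_const n"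
proof -
  interpret prob_space "slice_law n" by (rule prob_space_slice_law[OF n])
  have "emeasure (slice_law n) S \<le> emeasure (slice_law n) {-m..m}"
    using S by (intro emeasure_mono) (auto simp: sets_slice_law)
  also have "\<dots> = (\<integral>\<^sup>+t. ennreal (slice_const n * slice_density (Suc n) t) * indicator {-m..m} t \<partial>lborel)"
    by (rule emeasure_slice_law) simp
  also have "\<dots> \<le> (\<integral>\<^sup>+t. ennreal (slice_const n) * indicator {-m..m} t \<partial>lborel)"
    by (intro nn_integral_mono mult_right_mono ennreal_leI mult_left_le slice_density_le_1) auto
  also have "\<dots> = ennreal (2 * m * slice_const n)"
    using m by (subst nn_integral_cmult_indicator) (auto simp: ennreal_mult[symmetric] mult_ac)
  finally show ?thesis using m by (simp add: emeasure_eq_measure)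
qed

text \<open>Up to \<open>1 / sqrt (n + 1)\<close> the density is at least one half, and the interval
  of this half-width has mass at most one.\<close>

lemma slice_const_le:
  assumes n: "n \<ge> 1" 
  shows "slice_const n \<le> sqrt (Suc n)"
proof -
  interpret prob_space "slice_law n" by (rule prob_space_slice_law[OF n])
  let ?m = "1 / sqrt (Suc n)"
  have "1 / 2 \<le> slice_density (Suc n) ?m"
    using slice_density_ge[of ?m "Suc n"] by (simp add: power_divide)
  then have "2 * ?m * slice_const n * (1 / 2) \<le> 2 * ?m * slice_const n * slice_density (Suc n) ?m"
    by (intro mult_left_mono) auto
  also have "\<dots> \<le> measure (slice_law n) UNIV"
    by (rule measure_slice_law_ge[OF n]) auto
  also have "\<dots> \<le> 1" by simp
  finally show ?thesis by (simp add: field_simps)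
qed

lemma nn_integral_inverse_1_plus_square: "(\<integral>\<^sup>+x. ennreal (1 / (1 + x\<^sup>2)) \<partial>lborel) = ennreal pi"
proof -
  have "(LINT x:einterval (-\<infinity>) \<infinity>|lborel. inverse (1 + x\<^sup>2)) = pi"
    using LBINT_inverse_1_plus_square by (simp add: interval_lebesgue_integral_def)
  then have "(LINT x|lborel. inverse (1 + x\<^sup>2)) = pi"
    by (simp add: set_lebesgue_integral_def einterval_def)
  moreover have "integrable lborel (\<lambda>x::real. inverse (1 + x\<^sup>2))"
    using integrable_inverse_1_plus_square by (simp add: set_integrable_def einterval_def)
  ultimately show ?thesis
    by (subst nn_integral_eq_integral) (auto simp: field_simps inverse_eq_divide)
qed

text \<open>Total mass one against the Cauchy majorant gives
  \<open>1 <= slice_const n * pi / sqrt ((n + 1) / 2)\<close>; the 10 comes from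
  \<open>pi < 4\<close> and \<open>sqrt 2 <= 2\<close>.\<close>

lemma slice_const_ge:
  assumes n: "n \<ge> 1" 
  shows "slice_const n \<ge> sqrt (Suc n) / 10"
proof -
  interpret prob_space "slice_law n" by (rule prob_space_slice_law[OF n])
  let ?b = "sqrt (Suc n / 2)"
  have b: "?b > 0" by simp
  have "1 = emeasure (slice_law n) UNIV" using emeasure_space_1 by simp
  also have "\<dots> = (\<integral>\<^sup>+t. ennreal (slice_const n * slice_density (Suc n) t) \<partial>lborel)"
    by (subst emeasure_slice_law) auto
  also have "\<dots> \<le> (\<integral>\<^sup>+t. ennreal (slice_const n) * ennreal (1 / (1 + (?b * t)\<^sup>2)) \<partial>lborel)"
  proof (rule nn_integral_mono)
    fix t
    have "slice_const n * slice_density (Suc n) t \<le> slice_const n * (1 / (1 + (?b * t)\<^sup>2))"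
      using slice_density_le[of "Suc n" t] n by (intro mult_left_mono) (auto simp: power_mult_distrib)
    then show "ennreal (slice_const n * slice_density (Suc n) t) \<le> ennreal (slice_const n) * ennreal (1 / (1 + (?b * t)\<^sup>2))"
      by (simp add: ennreal_mult[symmetric] ennreal_leI)
  qed
  also have "\<dots> = ennreal (slice_const n) * (\<integral>\<^sup>+t. ennreal (1 / (1 + (?b * t)\<^sup>2)) \<partial>lborel)"
    by (rule nn_integral_cmult) simp
  also have "(\<integral>\<^sup>+t. ennreal (1 / (1 + (?b * t)\<^sup>2)) \<partial>lborel) = ennreal (pi / ?b)"
  proof -
    have "ennreal pi = ennreal ?b * (\<integral>\<^sup>+t. ennreal (1 / (1 + (?b * t)\<^sup>2)) \<partial>lborel)"
      using nn_integral_real_affine[of "\<lambda>x. ennreal (1 / (1 + x\<^sup>2))" ?b 0] b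
      unfolding nn_integral_inverse_1_plus_square by simp
    then have "ennreal (1 / ?b) * ennreal pi = ennreal (1 / ?b) * ennreal ?b * (\<integral>\<^sup>+t. ennreal (1 / (1 + (?b * t)\<^sup>2)) \<partial>lborel)"
      by (simp only: mult.assoc)
    also have "ennreal (1 / ?b) * ennreal ?b = 1"
      using b by (simp add: ennreal_mult[symmetric] del: real_sqrt_gt_0_iff)
    finally show ?thesis using b by (simp add: ennreal_mult[symmetric])
  qed
  also have "ennreal (slice_const n) * ennreal (pi / ?b) = ennreal (slice_const n * (pi / ?b))"
    using b by (intro ennreal_mult[symmetric]) auto
  finally have "1 \<le> slice_const n * (pi / ?b)"
    by (simp add: ennreal_ge_1)
  then have "?b \<le> slice_const n * pi" using b by (simp add: field_simps)
  also have "\<dots> \<le> slice_const n * 4" using pi_less_4 by (intro mult_left_mono) auto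
  finally have "?b / 4 \<le> slice_const n" by simp
  moreover have "sqrt (Suc n) / 10 \<le> ?b / 4"
  proof -
    have "sqrt 2 \<le> 2" by (rule real_le_lsqrt) auto
    then have "sqrt (Suc n) * sqrt 2 * 4 \<le> sqrt (Suc n) * 10"
      using mult_left_mono[of "sqrt 2 * 4" 10 "sqrt (Suc n)"] by (simp add: mult.assoc)
    then show ?thesis by (simp add: real_sqrt_divide field_simps)
  qed
  ultimately show ?thesis by linarith
qed

section \<open>The label averaged over the slope\<close>

text \<open>Contribution to the filtered correlation of all points over one equatorial point, where
  \<open>a\<close> is the inner product of that point with the target and \<open>c\<close> the
  cosine of the angle. It is not divided by the mass of the band.\<close>

definition slice_sign :: "nat \<Rightarrow> real \<Rightarrow> real \<Rightarrow> real \<Rightarrow> real" where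
  "slice_sign n \<gamma> c a = (LINT t|slice_law n. indicator {-\<gamma>..\<gamma>} t * sign_pm (c * t + a))"

lemma integral_slice_law_minus:
  fixes g :: "real \<Rightarrow> real"
  assumes [measurable]: "g \<in> borel_measurable borel"
  shows "(LINT t|slice_law n. g (- t)) = (LINT t|slice_law n. g t)"
proof -
  let ?k = "\<lambda>t. slice_const n * slice_density (Suc n) t"
  have k: "?k t \<ge> 0" for t using slice_density_pos[of "Suc n" t] by simp
  have "(LINT t|slice_law n. g t) = (LINT t|lborel. ?k t *\<^sub>R g t)"
    unfolding slice_law_def by (rule integral_density) (use k in auto)
  also have "\<dots> = (LINT t|lborel. ?k t *\<^sub>R g (- t))"
    using lborel_integral_real_affine[of "-1" "\<lambda>t. ?k t *\<^sub>R g t" 0] by simp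
  also have "\<dots> = (LINT t|slice_law n. g (- t))"
    unfolding slice_law_def by (rule integral_density[symmetric]) (use k in auto)
  finally show ?thesis by simp
qed

text \<open>Pair \<open>t\<close> with \<open>-t\<close>: the two signs cancel where
  \<open>c * |t|\<close> exceeds |a| and agree with the sign of \<open>a\<close> where it is
  smaller. At equality they agree for positive \<open>a\<close> only, as
  \<open>sign_pm 0 = 1\<close>, which is why \<open>S\<close> is known only up to its
  endpoints.\<close>

lemma slice_sign_eq:
  assumes n: "n \<ge> 1" and \<gamma>: "\<gamma> > 0" and c: "c > 0"
  defines "m \<equiv> \<lambda>a. min \<gamma> (\<bar>a\<bar> / c)"
  obtains S where "S \<in> sets borel" "{-m a<..<m a} \<subseteq> S" "S \<subseteq> {-m a..m a}"
    "slice_sign n \<gamma> c a = sgn a * measure (slice_law n) S"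
proof -
  interpret prob_space "slice_law n" by (rule prob_space_slice_law[OF n])
  define S where "S = (if a > 0 then {- m a..m a} else {-m a..m a} \<inter> {t. c * \<bar>t\<bar> < \<bar>a\<bar>})"
  have "{t. c * \<bar>t\<bar> < \<bar>a\<bar>} \<in> sets borel" by measurable
  then have S [measurable]: "S \<in> sets borel" unfolding S_def by auto
  let ?g = "\<lambda>t. indicator {-\<gamma>..\<gamma>} t * sign_pm (c * t + a) :: real"
  have g: "?g \<in> borel_measurable borel" "(\<lambda>t. ?g (-t)) \<in> borel_measurable borel" by measurable
  then have [measurable]: "?g \<in> borel_measurable (slice_law n)" "(\<lambda>t. ?g (-t)) \<in> borel_measurable (slice_law n)"
    by (simp_all cong: measurable_cong_sets add: sets_slice_law)
  have int: "integrable (slice_law n) ?g"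
    by (rule integrable_const_bound[of _ 1], simp add: indicator_def) measurable
  have int': "integrable (slice_law n) (\<lambda>t. ?g (-t))"
    by (rule integrable_const_bound[of _ 1], simp add: indicator_def) measurable
  \<comment> \<open>For \<open>a = 0\<close> the pairing fails at \<open>t = 0\<close>, where both
    signs are 1 by convention.\<close>
  have ae: "AE t in slice_law n. t \<noteq> 0"
    unfolding slice_law_def using AE_lborel_singleton[of 0] by (subst AE_density) auto
  have "2 * slice_sign n \<gamma> c a = (LINT t|slice_law n. ?g t) + (LINT t|slice_law n. ?g (- t))"
    by (subst integral_slice_law_minus) (auto simp: slice_sign_def)
  also have "\<dots> = (LINT t|slice_law n. ?g t + ?g (- t))"
    using int int' by simp
  also have "\<dots> = (LINT t|slice_law n. 2 * sgn a * indicator S t)"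
  proof (rule integral_cong_AE)
    show "AE t in slice_law n. ?g t + ?g (- t) = 2 * sgn a * indicator S t"
      using ae
    proof eventually_elim
      case (elim t)
      obtain y where y: "c * t = y" "c * \<bar>t\<bar> = \<bar>y\<bar>" "y \<noteq> 0"
        using elim c by (metis abs_mult abs_of_pos mult_eq_0_iff less_irrefl)
      have "t \<in> {-m a..m a} \<longleftrightarrow> t \<in> {-\<gamma>..\<gamma>} \<and> c * \<bar>t\<bar> \<le> \<bar>a\<bar>"
      proof -
        have "t \<in> {-m a..m a} \<longleftrightarrow> \<bar>t\<bar> \<le> m a" by auto
        also have "\<dots> \<longleftrightarrow> \<bar>t\<bar> \<le> \<gamma> \<and> c * \<bar>t\<bar> \<le> \<bar>a\<bar>"
          using c by (simp add: m_def pos_le_divide_eq mult.commute)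
        also have "\<dots> \<longleftrightarrow> t \<in> {-\<gamma>..\<gamma>} \<and> c * \<bar>t\<bar> \<le> \<bar>a\<bar>" by auto
        finally show ?thesis .
      qed
      then have "t \<in> S \<longleftrightarrow> t \<in> {-\<gamma>..\<gamma>} \<and> (if a > 0 then \<bar>y\<bar> \<le> \<bar>a\<bar> else \<bar>y\<bar> < \<bar>a\<bar>)"
        unfolding S_def using y by auto
      then show ?case
        using y(3) by (auto simp: sign_pm_def indicator_def sgn_if abs_if y(1) split: if_splits)
    qed
  qed measurable
  also have "\<dots> = 2 * sgn a * measure (slice_law n) S"
    by (simp add: emeasure_eq_measure)
  finally have "slice_sign n \<gamma> c a = sgn a * measure (slice_law n) S" by simp
  moreover have "S \<subseteq> {-m a..m a}" by (auto simp: S_def)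
  moreover have "{-m a<..<m a} \<subseteq> S"
  proof
    fix t assume "t \<in> {-m a<..<m a}"
    then have "\<bar>t\<bar> < m a" by auto
    then have "c * \<bar>t\<bar> < \<bar>a\<bar>" using c by (simp add: m_def pos_less_divide_eq mult.commute)
    then show "t \<in> S" using \<open>\<bar>t\<bar> < m a\<close> by (auto simp: S_def)
  qed
  ultimately show ?thesis using S that by blast
qed

text \<open>Were the density constant on the band, the value would be \<open>J\<close> times
  \<open>\<Lambda> * a\<close> clipped to the interval from -1 to 1. The density varies between
  \<open>k\<close> and 1 times its maximum, which costs \<open>(1 - k) / k\<close>. Beyond
  saturation \<open>\<Lambda> * |a|\<close> is at least one, so its square bounds the relative error
  of dropping the clipping.\<close>

lemma slice_sign_bounds:
  assumes n: "n \<ge> 1" and \<gamma>: "\<gamma> > 0" and c: "c > 0" 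
  defines "J \<equiv> measure (slice_law n) {-\<gamma>..\<gamma>}" and "\<Lambda> \<equiv> 1 / (\<gamma> * c)" and "k \<equiv> slice_density (Suc n) \<gamma>"
  shows "\<bar>slice_sign n \<gamma> c a\<bar> \<le> J * \<Lambda> / k * \<bar>a\<bar>"
    and "\<bar>slice_sign n \<gamma> c a - J * \<Lambda> * a\<bar> \<le> J * \<Lambda> * \<bar>a\<bar> * ((1 - k) / k + \<Lambda>\<^sup>2 * a\<^sup>2)"
proof -
  interpret prob_space "slice_law n" by (rule prob_space_slice_law[OF n])
  define m where "m = min \<gamma> (\<bar>a\<bar> / c)"
  obtain S where S: "S \<in> sets borel" "{-m<..<m} \<subseteq> S" "S \<subseteq> {-m..m}"
    "slice_sign n \<gamma> c a = sgn a * measure (slice_law n) S"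
    using slice_sign_eq[OF n \<gamma> c] unfolding m_def by blast
  define p where "p = measure (slice_law n) S"
  define C where "C = slice_const n"
  have C: "C > 0" unfolding C_def by (rule slice_const_pos[OF n])
  have k: "0 < k" "k \<le> 1" unfolding k_def by (rule slice_density_pos slice_density_le_1)+
  have m0: "0 \<le> m" "m \<le> \<gamma>" using \<gamma> c by (auto simp: m_def)
  have p: "2 * m * C * k \<le> p" "p \<le> 2 * m * C"
  proof -
    have "2 * m * C * k \<le> 2 * m * C * slice_density (Suc n) m"
      using m0 C unfolding k_def by (intro mult_left_mono slice_density_antimono) auto
    also have "\<dots> \<le> p" unfolding p_def C_def by (rule measure_slice_law_ge[OF n S(1,2) m0(1)])
    finally show "2 * m * C * k \<le> p" .
    show "p \<le> 2 * m * C" unfolding p_def C_def by (rule measure_slice_law_le[OF n S(3) m0(1)])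
  qed
  have J: "2 * \<gamma> * C * k \<le> J" "J \<le> 2 * \<gamma> * C"
    unfolding J_def C_def k_def using \<gamma>
    by (auto intro!: measure_slice_law_ge[OF n] measure_slice_law_le[OF n])
  have J0: "J > 0" using J(1) \<gamma> C k by (meson less_le_trans mult_pos_pos zero_less_numeral)
  have \<Lambda>: "\<Lambda> > 0" using \<gamma> c by (simp add: \<Lambda>_def)
  have H: "\<bar>slice_sign n \<gamma> c a\<bar> = p \<or> a = 0"
    unfolding S(4) by (auto simp: abs_mult p_def sgn_if)
  have lin: "2 * (\<bar>a\<bar> / c) * C * k \<le> J * \<Lambda> * \<bar>a\<bar>" "J * \<Lambda> * \<bar>a\<bar> \<le> 2 * (\<bar>a\<bar> / c) * C"
  proof -
    have "J * \<Lambda> * \<bar>a\<bar> = J * (\<bar>a\<bar> / c / \<gamma>)" by (simp add: \<Lambda>_def field_simps)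
    moreover have "2 * \<gamma> * C * k * (\<bar>a\<bar> / c / \<gamma>) \<le> J * (\<bar>a\<bar> / c / \<gamma>)" "J * (\<bar>a\<bar> / c / \<gamma>) \<le> 2 * \<gamma> * C * (\<bar>a\<bar> / c / \<gamma>)"
      using J \<gamma> c by (intro mult_right_mono; simp)+
    moreover have "2 * \<gamma> * C * (\<bar>a\<bar> / c / \<gamma>) = 2 * (\<bar>a\<bar> / c) * C" using \<gamma> by simp
    moreover have "2 * \<gamma> * C * k * (\<bar>a\<bar> / c / \<gamma>) = 2 * (\<bar>a\<bar> / c) * C * k" using \<gamma> by simp
    ultimately show "2 * (\<bar>a\<bar> / c) * C * k \<le> J * \<Lambda> * \<bar>a\<bar>" "J * \<Lambda> * \<bar>a\<bar> \<le> 2 * (\<bar>a\<bar> / c) * C" by simp_all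
  qed
  have mle: "m \<le> \<bar>a\<bar> / c" by (simp add: m_def)
  show "\<bar>slice_sign n \<gamma> c a\<bar> \<le> J * \<Lambda> / k * \<bar>a\<bar>"
  proof (cases "a = 0")
    case True
    then show ?thesis using S(4) by simp
  next
    case False
    have "p * k \<le> 2 * (\<bar>a\<bar> / c) * C * k"
      using p(2) mle C k by (intro mult_right_mono order_trans[OF p(2)]) auto
    also have "\<dots> \<le> J * \<Lambda> * \<bar>a\<bar>" by (rule lin)
    finally have "p \<le> J * \<Lambda> * \<bar>a\<bar> / k" using k by (simp add: pos_le_divide_eq)
    then show ?thesis using H False by simp
  qed
  show "\<bar>slice_sign n \<gamma> c a - J * \<Lambda> * a\<bar> \<le> J * \<Lambda> * \<bar>a\<bar> * ((1 - k) / k + \<Lambda>\<^sup>2 * a\<^sup>2)"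
  proof (cases "a = 0")
    case True
    then show ?thesis using S(4) by simp
  next
    case False
    define q where "q = J * \<Lambda> * \<bar>a\<bar>"
    have q0: "q \<ge> 0" using J0 \<Lambda> by (simp add: q_def)
    have "slice_sign n \<gamma> c a - J * \<Lambda> * a = sgn a * (p - q)"
      unfolding S(4) p_def[symmetric] q_def by (simp add: algebra_simps abs_sgn)
    then have eq: "\<bar>slice_sign n \<gamma> c a - J * \<Lambda> * a\<bar> = \<bar>p - q\<bar>"
      using False by (simp add: abs_mult sgn_if)
    show ?thesis
    proof (cases "\<bar>a\<bar> / c \<le> \<gamma>")
      case True
      then have m: "m = \<bar>a\<bar> / c" by (simp add: m_def)
      have "\<bar>p - q\<bar> \<le> 2 * m * C * (1 - k)"
      proof -
        have "2 * m * C * (1 - k) = 2 * m * C - 2 * m * C * k" by (simp add: algebra_simps)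
        then show ?thesis using p lin[folded q_def m] by linarith
      qed
      also have "\<dots> = (2 * m * C * k) * ((1 - k) / k)" using k by simp
      also have "\<dots> \<le> q * ((1 - k) / k)"
        using lin(1) k unfolding q_def m by (intro mult_right_mono) auto
      also have "\<dots> \<le> q * ((1 - k) / k + \<Lambda>\<^sup>2 * a\<^sup>2)"
        using q0 by (intro mult_left_mono) auto
      finally show ?thesis unfolding eq q_def .
    next
      case False
      then have m: "m = \<gamma>" by (simp add: m_def)
      have L1: "1 \<le> \<Lambda> * \<bar>a\<bar>" using False \<gamma> c by (simp add: \<Lambda>_def field_simps)
      have Jq: "J \<le> q" unfolding q_def using mult_left_mono[OF L1, of J] J0 by (simp add: mult.assoc)
      have "\<bar>p - q\<bar> \<le> \<bar>p - J\<bar> + (q - J)" using Jq by linarith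
      also have "\<bar>p - J\<bar> \<le> 2 * \<gamma> * C * (1 - k)"
        using p J unfolding m by (auto simp: abs_le_iff algebra_simps)
      also have "2 * \<gamma> * C * (1 - k) = (2 * \<gamma> * C * k) * ((1 - k) / k)" using k by simp
      also have "(2 * \<gamma> * C * k) * ((1 - k) / k) \<le> q * ((1 - k) / k)"
        using J(1) Jq k by (intro mult_right_mono) auto
      also have "q - J \<le> q * (\<Lambda>\<^sup>2 * a\<^sup>2)"
      proof -
        have "1 \<le> (\<Lambda> * \<bar>a\<bar>)\<^sup>2" using L1 by (rule one_le_power)
        then have "q * 1 \<le> q * (\<Lambda>\<^sup>2 * a\<^sup>2)" using q0 by (intro mult_left_mono) (auto simp: power_mult_distrib)
        then show ?thesis using J0 by simp
      qed
      finally have "\<bar>p - q\<bar> \<le> q * ((1 - k) / k) + q * (\<Lambda>\<^sup>2 * a\<^sup>2)" by simp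
      then show ?thesis unfolding eq q_def[symmetric] by (simp add: distrib_left)
    qed
  qed
qed

lemma measurable_slice_sign [measurable]:
  assumes n: "n \<ge> 1" shows "slice_sign n \<gamma> c \<in> borel_measurable borel"
proof -
  interpret prob_space "slice_law n" by (rule prob_space_slice_law[OF n])
  have "(\<lambda>(a, t). indicator {-\<gamma>..\<gamma>} t * sign_pm (c * t + a)) \<in> borel_measurable (borel \<Otimes>\<^sub>M (borel :: real measure))"
    by measurable
  then have "(\<lambda>(a, t). indicator {-\<gamma>..\<gamma>} t * sign_pm (c * t + a)) \<in> borel_measurable (borel \<Otimes>\<^sub>M slice_law n)"
    by (subst measurable_cong_sets[OF sets_pair_measure_cong[OF refl sets_slice_law] refl])
  from borel_measurable_lebesgue_integral[OF this] show ?thesis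
    by (simp add: slice_sign_def[abs_def])
qed

lemma abs_slice_sign_le:
  assumes n: "n \<ge> 1" shows "\<bar>slice_sign n \<gamma> c a\<bar> \<le> 1"
proof -
  interpret prob_space "slice_law n" by (rule prob_space_slice_law[OF n])
  have "\<bar>slice_sign n \<gamma> c a\<bar> \<le> (LINT t|slice_law n. \<bar>indicator {-\<gamma>..\<gamma>} t * sign_pm (c * t + a)\<bar>)"
    unfolding slice_sign_def by (rule integral_abs_bound)
  also have "\<dots> \<le> (LINT t|slice_law n. 1)"
    by (rule integral_mono') (auto simp: indicator_def)
  finally show ?thesis using prob_space by simp
qed

section \<open>Correlations inside the band\<close>

text \<open>First the clipping of the coordinate is removed, then the averaged label is replaced by
  its linear approximation, whose correlation is a second moment. The three terms of the error come
  from clipping, from the variation of the density on the band, and from saturation, which costs a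
  fourth moment.\<close>

lemma (in rotation_invariant) band_correlation:
  assumes n: "n \<ge> 1" and K: "K > 0" and g: "g > 0" and c: "c > 0" and a: "norm_dim n a \<le> 1"
  defines "\<gamma> \<equiv> g / sqrt n"
  defines "J \<equiv> measure (slice_law n) {-\<gamma>..\<gamma>}" and "k \<equiv> slice_density (Suc n) \<gamma>"
  shows "\<bar>(LINT h|M. slice_sign n \<gamma> c (dot n v h) * clip K (sqrt n * dot n a h)) - J / (g * c) * dot n a v\<bar>
    \<le> J / (g * c) * \<bar>dot n a v\<bar> * (6 / (K\<^sup>2 * k) + (1 - k) / k + 3 * (norm_dim n v / (g * c))\<^sup>2)"
proof (cases "norm_dim n v = 0")
  case True
  then have "dot n v h = 0" "dot n h v = 0" for h
    by (auto simp: norm_dim_zero_iff dot_def)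
  moreover have "slice_sign n \<gamma> c 0 = 0"
    using slice_sign_bounds(1)[OF n _ c, of \<gamma> 0] g n by (simp add: \<gamma>_def)
  ultimately show ?thesis by simp
next
  case False
  let ?H = "slice_sign n \<gamma> c" and ?X = "dot n v"
  define \<Lambda> where "\<Lambda> = 1 / (\<gamma> * c)"
  define \<alpha> where "\<alpha> = dot n a v / dot n v v"
  define s where "s = norm_dim n v"
  define \<eta> where "\<eta> = (1 - k) / k"
  have \<gamma>: "\<gamma> > 0" using g n by (simp add: \<gamma>_def)
  have k: "0 < k" "k \<le> 1" unfolding k_def by (rule slice_density_pos slice_density_le_1)+
  have J: "J \<ge> 0" by (simp add: J_def)
  have \<Lambda>: "\<Lambda> > 0" using \<gamma> c by (simp add: \<Lambda>_def)
  have \<Lambda>n: "\<Lambda> / sqrt n = 1 / (g * c)" using n g c by (simp add: \<Lambda>_def \<gamma>_def)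
  have \<alpha>s: "\<alpha> * s\<^sup>2 = dot n a v"
    using False by (simp add: \<alpha>_def s_def norm_dim_square norm_dim_eq)
  note bounds = slice_sign_bounds[OF n \<gamma> c, folded J_def \<Lambda>_def k_def]
  note [measurable] = measurable_slice_sign[OF n]
  have 1: "\<bar>(LINT h|M. ?H (?X h) * clip K (sqrt n * dot n a h)) - sqrt n * \<alpha> * (LINT h|M. ?H (?X h) * ?X h)\<bar>
    \<le> 6 / K\<^sup>2 * (J * \<Lambda> / k / sqrt n) * \<bar>dot n a v\<bar>"
    unfolding \<alpha>_def
    by (rule clip_correlation_linear_bound[OF K False n _ abs_slice_sign_le[OF n] bounds(1) a]) measurable
  have intHX: "integrable M (\<lambda>h. ?H (?X h) * ?X h)"
  proof (rule integrable_bounded[of _ "norm_dim n v"])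
    show "AE h in M. \<bar>?H (?X h) * ?X h\<bar> \<le> norm_dim n v"
      using AE_dot_le[of v]
    proof eventually_elim
      case (elim h)
      have "\<bar>?H (?X h)\<bar> * \<bar>?X h\<bar> \<le> 1 * \<bar>?X h\<bar>"
        by (intro mult_right_mono abs_slice_sign_le[OF n]) auto
      then show ?case using elim by (simp add: abs_mult)
    qed
  qed measurable
  have "\<bar>(LINT h|M. ?H (?X h) * ?X h) - J * \<Lambda> * (LINT h|M. ?X h ^ 2)\<bar> = 
      \<bar>(LINT h|M. ?H (?X h) * ?X h - J * \<Lambda> * ?X h ^ 2)\<bar>"
    using intHX by simp
  also have "\<dots> \<le> (LINT h|M. \<bar>?H (?X h) * ?X h - J * \<Lambda> * ?X h ^ 2\<bar>)"
    by (rule integral_abs_bound)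
  also have "\<dots> \<le> (LINT h|M. J * \<Lambda> * (\<eta> * ?X h ^ 2 + \<Lambda>\<^sup>2 * ?X h ^ 4))"
  proof (rule integral_mono)
    fix h
    have "\<bar>?H (?X h) * ?X h - J * \<Lambda> * ?X h ^ 2\<bar> = \<bar>?H (?X h) - J * \<Lambda> * ?X h\<bar> * \<bar>?X h\<bar>"
      unfolding abs_mult[symmetric] by (simp add: algebra_simps power2_eq_square)
    also have "\<dots> \<le> (J * \<Lambda> * \<bar>?X h\<bar> * (\<eta> + \<Lambda>\<^sup>2 * (?X h)\<^sup>2)) * \<bar>?X h\<bar>"
      using bounds(2)[of "?X h"] by (intro mult_right_mono) (auto simp: \<eta>_def)
    also have "\<dots> = J * \<Lambda> * (\<eta> + \<Lambda>\<^sup>2 * (?X h)\<^sup>2) * (\<bar>?X h\<bar> * \<bar>?X h\<bar>)" by (simp only: mult_ac)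
    also have "\<dots> = J * \<Lambda> * (\<eta> * ?X h ^ 2 + \<Lambda>\<^sup>2 * ?X h ^ 4)"
      by (simp add: algebra_simps power2_eq_square power4_eq_xxxx)
    finally show "\<bar>?H (?X h) * ?X h - J * \<Lambda> * ?X h ^ 2\<bar> \<le> J * \<Lambda> * (\<eta> * ?X h ^ 2 + \<Lambda>\<^sup>2 * ?X h ^ 4)" .
  qed (use intHX in auto)
  also have "\<dots> = J * \<Lambda> * (\<eta> * (LINT h|M. ?X h ^ 2) + \<Lambda>\<^sup>2 * (LINT h|M. ?X h ^ 4))"
    by simp
  also have "\<dots> \<le> J * \<Lambda> * (\<eta> * (s\<^sup>2 / n) + \<Lambda>\<^sup>2 * (s ^ 4 * (3 / n\<^sup>2)))"
    unfolding second_moment[OF n] s_def using fourth_moment[OF n, of v] J \<Lambda>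
    by (intro mult_left_mono add_left_mono) auto
  also have "\<dots> = J * \<Lambda> * s\<^sup>2 / n * (\<eta> + 3 * (\<Lambda> / sqrt n * s)\<^sup>2)"
    using n by (simp add: field_simps power2_eq_square power4_eq_xxxx)
  finally have "\<bar>(LINT h|M. ?H (?X h) * ?X h) - J * \<Lambda> * (s\<^sup>2 / n)\<bar> \<le> J * \<Lambda> * s\<^sup>2 / n * (\<eta> + 3 * (\<Lambda> / sqrt n * s)\<^sup>2)"
    unfolding second_moment[OF n] s_def .
  then have "\<bar>sqrt n * \<alpha>\<bar> * \<bar>(LINT h|M. ?H (?X h) * ?X h) - J * \<Lambda> * (s\<^sup>2 / n)\<bar> \<le> 
     \<bar>sqrt n * \<alpha>\<bar> * (J * \<Lambda> * s\<^sup>2 / n * (\<eta> + 3 * (\<Lambda> / sqrt n * s)\<^sup>2))"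
    by (rule mult_left_mono) simp
  also have "\<dots> = J * (\<Lambda> / sqrt n) * (\<bar>\<alpha>\<bar> * s\<^sup>2) * (\<eta> + 3 * (\<Lambda> / sqrt n * s)\<^sup>2)"
  proof -
    have "sqrt n / n = 1 / sqrt n" using n by (simp add: field_simps)
    moreover have "\<bar>sqrt n * \<alpha>\<bar> * (J * \<Lambda> * s\<^sup>2 / n * (\<eta> + 3 * (\<Lambda> / sqrt n * s)\<^sup>2)) = 
      (sqrt n / n) * (J * \<Lambda> * (\<bar>\<alpha>\<bar> * s\<^sup>2) * (\<eta> + 3 * (\<Lambda> / sqrt n * s)\<^sup>2))"
      by (simp add: abs_mult)
    ultimately show ?thesis by simp
  qed
  also have "\<bar>\<alpha>\<bar> * s\<^sup>2 = \<bar>dot n a v\<bar>"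
    unfolding \<alpha>s[symmetric] by (simp add: abs_mult)
  also have "\<bar>sqrt n * \<alpha>\<bar> * \<bar>(LINT h|M. ?H (?X h) * ?X h) - J * \<Lambda> * (s\<^sup>2 / n)\<bar> =
     \<bar>sqrt n * \<alpha> * (LINT h|M. ?H (?X h) * ?X h) - J * (\<Lambda> / sqrt n) * dot n a v\<bar>"
  proof -
    have "sqrt n / n = 1 / sqrt n" using n by (simp add: field_simps)
    then have "sqrt n * \<alpha> * (J * \<Lambda> * (s\<^sup>2 / n)) = J * (\<Lambda> * (1 / sqrt n)) * (\<alpha> * s\<^sup>2)"
      by (metis (no_types, lifting) mult.assoc mult.commute times_divide_eq_right)
    then show ?thesis unfolding abs_mult[symmetric] right_diff_distrib \<alpha>s by simp
  qed
  finally have 2: "\<bar>sqrt n * \<alpha> * (LINT h|M. ?H (?X h) * ?X h) - J / (g * c) * dot n a v\<bar>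
    \<le> J / (g * c) * \<bar>dot n a v\<bar> * (\<eta> + 3 * (s / (g * c))\<^sup>2)"
    unfolding \<Lambda>n by simp
  have "6 / K\<^sup>2 * (J * \<Lambda> / k / sqrt n) * \<bar>dot n a v\<bar> = J * (\<Lambda> / sqrt n) * \<bar>dot n a v\<bar> * (6 / (K\<^sup>2 * k))"
    by (simp add: mult_ac)
  with 1 have "\<bar>(LINT h|M. ?H (?X h) * clip K (sqrt n * dot n a h)) - sqrt n * \<alpha> * (LINT h|M. ?H (?X h) * ?X h)\<bar>
    \<le> J / (g * c) * \<bar>dot n a v\<bar> * (6 / (K\<^sup>2 * k))"
    unfolding \<Lambda>n by simp
  with 2 have "\<bar>(LINT h|M. ?H (?X h) * clip K (sqrt n * dot n a h)) - J / (g * c) * dot n a v\<bar>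
    \<le> J / (g * c) * \<bar>dot n a v\<bar> * (6 / (K\<^sup>2 * k)) + J / (g * c) * \<bar>dot n a v\<bar> * (\<eta> + 3 * (s / (g * c))\<^sup>2)"
    by linarith
  then show ?thesis unfolding \<eta>_def s_def by (simp only: distrib_left add.assoc)
qed

section \<open>From the sphere law to the uniform distribution and its filtered versions\<close>

lemma space_sphere_law [simp]: "space (sphere_law d) = space (lborel_dim d)"
  by (simp add: sphere_law_def)

lemma sets_sphere_law [measurable_cong]: "sets (sphere_law d) = sets (lborel_dim d)"
  by (simp add: sphere_law_def)

lemma unit_sphere_subset: "unit_sphere d \<subseteq> space (lborel_dim d)"
  by (auto simp: unit_sphere_def)

lemma space_uniform_sphere: "space (uniform_sphere d) = unit_sphere d"
  using unit_sphere_subset by (auto simp: uniform_sphere_eq space_restrict_space)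

lemma measurable_uniform_sphere: "f \<in> measurable (lborel_dim d) N \<Longrightarrow> f \<in> measurable (uniform_sphere d) N"
  unfolding uniform_sphere_eq by (rule measurable_restrict_space1) (simp cong: measurable_cong_sets add: sets_sphere_law)

lemma AE_unit_sphere: "d \<ge> 1 \<Longrightarrow> AE x in sphere_law d. x \<in> unit_sphere d"
  using rotation_invariant.AE_norm[OF rotation_invariant_sphere_law, of d] AE_space[of "sphere_law d"]
  by (auto simp: unit_sphere_def)

lemma integral_uniform_sphere:
  fixes F :: "(nat \<Rightarrow> real) \<Rightarrow> real"
  assumes d: "d \<ge> 1" and [measurable]: "F \<in> borel_measurable (lborel_dim d)"
  shows "(LINT x|uniform_sphere d. F x) = (LINT x|sphere_law d. F x)"
proof -
  have "(LINT x|uniform_sphere d. F x) = (LINT x|sphere_law d. indicator (unit_sphere d) x *\<^sub>R F x)"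
    unfolding uniform_sphere_eq by (subst integral_restrict_space) (auto simp: set_lebesgue_integral_def)
  also have "\<dots> = (LINT x|sphere_law d. F x)"
    by (rule integral_cong_AE, measurable) (use AE_unit_sphere[OF d] in auto)
  finally show ?thesis .
qed

lemma measure_uniform_sphere:
  assumes "A \<subseteq> unit_sphere d"
  shows "measure (uniform_sphere d) A = measure (sphere_law d) A"
  unfolding uniform_sphere_eq using assms by (intro measure_restrict_space) auto

text \<open>For a filter of mass zero both sides are 0, by the value of division by zero.\<close>

lemma integral_filtered:
  assumes chi: "chi \<in> borel_measurable D" "\<And>x. x \<in> space D \<Longrightarrow> chi x \<ge> 0" and F: "F \<in> borel_measurable D"
  shows "(LINT x|filtered D chi. F x) = (LINT x|D. chi x * F x) / (LINT x|D. chi x)"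
proof -
  have "(LINT x|D. chi x) \<ge> 0" using chi by (intro integral_nonneg_AE AE_I2) auto
  then have "(LINT x|filtered D chi. F x) = (LINT x|D. (chi x / (LINT x|D. chi x)) *\<^sub>R F x)"
    unfolding filtered_def using chi F by (intro integral_density) (auto intro!: AE_I2 divide_nonneg_nonneg)
  also have "\<dots> = (LINT x|D. chi x * F x) / (LINT x|D. chi x)"
    by (simp flip: integral_divide_zero)
  finally show ?thesis .
qed

lemma integral_sphere_law_slices:
  assumes n: "n \<ge> 1" and R: "R \<in> measurable (lborel_dim (Suc n)) (lborel_dim (Suc n))"
    and eq: "sphere_law (Suc n) = distr (slice_law n \<Otimes>\<^sub>M equator_law n) (lborel_dim (Suc n)) (\<lambda>(t, h). R (tilt n t h))"
    and G: "G \<in> borel_measurable (lborel_dim (Suc n))" and B: "\<And>x. \<bar>G x\<bar> \<le> (B :: real)"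
  shows "(LINT x|sphere_law (Suc n). G x) = (LINT h|equator_law n. LINT t|slice_law n. G (R (tilt n t h)))"
proof -
  interpret E: rotation_invariant "equator_law n" n by (rule rotation_invariant_equator_law[OF n])
  interpret S: prob_space "slice_law n" by (rule prob_space_slice_law[OF n])
  interpret P: pair_prob_space "slice_law n" "equator_law n" ..
  have sets: "sets (slice_law n \<Otimes>\<^sub>M equator_law n) = sets (borel \<Otimes>\<^sub>M lborel_dim n)"
    by (intro sets_pair_measure_cong E.sets_eq sets_slice_law)
  have "(\<lambda>(t, h). R (tilt n t h)) \<in> measurable (borel \<Otimes>\<^sub>M lborel_dim n) (lborel_dim (Suc n))"
    using measurable_compose[OF measurable_tilt R] by (simp add: case_prod_beta')
  then have t: "(\<lambda>(t, h). R (tilt n t h)) \<in> measurable (slice_law n \<Otimes>\<^sub>M equator_law n) (lborel_dim (Suc n))"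
    by (subst measurable_cong_sets[OF sets refl])
  have "(LINT x|sphere_law (Suc n). G x) = (LINT z|(slice_law n \<Otimes>\<^sub>M equator_law n). G ((\<lambda>(t, h). R (tilt n t h)) z))"
    unfolding eq by (rule integral_distr[OF t G])
  also have "\<dots> = (LINT z|(slice_law n \<Otimes>\<^sub>M equator_law n). case_prod (\<lambda>t h. G (R (tilt n t h))) z)"
    by (simp add: case_prod_beta')
  also have "\<dots> = (LINT h|equator_law n. LINT t|slice_law n. G (R (tilt n t h)))"
  proof (rule P.integral_snd[symmetric])
    show "integrable (slice_law n \<Otimes>\<^sub>M equator_law n) (\<lambda>(t, h). G (R (tilt n t h)))"
      using measurable_compose[OF t G] B
      by (intro P.integrable_const_bound[of _ B]) (auto simp: case_prod_beta')
  qed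
  finally show ?thesis .
qed

section \<open>Filter and query functions of a round and their expectations\<close>

text \<open>With \<open>p = dot d w x\<close> the slope satisfies
  \<open>t^2 = p^2 / (1 - p^2)\<close>; the condition \<open>|t| <= g / sqrt n\<close> is written
  without the division. \<open>Suc (d - 2)\<close> is \<open>d - 1\<close> for \<open>d >= 2\<close>
  and stays positive for \<open>d = 1\<close>. For \<open>w = 0\<close> nothing is filtered
  out.\<close>

definition band :: "nat \<Rightarrow> real \<Rightarrow> (nat \<Rightarrow> real) \<Rightarrow> (nat \<Rightarrow> real) \<Rightarrow> real" where
  "band d g w x = (if g\<^sup>2 * (1 - (dot d w x)\<^sup>2) < (dot d w x)\<^sup>2 * real (Suc (d - 2)) then 0 else 1)"

text \<open>For unit vectors \<open>sqrt (1 - p^2)\<close> is the length of the projection of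
  \<open>x\<close> orthogonal to \<open>w\<close>, so the argument of \<open>clip\<close> is a
  coordinate of the equatorial point, scaled to constant size. Dividing by \<open>K\<close> brings
  the value into the range of a query function.\<close>

definition probe :: "nat \<Rightarrow> real \<Rightarrow> (nat \<Rightarrow> real) \<Rightarrow> nat \<Rightarrow> (nat \<Rightarrow> real) \<Rightarrow> real" where
  "probe d K w i x =
     clip K (sqrt (real (Suc (d - 2))) * (x i - dot d w x * w i) / sqrt (1 - (dot d w x)\<^sup>2)) / K"

lemma measurable_band [measurable]: "band d g w \<in> borel_measurable (lborel_dim d)"
  unfolding band_def[abs_def] by measurable

lemma measurable_probe: "i < d \<Longrightarrow> probe d K w i \<in> borel_measurable (lborel_dim d)"
  using measurable_component_lborel_dim[of i d] unfolding probe_def[abs_def] by measurable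

lemma measurable_halfspace [measurable]: "halfspace d v \<in> borel_measurable (lborel_dim d)"
  unfolding halfspace_def[abs_def] dot_def[symmetric] by measurable

lemma halfspace_eq: "halfspace d v x = sign_pm (dot d v x)"
  by (simp add: halfspace_def dot_def)

lemma abs_probe_le: "K > 0 \<Longrightarrow> \<bar>probe d K w i x\<bar> \<le> 1"
  using abs_clip_le[of K] by (simp add: probe_def divide_le_eq_1)

lemma band_bounds: "0 \<le> band d g w x" "band d g w x \<le> 1"
  by (simp_all add: band_def)

lemma sign_pm_divide: "r > 0 \<Longrightarrow> sign_pm (x / r) = sign_pm x"
  by (simp add: sign_pm_def zero_le_divide_iff)

lemma unit_sphere_iff: "x \<in> unit_sphere d \<longleftrightarrow> x \<in> extensional {..<d} \<and> dot d x x = 1"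
  by (simp add: unit_sphere_def space_lborel_dim norm_dim_eq_1_iff)

lemma (in rotation_invariant) square_expectation_abs_dot_le:
  assumes n: "n \<ge> 1"
  shows "(LINT h|M. \<bar>dot n v h\<bar>)\<^sup>2 \<le> (norm_dim n v)\<^sup>2 / n"
proof -
  define m where "m = (LINT h|M. \<bar>dot n v h\<bar>)"
  have "0 \<le> (LINT h|M. (\<bar>dot n v h\<bar> - m)\<^sup>2)"
    by (rule Bochner_Integration.integral_nonneg) simp
  also have "\<dots> = (LINT h|M. (dot n v h)\<^sup>2 - 2 * m * \<bar>dot n v h\<bar> + m\<^sup>2)"
    by (rule Bochner_Integration.integral_cong) (auto simp: power2_diff)
  also have "\<dots> = (norm_dim n v)\<^sup>2 / n - 2 * m * m + m\<^sup>2"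
    using integrable_polynomial(1)[of v 2] integrable_polynomial(3)[of v]
    by (simp add: second_moment[OF n] prob_space m_def)
  finally show ?thesis unfolding m_def[symmetric] by (simp add: power2_eq_square)
qed

text \<open>In coordinates adapted to \<open>w\<close> the filter depends on \<open>t\<close> only
  and the probe on \<open>h\<close> only, while the label is the sign of
  \<open>co * t + dot n v' h\<close>. Integrating out \<open>t\<close> leaves the integral of
  \<open>band_correlation\<close>. Here \<open>v'\<close> is the equatorial part of the target; its
  length is the sine of the angle.\<close>

lemma refined_round:
  assumes n: "n \<ge> 1" and v: "v \<in> unit_sphere (Suc n)" and w: "w \<in> unit_sphere (Suc n)" and i: "i < Suc n"
    and K: "K \<ge> 100" and g: "0 < g" "g \<le> 1 / 20" and c: "dot (Suc n) w v \<ge> 9 / 10"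
    and s: "1 - (dot (Suc n) w v)\<^sup>2 \<le> (g / 100)\<^sup>2"
  defines "D \<equiv> uniform_sphere (Suc n)" and "chi \<equiv> band (Suc n) g w"
    and "F \<equiv> (\<lambda>x. halfspace (Suc n) v x * probe (Suc n) K w i x)"
  shows "(LINT x|D. chi x) \<ge> g / 10"
    and "\<bar>g * K * (LINT x|filtered D chi. F x) - (v i / dot (Suc n) w v - w i)\<bar> \<le> 1 / 100 * \<bar>v i / dot (Suc n) w v - w i\<bar>"
proof -
  interpret E: rotation_invariant "equator_law n" n by (rule rotation_invariant_equator_law[OF n])
  interpret S: prob_space "slice_law n" by (rule prob_space_slice_law[OF n])
  let ?d = "Suc n"
  define co where "co = dot ?d w v"
  define \<gamma> where "\<gamma> = g / sqrt n"
  define J where "J = measure (slice_law n) {-\<gamma>..\<gamma>}"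
  define k where "k = slice_density ?d \<gamma>"
  have co: "co \<ge> 9 / 10" using c by (simp add: co_def)
  have ww: "dot ?d w w = 1" and vv: "dot ?d v v = 1" and w': "norm_dim ?d w = 1" "w \<in> extensional {..<?d}"
    using v w by (simp_all add: unit_sphere_iff norm_dim_eq_1_iff)
  obtain R where R: "R \<in> measurable (lborel_dim ?d) (lborel_dim ?d)"
    "sphere_law ?d = distr (slice_law n \<Otimes>\<^sub>M equator_law n) (lborel_dim ?d) (\<lambda>(t, h). R (tilt n t h))"
    and dR: "\<And>b t h. dot ?d b (R (tilt n t h)) = (dot n (R b) h + dot ?d w b * t) / sqrt (1 + t\<^sup>2)"
    and RR: "\<And>a b. dot n (R a) (R b) = dot ?d a b - dot ?d w a * dot ?d w b"
    using sphere_law_slices[OF n w'] by blast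
  define a where "a = R (unit_vec i)"
  define v' where "v' = R v"
  \<comment> \<open>\<open>R\<close> takes \<open>w\<close> to the last basis vector, so its first
    \<open>n\<close> coordinates vanish.\<close>
  have "dot n (R w) (R w) = 0" using RR[of w w] ww by simp
  then have "norm_dim n (R w) = 0" by (simp add: norm_dim_eq)
  then have Rw: "dot n (R w) h = 0" for h by (auto simp: norm_dim_zero_iff dot_def)
  have wi: "dot ?d w (unit_vec i) = w i"
    using dot_unit_vec[OF i, of w] by (simp add: dot_commute)
  have av: "dot n a v' = v i - w i * co"
    unfolding a_def v'_def RR wi dot_unit_vec[OF i] co_def ..
  have na: "norm_dim n a \<le> 1"
    using RR[of "unit_vec i" "unit_vec i"] norm_unit_vec[OF i] unfolding norm_dim_eq a_def wi
    by (simp add: norm_dim_eq_1_iff power2_eq_square[symmetric])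
  have nv': "(norm_dim n v')\<^sup>2 = 1 - co\<^sup>2"
    unfolding norm_dim_square v'_def RR vv co_def by (simp add: power2_eq_square)
  have Spos: "sqrt (1 + t\<^sup>2) > 0" for t :: real by (simp add: add_pos_nonneg)
  have wt: "dot ?d w (R (tilt n t h)) = t / sqrt (1 + t\<^sup>2)" for t h
    unfolding dR Rw ww by simp
  have one: "1 - (t / sqrt (1 + t\<^sup>2))\<^sup>2 = 1 / (1 + t\<^sup>2)" for t :: real
  proof -
    have "1 + t\<^sup>2 > 0" by (simp add: add_pos_nonneg)
    then show ?thesis by (simp add: power_divide field_simps)
  qed
  have nn: "real (Suc (?d - 2)) = n" using n by simp
  have chi: "chi (R (tilt n t h)) = indicator {-\<gamma>..\<gamma>} t" for t h
  proof -
    have pos: "1 + t\<^sup>2 > 0" by (simp add: add_pos_nonneg)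
    have "g\<^sup>2 * (1 / (1 + t\<^sup>2)) < (t / sqrt (1 + t\<^sup>2))\<^sup>2 * n \<longleftrightarrow> g\<^sup>2 / (1 + t\<^sup>2) < t\<^sup>2 * n / (1 + t\<^sup>2)"
      using pos by (simp add: power_divide)
    also have "\<dots> \<longleftrightarrow> g\<^sup>2 < t\<^sup>2 * n"
      using pos by (simp add: divide_less_cancel)
    also have "\<dots> \<longleftrightarrow> \<gamma>\<^sup>2 < t\<^sup>2"
      using n by (simp add: \<gamma>_def power_divide divide_less_eq)
    also have "\<dots> \<longleftrightarrow> \<bar>\<gamma>\<bar> < \<bar>t\<bar>" by (metis abs_le_square_iff not_le)
    also have "\<dots> \<longleftrightarrow> t \<notin> {-\<gamma>..\<gamma>}" using g by (auto simp: \<gamma>_def)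
    finally show ?thesis
      unfolding chi_def band_def wt one nn by (auto simp: indicator_def)
  qed
  have hv: "halfspace ?d v (R (tilt n t h)) = sign_pm (co * t + dot n v' h)" for t h
    unfolding halfspace_eq dR v'_def co_def sign_pm_divide[OF Spos] by (simp add: add.commute)
  have pr: "probe ?d K w i (R (tilt n t h)) = clip K (sqrt n * dot n a h) / K" for t h
  proof -
    have "R (tilt n t h) i = (dot n a h + w i * t) / sqrt (1 + t\<^sup>2)"
      using dR[of "unit_vec i" t h] unfolding dot_unit_vec[OF i] wi a_def .
    then have "R (tilt n t h) i - t / sqrt (1 + t\<^sup>2) * w i = dot n a h / sqrt (1 + t\<^sup>2)"
      by (simp add: add_divide_distrib)
    then have "sqrt n * (R (tilt n t h) i - t / sqrt (1 + t\<^sup>2) * w i) / sqrt (1 / (1 + t\<^sup>2)) = sqrt n * dot n a h"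
      using Spos[of t] by (simp add: real_sqrt_divide)
    then show ?thesis unfolding probe_def wt one nn by simp
  qed
  have meas: "probe ?d K w i \<in> borel_measurable (lborel_dim ?d)" by (rule measurable_probe[OF i])
  have F: "F \<in> borel_measurable (lborel_dim ?d)" unfolding F_def using meas by measurable
  have Fb: "\<bar>F x\<bar> \<le> 1" for x
    unfolding F_def abs_mult halfspace_eq using abs_probe_le[of K] K by simp
  have chi_m [measurable]: "chi \<in> borel_measurable (lborel_dim ?d)" unfolding chi_def by measurable
  have chi_b: "0 \<le> chi x" "\<bar>chi x\<bar> \<le> 1" for x unfolding chi_def using band_bounds[of ?d g w x] by auto
  have "(LINT x|D. chi x) = (LINT x|sphere_law ?d. chi x)"
    unfolding D_def by (rule integral_uniform_sphere) auto
  also have "\<dots> = (LINT h|equator_law n. LINT t|slice_law n. chi (R (tilt n t h)))"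
    by (rule integral_sphere_law_slices[OF n R chi_m chi_b(2)])
  also have "\<dots> = J"
    unfolding chi by (simp add: J_def E.prob_space)
  finally have chiJ: "(LINT x|D. chi x) = J" .
  have "(LINT x|D. chi x * F x) = (LINT x|sphere_law ?d. chi x * F x)"
    unfolding D_def by (rule integral_uniform_sphere) (use F in auto)
  also have "\<dots> = (LINT h|equator_law n. LINT t|slice_law n. chi (R (tilt n t h)) * F (R (tilt n t h)))"
  proof (rule integral_sphere_law_slices[OF n R, of _ 1])
    show "\<bar>chi x * F x\<bar> \<le> 1" for x
      unfolding abs_mult using mult_mono[OF chi_b(2) Fb, of x x] by simp
  qed (use F in auto)
  also have "\<dots> = (LINT h|equator_law n. slice_sign n \<gamma> co (dot n v' h) * clip K (sqrt n * dot n a h) / K)"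
    unfolding chi F_def hv pr slice_sign_def
    by (intro Bochner_Integration.integral_cong refl) (simp flip: mult.assoc)
  also have "\<dots> = (LINT h|equator_law n. slice_sign n \<gamma> co (dot n v' h) * clip K (sqrt n * dot n a h)) / K"
    by simp
  finally have FJ: "(LINT x|D. chi x * F x) = (LINT h|equator_law n. slice_sign n \<gamma> co (dot n v' h) * clip K (sqrt n * dot n a h)) / K"
    (is "_ = ?I / K") .
  have filt: "(LINT x|filtered D chi. F x) = ?I / K / J"
  proof -
    have "chi \<in> borel_measurable D" "F \<in> borel_measurable D"
      unfolding D_def using F by (auto intro: measurable_uniform_sphere)
    then have "(LINT x|filtered D chi. F x) = (LINT x|D. chi x * F x) / (LINT x|D. chi x)"
      by (intro integral_filtered chi_b)
    then show ?thesis by (simp only: FJ chiJ)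
  qed
  have n1: "real n \<ge> 1" using n by simp
  have \<gamma>2: "\<gamma>\<^sup>2 = g\<^sup>2 / n" by (simp add: \<gamma>_def power_divide)
  have g2: "g\<^sup>2 \<le> 1 / 400" using power_mono[OF g(2), of 2] g by (simp add: power_divide)
  \<comment> \<open>The density has exponent \<open>Suc n\<close> but the band width is scaled by
    \<open>n\<close>; \<open>Suc n <= 2 * n\<close> absorbs the difference.\<close>
  have kge: "k \<ge> 399 / 400"
  proof -
    have "\<gamma>\<^sup>2 \<le> g\<^sup>2 / 1" unfolding \<gamma>2 using n1 by (intro divide_left_mono) auto
    then have "\<gamma>\<^sup>2 \<le> 1" using g2 by simp
    then have "1 - ?d * \<gamma>\<^sup>2 / 2 \<le> k" unfolding k_def by (rule slice_density_ge)
    moreover have "?d * \<gamma>\<^sup>2 / 2 \<le> g\<^sup>2"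
      unfolding \<gamma>2 using n1 mult_right_mono[of "real ?d" "2 * n" "g\<^sup>2"] by (simp add: field_simps)
    ultimately show ?thesis using g2 by simp
  qed
  have k1: "k \<le> 1" unfolding k_def by (rule slice_density_le_1)
  have \<gamma>0: "\<gamma> > 0" using g n by (simp add: \<gamma>_def)
  have "J \<ge> 2 * \<gamma> * slice_const n * k"
    unfolding J_def k_def by (rule measure_slice_law_ge[OF n]) (use \<gamma>0 in auto)
  moreover have "2 * \<gamma> * slice_const n * k \<ge> 2 * \<gamma> * (sqrt ?d / 10) * (399 / 400)"
    using slice_const_ge[OF n] kge \<gamma>0 by (intro mult_mono) auto
  moreover have "\<gamma> * sqrt ?d \<ge> g"
  proof -
    have "sqrt n \<le> sqrt ?d" by simp
    then have "g * sqrt n \<le> g * sqrt ?d" using g by (intro mult_left_mono) auto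
    then show ?thesis using n by (simp add: \<gamma>_def pos_le_divide_eq)
  qed
  ultimately have Jg: "J \<ge> g / 10" using g by simp
  then show "(LINT x|D. chi x) \<ge> g / 10" unfolding chiJ .
  have J0: "J > 0" using Jg g by simp
  define \<xi> where "\<xi> = 6 / (K\<^sup>2 * k) + (1 - k) / k + 3 * (norm_dim n v' / (g * co))\<^sup>2"
  \<comment> \<open>The budget is about 0.0006 for clipping, 0.0025 for the density and 0.0004 for
    saturation.\<close>
  have "\<xi> \<le> 1 / 100"
  proof -
    have "K\<^sup>2 \<ge> 100\<^sup>2" by (rule power_mono[OF K]) simp
    then have "K\<^sup>2 * k \<ge> 10000 * (399 / 400)" using kge by (intro mult_mono) auto
    then have "6 / (K\<^sup>2 * k) \<le> 6 / (10000 * (399 / 400))" by (intro divide_left_mono) auto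
    moreover have "(1 - k) / k \<le> (1 / 400) / (399 / 400)" using kge k1 by (intro frac_le) auto
    moreover have "(norm_dim n v' / (g * co))\<^sup>2 \<le> 1 / 8100"
    proof -
      have "norm_dim n v' \<le> g / 100"
        by (rule power2_le_imp_le) (use nv' s g in \<open>auto simp: co_def\<close>)
      also have "\<dots> \<le> (g * co) / 90" using co g mult_left_mono[OF co, of g] by simp
      finally have "norm_dim n v' / (g * co) \<le> 1 / 90" using co g by (simp add: field_simps)
      then have "(norm_dim n v' / (g * co))\<^sup>2 \<le> (1 / 90)\<^sup>2" using co g by (intro power_mono) auto
      then show ?thesis by (simp add: power_divide)
    qed
    ultimately have "\<xi> \<le> 6 / (10000 * (399 / 400)) + (1 / 400) / (399 / 400) + 3 * (1 / 8100)"
      unfolding \<xi>_def by (intro add_mono mult_left_mono) auto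
    then show ?thesis by simp
  qed
  have "\<bar>?I - J / (g * co) * dot n a v'\<bar> \<le> J / (g * co) * \<bar>dot n a v'\<bar> * \<xi>"
    unfolding \<xi>_def J_def k_def \<gamma>_def
    by (rule E.band_correlation[OF n _ g(1) _ na]) (use K co in auto)
  also have "\<dots> \<le> J / (g * co) * \<bar>dot n a v'\<bar> * (1 / 100)"
    using \<open>\<xi> \<le> 1 / 100\<close> J0 g co by (intro mult_left_mono) auto
  finally have "\<bar>?I - J / (g * co) * dot n a v'\<bar> \<le> J / (g * co) * \<bar>dot n a v'\<bar> * (1 / 100)" .
  \<comment> \<open>The filtered answer is \<open>?I / K / J\<close>; multiplying by
    \<open>g / J\<close> turns \<open>?I\<close> into \<open>g * K\<close> times the answer, and the
    unknown band mass cancels.\<close>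
  then have "g / J * \<bar>?I - J / (g * co) * dot n a v'\<bar> \<le> g / J * (J / (g * co) * \<bar>dot n a v'\<bar> * (1 / 100))"
    using g J0 by (intro mult_left_mono) auto
  also have "g / J * \<bar>?I - J / (g * co) * dot n a v'\<bar> = \<bar>g / J * (?I - J / (g * co) * dot n a v')\<bar>"
    using g J0 by (simp add: abs_mult)
  also have "g / J * (?I - J / (g * co) * dot n a v') = g * K * (?I / K / J) - dot n a v' / co"
    using g J0 co K by (simp add: field_simps)
  also have "g / J * (J / (g * co) * \<bar>dot n a v'\<bar> * (1 / 100)) = 1 / 100 * \<bar>dot n a v' / co\<bar>"
    using g J0 co by (simp add: field_simps)
  also have "dot n a v' / co = v i / co - w i" unfolding av using co by (simp add: field_simps)
  finally show "\<bar>g * K * (LINT x|filtered D chi. F x) - (v i / dot ?d w v - w i)\<bar> \<le> 1 / 100 * \<bar>v i / dot ?d w v - w i\<bar>"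
    unfolding filt co_def .
qed

text \<open>With \<open>w = 0\<close> the probe is the clipped coordinate itself, and
  \<open>sign_correlation\<close> applies on the whole sphere. The factor \<open>\<kappa>\<close> is
  the same for all coordinates; only its lower bound matters, to keep the tolerance small relative
  to it.\<close>

lemma first_round:
  assumes d: "d \<ge> 1" and v: "v \<in> unit_sphere d" and w: "\<And>j. j < d \<Longrightarrow> w j = 0" and K: "K \<ge> 100"
  defines "D \<equiv> uniform_sphere d"
  shows "\<exists>\<kappa>\<ge>1 / 4. \<forall>i<d. \<forall>g. \<bar>K * (LINT x|filtered D (band d g w). halfspace d v x * probe d K w i x) - \<kappa> * v i\<bar> \<le> 16 / K\<^sup>2 * \<kappa> * \<bar>v i\<bar>"
    and "(LINT x|D. band d g w x) = 1"
proof -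
  interpret S: rotation_invariant "sphere_law d" d by (rule rotation_invariant_sphere_law[OF d])
  define \<sigma> where "\<sigma> = sqrt (Suc (d - 2))"
  have w0: "dot d w x = 0" for x using w by (simp add: dot_def)
  have band: "band d g w x = 1" for g x by (simp add: band_def w0 not_less)
  have v1: "norm_dim d v = 1" using v by (simp add: unit_sphere_iff norm_dim_eq_1_iff)
  have \<sigma>: "0 \<le> \<sigma>" "\<sigma> \<le> sqrt d" using d by (auto simp: \<sigma>_def)
  \<comment> \<open>The scaling is shared with the later rounds, where the equator has one dimension
    less; it falls short of \<open>sqrt d\<close> by at most a factor two.\<close>
  have \<sigma>d: "\<sigma> / sqrt d \<ge> 1 / 2"
  proof -
    have "sqrt d \<le> sqrt (4 * real (Suc (d - 2)))" using d by (intro real_sqrt_le_mono) simp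
    also have "\<dots> = 2 * \<sigma>" unfolding \<sigma>_def real_sqrt_mult by simp
    finally have "sqrt d \<le> 2 * \<sigma>" .
    then show ?thesis using d by (simp add: field_simps)
  qed
  define \<kappa> where "\<kappa> = \<sigma> * (LINT x|sphere_law d. \<bar>dot d v x\<bar>)"
  have "\<sigma> * (9 / 16 / sqrt d) \<le> \<kappa>"
    unfolding \<kappa>_def using S.expectation_abs_dot[OF v1 d] \<sigma> by (intro mult_left_mono)
  then have \<kappa>: "9 / 16 * (\<sigma> / sqrt d) \<le> \<kappa>" by simp
  have b1: "(LINT x|D. band d g w x) = 1" for g
    unfolding D_def band using integral_uniform_sphere[OF d, of "\<lambda>_. 1"] S.prob_space by simp
  have "\<bar>K * (LINT x|filtered D (band d g w). halfspace d v x * probe d K w i x) - \<kappa> * v i\<bar> \<le> 16 / K\<^sup>2 * \<kappa> * \<bar>v i\<bar>"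
    if i: "i < d" for i g
  proof -
    have m: "(\<lambda>x. halfspace d v x * probe d K w i x) \<in> borel_measurable (lborel_dim d)"
      using measurable_probe[OF i] by measurable
    have m1: "band d g w \<in> borel_measurable (uniform_sphere d)" "(\<lambda>x. halfspace d v x * probe d K w i x) \<in> borel_measurable (uniform_sphere d)"
      using m by (auto intro!: measurable_uniform_sphere)
    have "(LINT x|filtered D (band d g w). halfspace d v x * probe d K w i x) = (LINT x|D. band d g w x * (halfspace d v x * probe d K w i x)) / 1"
      using integral_filtered[of "band d g w" D, OF _ _ m1(2)[folded D_def]] m1 band_bounds b1 by (simp add: D_def)
    also have "\<dots> = (LINT x|sphere_law d. halfspace d v x * probe d K w i x)"
      unfolding band D_def using integral_uniform_sphere[OF d m] by simp
    also have "\<dots> = (LINT x|sphere_law d. sign_pm (dot d v x) * clip K (\<sigma> * dot d (unit_vec i) x) / K)"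
      unfolding probe_def w0 halfspace_eq dot_unit_vec[OF i] \<sigma>_def by simp
    finally have "K * (LINT x|filtered D (band d g w). halfspace d v x * probe d K w i x) = 
      (LINT x|sphere_law d. sign_pm (dot d v x) * clip K (\<sigma> * dot d (unit_vec i) x))"
      using K by simp
    moreover have "\<bar>(LINT x|sphere_law d. sign_pm (dot d v x) * clip K (\<sigma> * dot d (unit_vec i) x)) - \<kappa> * dot d (unit_vec i) v\<bar>
      \<le> 4 / K\<^sup>2 * (\<sigma> / sqrt d) * \<bar>dot d (unit_vec i) v\<bar>"
      unfolding \<kappa>_def by (rule S.sign_correlation[OF _ v1 d \<sigma> norm_unit_vec[OF i]]) (use K in simp)
    moreover have "4 / K\<^sup>2 * (\<sigma> / sqrt d) \<le> 16 / K\<^sup>2 * \<kappa>"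
    proof -
      have "4 / K\<^sup>2 * (\<sigma> / sqrt d) \<le> 4 / K\<^sup>2 * (4 * \<kappa>)"
        using \<kappa> \<sigma>d by (intro mult_left_mono) auto
      then show ?thesis by simp
    qed
    then have "4 / K\<^sup>2 * (\<sigma> / sqrt d) * \<bar>v i\<bar> \<le> 16 / K\<^sup>2 * \<kappa> * \<bar>v i\<bar>" by (rule mult_right_mono) simp
    ultimately show ?thesis unfolding dot_unit_vec[OF i] by linarith
  qed
  moreover have "\<kappa> \<ge> 1 / 4" using \<kappa> \<sigma>d by linarith
  ultimately show "\<exists>\<kappa>\<ge>1 / 4. \<forall>i<d. \<forall>g. \<bar>K * (LINT x|filtered D (band d g w). halfspace d v x * probe d K w i x) - \<kappa> * v i\<bar> \<le> 16 / K\<^sup>2 * \<kappa> * \<bar>v i\<bar>"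
    by blast
  show "(LINT x|D. band d g w x) = 1" by (rule b1)
qed

text \<open>Over an equatorial point \<open>h\<close> the labels can differ only for slopes up to
  \<open>|dot n v' h| / co\<close>. Such slopes have mass proportional to this bound, with a
  constant of order \<open>sqrt n\<close>, and the mean of \<open>|dot n v' h|\<close> is at most
  \<open>s / sqrt n\<close>.\<close>

lemma halfspace_disagreement:
  assumes n: "n \<ge> 1" and v: "v \<in> unit_sphere (Suc n)" and w: "w \<in> unit_sphere (Suc n)"
    and c: "dot (Suc n) w v \<ge> 9 / 10"
  defines "s \<equiv> sqrt (1 - (dot (Suc n) w v)\<^sup>2)"
  shows "measure (uniform_sphere (Suc n)) {x \<in> unit_sphere (Suc n). halfspace (Suc n) w x \<noteq> halfspace (Suc n) v x} \<le> 4 * s"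
proof -
  interpret E: rotation_invariant "equator_law n" n by (rule rotation_invariant_equator_law[OF n])
  interpret S: prob_space "slice_law n" by (rule prob_space_slice_law[OF n])
  let ?d = "Suc n"
  interpret L: rotation_invariant "sphere_law ?d" ?d by (rule rotation_invariant_sphere_law) simp
  define co where "co = dot ?d w v"
  have co: "co \<ge> 9 / 10" using c by (simp add: co_def)
  have ww: "dot ?d w w = 1" and vv: "dot ?d v v = 1" and w': "norm_dim ?d w = 1" "w \<in> extensional {..<?d}"
    using v w by (simp_all add: unit_sphere_iff norm_dim_eq_1_iff)
  obtain R where R: "R \<in> measurable (lborel_dim ?d) (lborel_dim ?d)"
    "sphere_law ?d = distr (slice_law n \<Otimes>\<^sub>M equator_law n) (lborel_dim ?d) (\<lambda>(t, h). R (tilt n t h))"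
    and dR: "\<And>b t h. dot ?d b (R (tilt n t h)) = (dot n (R b) h + dot ?d w b * t) / sqrt (1 + t\<^sup>2)"
    and RR: "\<And>a b. dot n (R a) (R b) = dot ?d a b - dot ?d w a * dot ?d w b"
    using sphere_law_slices[OF n w'] by blast
  define v' where "v' = R v"
  have "dot n (R w) (R w) = 0" using RR[of w w] ww by simp
  then have "norm_dim n (R w) = 0" by (simp add: norm_dim_eq)
  then have Rw: "dot n (R w) h = 0" for h by (auto simp: norm_dim_zero_iff dot_def)
  have nv': "norm_dim n v' = s"
    using RR[of v v] vv by (simp add: norm_dim_eq v'_def s_def power2_eq_square)
  have s0: "s \<ge> 0" unfolding nv'[symmetric] by simp
  have Spos: "sqrt (1 + t\<^sup>2) > 0" for t :: real by (simp add: add_pos_nonneg)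
  define G :: "(nat \<Rightarrow> real) \<Rightarrow> real" where "G x = (if halfspace ?d w x \<noteq> halfspace ?d v x then 1 else 0)" for x
  have "G = (\<lambda>x. \<bar>halfspace ?d w x - halfspace ?d v x\<bar> / 2)"
    by (auto simp: G_def fun_eq_iff halfspace_eq sign_pm_def)
  then have Gm: "G \<in> borel_measurable (lborel_dim ?d)"
    using measurable_halfspace[of ?d v] measurable_halfspace[of ?d w] by simp
  have Gt: "G (R (tilt n t h)) \<le> indicator {- (\<bar>dot n v' h\<bar> / co)..\<bar>dot n v' h\<bar> / co} t" for t h
  proof (cases "\<bar>t\<bar> \<le> \<bar>dot n v' h\<bar> / co")
    case True
    then show ?thesis by (auto simp: G_def indicator_def)
  next
    case False
    then have "\<bar>dot n v' h\<bar> < co * \<bar>t\<bar>" using co by (simp add: field_simps)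
    then have "sign_pm (dot n v' h + co * t) = sign_pm t"
      using co zero_le_mult_iff[of co t] by (cases "t \<ge> 0") (auto simp: sign_pm_def)
    then have "G (R (tilt n t h)) = 0"
      unfolding G_def halfspace_eq dR Rw ww sign_pm_divide[OF Spos] v'_def co_def by simp
    then show ?thesis by simp
  qed
  have Gb: "\<bar>G x\<bar> \<le> 1" for x by (simp add: G_def)
  have "measure (uniform_sphere ?d) {x \<in> unit_sphere ?d. halfspace ?d w x \<noteq> halfspace ?d v x} = 
      measure (sphere_law ?d) {x \<in> unit_sphere ?d. halfspace ?d w x \<noteq> halfspace ?d v x}"
    by (rule measure_uniform_sphere) auto
  also have "\<dots> \<le> measure (sphere_law ?d) {x \<in> space (sphere_law ?d). halfspace ?d w x \<noteq> halfspace ?d v x}"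
  proof (rule L.finite_measure_mono)
    have "{x \<in> space (lborel_dim ?d). halfspace ?d w x \<noteq> halfspace ?d v x} \<in> sets (lborel_dim ?d)"
      by (rule borel_measurable_neq[OF measurable_halfspace measurable_halfspace])
    then show "{x \<in> space (sphere_law ?d). halfspace ?d w x \<noteq> halfspace ?d v x} \<in> sets (sphere_law ?d)"
      by (simp add: L.sets_eq)
  qed (use unit_sphere_subset[of ?d] in auto)
  also have "\<dots> = (LINT x|sphere_law ?d. G x)"
  proof -
    have "(LINT x|sphere_law ?d. G x) = (LINT x|sphere_law ?d. indicator {x \<in> space (sphere_law ?d). halfspace ?d w x \<noteq> halfspace ?d v x} x)"
      by (rule Bochner_Integration.integral_cong) (auto simp: G_def indicator_def)
    also have "\<dots> = measure (sphere_law ?d) ({x \<in> space (sphere_law ?d). halfspace ?d w x \<noteq> halfspace ?d v x} \<inter> space (sphere_law ?d))"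
      by (rule Bochner_Integration.integral_indicator)
    finally show ?thesis by (simp add: Int_absorb2 Collect_conj_eq)
  qed
  also have "\<dots> = (LINT h|equator_law n. LINT t|slice_law n. G (R (tilt n t h)))"
    by (rule integral_sphere_law_slices[OF n R Gm Gb])
  also have "\<dots> \<le> (LINT h|equator_law n. 2 * (\<bar>dot n v' h\<bar> / co) * slice_const n)"
  proof (rule integral_mono')
    show "integrable (equator_law n) (\<lambda>h. 2 * (\<bar>dot n v' h\<bar> / co) * slice_const n)"
      using E.integrable_polynomial(3)[of v'] by auto
    fix h
    have "(LINT t|slice_law n. G (R (tilt n t h))) \<le> (LINT t|slice_law n. indicator {- (\<bar>dot n v' h\<bar> / co)..\<bar>dot n v' h\<bar> / co} t)"
      using Gt by (intro integral_mono') (auto simp: sets_slice_law S.emeasure_eq_measure)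
    also have "\<dots> = measure (slice_law n) {- (\<bar>dot n v' h\<bar> / co)..\<bar>dot n v' h\<bar> / co}" by simp
    also have "\<dots> \<le> 2 * (\<bar>dot n v' h\<bar> / co) * slice_const n"
      by (rule measure_slice_law_le[OF n]) (use co in auto)
    finally show "(LINT t|slice_law n. G (R (tilt n t h))) \<le> 2 * (\<bar>dot n v' h\<bar> / co) * slice_const n" .
    show "0 \<le> 2 * (\<bar>dot n v' h\<bar> / co) * slice_const n" using co by simp
  qed
  also have "\<dots> = 2 * slice_const n / co * (LINT h|equator_law n. \<bar>dot n v' h\<bar>)"
    by simp
  also have "\<dots> \<le> 2 * sqrt ?d / co * (s / sqrt n)"
  proof -
    have "(LINT h|equator_law n. \<bar>dot n v' h\<bar>)\<^sup>2 \<le> (s / sqrt n)\<^sup>2"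
      using E.square_expectation_abs_dot_le[OF n, of v'] n by (simp add: nv' power_divide)
    then have "(LINT h|equator_law n. \<bar>dot n v' h\<bar>) \<le> s / sqrt n"
      by (rule power2_le_imp_le) (use s0 in simp)
    then show ?thesis using slice_const_le[OF n] co s0
      by (intro mult_mono divide_right_mono) (auto intro!: Bochner_Integration.integral_nonneg)
  qed
  \<comment> \<open>Uses \<open>sqrt ((n + 1) / n) <= sqrt 2 <= 3 / 2\<close> and
    \<open>co >= 9 / 10\<close>.\<close>
  also have "\<dots> \<le> 4 * s"
  proof -
    have "sqrt ?d \<le> sqrt 2 * sqrt n" using n by (simp flip: real_sqrt_mult)
    moreover have "sqrt 2 \<le> 3 / 2" by (rule real_le_lsqrt) (auto simp: power2_eq_square)
    ultimately have "sqrt ?d \<le> 3 / 2 * sqrt n"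
      using mult_right_mono[of "sqrt 2" "3 / 2" "sqrt n"] by simp
    then have "2 * sqrt ?d * s \<le> 3 * sqrt n * s" using s0 by (intro mult_right_mono) auto
    also have "\<dots> \<le> 4 * s * co * sqrt n"
      using mult_right_mono[of 3 "4 * co" "s * sqrt n"] co s0 by (simp add: mult_ac)
    finally show ?thesis using co n by (simp add: field_simps)
  qed
  finally show ?thesis .
qed

section \<open>Reasoning about real RAM programs\<close>

text \<open>Total correctness with a step bound. Since the conclusion contains a halting run, it
  also shows that every query posed was well formed.\<close>

definition runs :: "('q \<Rightarrow> state \<Rightarrow> real \<Rightarrow> bool) \<Rightarrow> 'q com \<Rightarrow> state \<Rightarrow> nat \<Rightarrow> (state \<Rightarrow> bool) \<Rightarrow> bool" where
  "runs ans c s T Q \<longleftrightarrow> (\<exists>t s'. exec ans c s t s' \<and> t \<le> T \<and> Q s')"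

lemma runs_weaken: "runs ans c s T Q \<Longrightarrow> T \<le> T' \<Longrightarrow> (\<And>s'. Q s' \<Longrightarrow> Q' s') \<Longrightarrow> runs ans c s T' Q'"
  unfolding runs_def by (meson le_trans)

lemma runs_Skip: "Q s \<Longrightarrow> runs ans Skip s 1 Q"
  unfolding runs_def by (blast intro: exec.Skip)

lemma runs_ISet: "Q (s\<lparr>ivar := (ivar s)(i := ieval a s)\<rparr>) \<Longrightarrow> runs ans (ISet i a) s 1 Q"
  unfolding runs_def by (blast intro: exec.ISet)

lemma runs_RSet: "Q (s\<lparr>rvar := (rvar s)(i := reval a s)\<rparr>) \<Longrightarrow> runs ans (RSet i a) s 1 Q"
  unfolding runs_def by (blast intro: exec.RSet)

lemma runs_Store: "Q (s\<lparr>mem := (mem s)(ieval a s := reval b s)\<rparr>) \<Longrightarrow> runs ans (Store a b) s 1 Q"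
  unfolding runs_def by (blast intro: exec.Store)

lemma runs_Ask:
  "ans q s \<mu> \<Longrightarrow> Q (s\<lparr>rvar := (rvar s)(i := \<mu>), asked := Suc (asked s)\<rparr>) \<Longrightarrow> runs ans (Ask i q) s 1 Q"
  unfolding runs_def by (blast intro: exec.Ask)

lemma runs_Seq:
  "runs ans c1 s T1 Q1 \<Longrightarrow> (\<And>s'. Q1 s' \<Longrightarrow> runs ans c2 s' T2 Q) \<Longrightarrow> runs ans (Seq c1 c2) s (T1 + T2) Q"
  unfolding runs_def by (meson add_mono exec.Seq)

lemma runs_If:
  assumes "beval b s \<Longrightarrow> runs ans c1 s T Q" "\<not> beval b s \<Longrightarrow> runs ans c2 s T Q"
  shows "runs ans (If b c1 c2) s (T + 1) Q"
  using assms unfolding runs_def by (cases "beval b s") (meson add_right_mono exec.IfTrue exec.IfFalse)+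

text \<open>Indexing the invariant by the number of iterations done fixes their total as
  \<open>N\<close>, so no separate termination measure appears. The final 1 is the failing
  test.\<close>

lemma runs_While:
  assumes body: "\<And>i s. i < N \<Longrightarrow> I i s \<Longrightarrow> beval b s \<and> runs ans c s T (I (Suc i))"
    and exit: "\<And>s. I N s \<Longrightarrow> \<not> beval b s" and init: "I 0 s"
  shows "runs ans (While b c) s (N * (T + 1) + 1) (I N)"
proof -
  have "runs ans (While b c) s (k * (T + 1) + 1) (I N)" if "I (N - k) s" "k \<le> N" for k s
    using that
  proof (induction k arbitrary: s)
    case 0
    then show ?case using exit[of s] unfolding runs_def by (auto intro!: exI[of _ 1] exI[of _ s] exec.WhileFalse)
  next
    case (Suc k)
    then have "N - Suc k < N" and *: "Suc (N - Suc k) = N - k" by auto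
    from body[OF this(1) Suc.prems(1)] have b: "beval b s" and "runs ans c s T (I (N - k))"
      by (simp_all add: *)
    then obtain t1 s1 where 1: "exec ans c s t1 s1" "t1 \<le> T" "I (N - k) s1"
      unfolding runs_def by blast
    from Suc.IH[OF this(3)] Suc.prems obtain t2 s2 where 2: "exec ans (While b c) s1 t2 s2" "t2 \<le> k * (T + 1) + 1" "I N s2"
      unfolding runs_def by auto
    have "exec ans (While b c) s (t1 + t2 + 1) s2" by (rule exec.WhileTrue[OF b 1(1) 2(1)])
    moreover have "t1 + t2 + 1 \<le> Suc k * (T + 1) + 1" using 1 2 by simp
    ultimately show ?case using 2(3) unfolding runs_def by blast
  qed
  from this[of N] init show ?thesis by simp
qed

fun seq :: "'q com list \<Rightarrow> 'q com" where
  "seq [] = Skip"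
| "seq [c] = c"
| "seq (c # d # cs) = Seq c (seq (d # cs))"

definition for_loop :: "nat \<Rightarrow> 'q com \<Rightarrow> 'q com" where
  "for_loop i c = Seq (ISet i (INum 0)) (While (ILess (IVar i) (IVar 0)) (Seq c (ISet i (IAdd (IVar i) (INum 1)))))"

text \<open>\<open>P (Suc j)\<close> is required of the state after the counter has been
  incremented, so that \<open>P\<close> may mention all natural variables.\<close>

lemma runs_for_loop:
  assumes body: "\<And>j s. j < ivar s 0 \<Longrightarrow> ivar s 0 = n \<Longrightarrow> ivar s i = j \<Longrightarrow> P j s \<Longrightarrow>
      runs ans c s T (\<lambda>s'. ivar s' 0 = n \<and> ivar s' i = j \<and> P (Suc j) (s'\<lparr>ivar := (ivar s')(i := Suc j)\<rparr>))"
    and init: "P 0 (s\<lparr>ivar := (ivar s)(i := 0)\<rparr>)" "ivar s 0 = n" and i: "i \<noteq> 0"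
  shows "runs ans (for_loop i c) s (n * (T + 2) + 2) (\<lambda>s'. ivar s' 0 = n \<and> P n s')"
proof -
  let ?I = "\<lambda>j s. ivar s 0 = n \<and> ivar s i = j \<and> P j s"
  have "runs ans (While (ILess (IVar i) (IVar 0)) (Seq c (ISet i (IAdd (IVar i) (INum 1))))) s'
      (n * ((T + 1) + 1) + 1) (?I n)" if "?I 0 s'" for s'
  proof (rule runs_While[where I="?I"])
    fix j s assume j: "j < n" and I: "?I j s"
    then have "runs ans c s T (\<lambda>s'. ivar s' 0 = n \<and> ivar s' i = j \<and> P (Suc j) (s'\<lparr>ivar := (ivar s')(i := Suc j)\<rparr>))"
      by (intro body) auto
    then have "runs ans (Seq c (ISet i (IAdd (IVar i) (INum 1)))) s (T + 1) (?I (Suc j))"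
      by (rule runs_Seq) (rule runs_ISet, use i in auto)
    then show "beval (ILess (IVar i) (IVar 0)) s \<and>
        runs ans (Seq c (ISet i (IAdd (IVar i) (INum 1)))) s (T + 1) (?I (Suc j))"
      using I j by simp
  qed (use that in auto)
  then have "runs ans (for_loop i c) s (1 + (n * ((T + 1) + 1) + 1)) (?I n)"
    unfolding for_loop_def by (intro runs_Seq[OF runs_ISet[where Q="?I 0"]]) (use init i in auto)
  then show ?thesis by (rule runs_weaken) auto
qed

lemma runs_mono: "runs ans c s T Q \<Longrightarrow> T \<le> T' \<Longrightarrow> runs ans c s T' Q"
  by (rule runs_weaken)

lemma runs_Seq_ISet:
  "runs ans c (s\<lparr>ivar := (ivar s)(i := ieval a s)\<rparr>) T Q \<Longrightarrow> runs ans (Seq (ISet i a) c) s (1 + T) Q"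
  by (rule runs_Seq[OF runs_ISet]) auto

lemma runs_Seq_RSet:
  "runs ans c (s\<lparr>rvar := (rvar s)(i := reval a s)\<rparr>) T Q \<Longrightarrow> runs ans (Seq (RSet i a) c) s (1 + T) Q"
  by (rule runs_Seq[OF runs_RSet]) auto

lemma runs_Seq_Store:
  "runs ans c (s\<lparr>mem := (mem s)(ieval a s := reval b s)\<rparr>) T Q \<Longrightarrow> runs ans (Seq (Store a b) c) s (1 + T) Q"
  by (rule runs_Seq[OF runs_Store]) auto

section \<open>The learner\<close>

text \<open>Natural variable 0 holds \<open>d\<close>, variable 1 the current coordinate and variable 2 the number
  \<open>max 1 (d - 1)\<close>; real variable 1 holds the accuracy \<open>e\<close>, which is halved in every round. The
  hypothesis \<open>w\<close> is in the memory cells below \<open>d\<close> and the answers of a round in the next \<open>d\<close> cells.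
  Initially \<open>w = 0\<close>, so that the band of the first round is the whole sphere.\<close>

definition dot_prog :: "'q com" where
  "dot_prog = Seq (RSet 5 (RNum 0))
     (for_loop 3 (RSet 5 (RAdd (RVar 5) (RMul (Mem (IVar 3)) (Point (IVar 3))))))"

text \<open>The band parameter is \<open>g = e / 10\<close>: small enough for a nearly constant
  density on the band, and large against the distance \<open>e / 10 ^ 4\<close> to the
  target.\<close>

definition filter_prog :: func where
  "filter_prog = Seq dot_prog
     (If (RLess
           (RMul (RMul (RDiv (RVar 1) (RNum 10)) (RDiv (RVar 1) (RNum 10))) (RSub (RNum 1) (RMul (RVar 5) (RVar 5))))
           (RMul (RMul (RVar 5) (RVar 5)) (OfNat (IVar 2))))
       (RSet 0 (RNum 0)) (RSet 0 (RNum 1)))"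

text \<open>\<open>dot_prog\<close> counts with variable 3, which keeps the coordinate of the
  current query intact in variable 1. The clipping level is \<open>K = 1000\<close>.\<close>

definition probe_prog :: func where
  "probe_prog = seq [dot_prog,
     RSet 6 (RDiv (RMul (RSqrt (OfNat (IVar 2))) (RSub (Point (IVar 1)) (RMul (RVar 5) (Mem (IVar 1)))))
                  (RSqrt (RSub (RNum 1) (RMul (RVar 5) (RVar 5))))),
     If (RLess (RNum 1000) (RVar 6)) (RSet 6 (RNum 1000)) Skip,
     If (RLess (RVar 6) (RNum (- 1000))) (RSet 6 (RNum (- 1000))) Skip,
     RSet 0 (RMul Label (RDiv (RVar 6) (RNum 1000)))]"

definition hypothesis_prog :: func where
  "hypothesis_prog = Seq dot_prog (If (RLess (RVar 5) (RNum 0)) (RSet 0 (RNum (- 1))) (RSet 0 (RNum 1)))"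

text \<open>All answers of a round refer to the same \<open>w\<close>, so they are stored separately
  until the last one has arrived. The factor \<open>100 * e\<close> is \<open>g * K\<close> for
  \<open>g = e / 10\<close> and \<open>K = 1000\<close>. In the first round, where
  \<open>w = 0\<close>, the normalisation makes its value irrelevant.\<close>

definition round_prog :: "(func \<times> func) com" where
  "round_prog = seq
    [for_loop 1 (Seq (Ask 2 (filter_prog, probe_prog)) (Store (IAdd (IVar 0) (IVar 1)) (RVar 2))),
     RSet 3 (RNum 0),
     for_loop 1 (Seq
       (Store (IVar 1) (RAdd (Mem (IVar 1)) (RMul (RMul (RNum 100) (RVar 1)) (Mem (IAdd (IVar 0) (IVar 1))))))
       (RSet 3 (RAdd (RVar 3) (RMul (Mem (IVar 1)) (Mem (IVar 1)))))),
     for_loop 1 (Store (IVar 1) (RDiv (Mem (IVar 1)) (RSqrt (RVar 3)))),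
     RSet 1 (RDiv (RVar 1) (RNum 2))]"

text \<open>In dimension one the first round already recovers the target, while every later band would be a
  null set and its answers arbitrary.\<close>

definition guard :: bexp where
  "guard = Conj (Neg (RLess (RVar 1) (RMul (RNum 2) (RVar 0))))
     (Neg (Conj (ILess (IVar 0) (INum 2)) (RLess (RVar 1) (RNum 1))))"

definition learner :: "(func \<times> func) com" where
  "learner = seq [ISet 2 (IAdd (INum 1) (ISub (IVar 0) (INum 2))), RSet 1 (RNum 1), While guard round_prog]"

section \<open>Correctness and running time of the programs\<close>

lemma runs_dot_prog:
  assumes d: "ivar s 0 = d"
  shows "runs ans dot_prog s (3 * d + 3) (\<lambda>s'. rvar s' 5 = dot d (mem s) (point s) \<and> mem s' = mem s \<and>
    point s' = point s \<and> label s' = label s \<and> (\<forall>i\<le>2. ivar s' i = ivar s i) \<and> rvar s' 1 = rvar s 1)"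
proof -
  let ?P = "\<lambda>j s'. rvar s' 5 = dot j (mem s) (point s) \<and> mem s' = mem s \<and>
    point s' = point s \<and> label s' = label s \<and> (\<forall>i\<le>2. ivar s' i = ivar s i) \<and> rvar s' 1 = rvar s 1"
  have "runs ans dot_prog s (1 + (d * (1 + 2) + 2)) (\<lambda>s'. ivar s' 0 = d \<and> ?P d s')"
    unfolding dot_prog_def
    apply (rule runs_Seq_RSet)
    apply (rule runs_for_loop)
       apply (rule runs_RSet)
       apply (auto simp: d dot_def)
    done
  then show ?thesis by (rule runs_weaken) auto
qed

lemma runs_filter_prog:
  assumes d: "ivar s 0 = d" "ivar s 2 = Suc (d - 2)"
  shows "runs ans filter_prog s (3 * d + 20) (\<lambda>s'. rvar s' 0 = band d (rvar s 1 / 10) (mem s) (point s))"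
  unfolding filter_prog_def
  apply (rule runs_mono)
    apply (rule runs_Seq[OF runs_dot_prog[OF d(1)]])
    apply (rule runs_If)
     apply (rule runs_RSet)
     apply (use d in \<open>auto simp: band_def power2_eq_square\<close>)[1]
    apply (rule runs_RSet)
    apply (use d in \<open>auto simp: band_def power2_eq_square\<close>)
  done

lemma runs_hypothesis_prog:
  assumes d: "ivar s 0 = d"
  shows "runs ans hypothesis_prog s (3 * d + 20) (\<lambda>s'. rvar s' 0 = halfspace d (mem s) (point s))"
  unfolding hypothesis_prog_def
  apply (rule runs_mono)
    apply (rule runs_Seq[OF runs_dot_prog[OF d(1)]])
    apply (rule runs_If)
     apply (rule runs_RSet)
     apply (use d in \<open>auto simp: halfspace_eq sign_pm_def of_rat_minus\<close>)[1]
    apply (rule runs_RSet)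
    apply (use d in \<open>auto simp: halfspace_eq sign_pm_def\<close>)
  done

lemma runs_probe_prog:
  assumes d: "ivar s 0 = d" "ivar s 2 = Suc (d - 2)"
  shows "runs ans probe_prog s (3 * d + 20)
     (\<lambda>s'. rvar s' 0 = label s * probe d 1000 (mem s) (ivar s 1) (point s))"
proof -
  let ?y = "sqrt (real (Suc (d - 2))) * (point s (ivar s 1) - dot d (mem s) (point s) * mem s (ivar s 1)) /
     sqrt (1 - (dot d (mem s) (point s))\<^sup>2)"
  let ?Q = "\<lambda>y s'. rvar s' 6 = y \<and> label s' = label s"
  show ?thesis unfolding probe_prog_def seq.simps
    apply (rule runs_mono)
      apply (rule runs_Seq[OF runs_dot_prog[OF d(1)]])
      apply (rule runs_Seq[OF runs_RSet[where Q="?Q ?y"]])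
       apply (use d in \<open>auto simp: power2_eq_square\<close>)[1]
      apply (rule runs_Seq[where ?Q1.0="?Q (min 1000 ?y)" and ?T1.0=2])
       apply (rule runs_mono[OF runs_If])
          apply (rule runs_RSet)
          apply force
         apply (rule runs_Skip)
         apply force
        apply simp
      apply (rule runs_Seq[where ?Q1.0="?Q (max (-1000) (min 1000 ?y))" and ?T1.0=2])
       apply (rule runs_mono[OF runs_If])
          apply (rule runs_RSet)
          apply (force simp: of_rat_minus)
         apply (rule runs_Skip)
         apply (force simp: of_rat_minus)
        apply simp
      apply (rule runs_RSet)
      apply (auto simp: probe_def clip_def)
    done
qed

lemma returnsI:
  assumes "\<And>ans. runs ans F (s\<lparr>point := x, label := l\<rparr>) t (\<lambda>s'. rvar s' 0 = y)" "real t \<le> B"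
  shows "returns B F s x l y"
proof -
  obtain t' s' where "exec (\<lambda>_ _ _. False) F (s\<lparr>point := x, label := l\<rparr>) t' s'" "t' \<le> t" "rvar s' 0 = y"
    using assms(1)[of "\<lambda>_ _ _. False"] unfolding runs_def by blast
  moreover have "real t' \<le> B" using \<open>t' \<le> t\<close> assms(2) by linarith
  ultimately show ?thesis unfolding returns_def by blast
qed

text \<open>The predicate \<open>good\<close> keeps the analysis of the answers out of the reasoning
  about the program. The bound on the time is the sum of \<open>4 * d + 2\<close>, 1,
  \<open>4 * d + 2\<close>, \<open>3 * d + 2\<close> and 1.\<close>

lemma runs_round_prog:
  assumes d: "ivar s 0 = d" "ivar s 2 = N" and e: "rvar s 1 = e" and w: "\<And>j. j < d \<Longrightarrow> mem s j = w j"
    and ans: "\<And>i (s' :: state). i < d \<Longrightarrow> ivar s' 0 = d \<Longrightarrow> ivar s' 1 = i \<Longrightarrow> ivar s' 2 = N \<Longrightarrow> rvar s' 1 = e \<Longrightarrow>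
        (\<And>j. j < d \<Longrightarrow> mem s' j = w j) \<Longrightarrow> \<exists>\<mu>. ans (filter_prog, probe_prog) s' \<mu> \<and> good i \<mu>"
  shows "runs ans round_prog s (11 * d + 8) (\<lambda>s'. \<exists>\<mu>. (\<forall>i<d. good i (\<mu> i)) \<and>
     (\<forall>i<d. mem s' i = (w i + 100 * e * \<mu> i) / norm_dim d (\<lambda>i. w i + 100 * e * \<mu> i)) \<and>
     ivar s' 0 = d \<and> ivar s' 2 = N \<and> rvar s' 0 = rvar s 0 \<and> rvar s' 1 = e / 2 \<and> asked s' = asked s + d)"
    (is "runs _ _ _ _ ?Q")
proof -
  let ?F = "\<lambda>(s' :: state). ivar s' 2 = N \<and> rvar s' 0 = rvar s 0 \<and> rvar s' 1 = e"
  let ?P1 = "\<lambda>j (s' :: state). ?F s' \<and> asked s' = asked s + j \<and> (\<forall>i<d. mem s' i = w i) \<and> (\<forall>i<j. good i (mem s' (d + i)))"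
  let ?u = "\<lambda>\<mu> i. w i + 100 * e * \<mu> i"
  let ?G = "\<lambda>\<mu> (s' :: state). ?F s' \<and> asked s' = asked s + d \<and> (\<forall>i<d. good i (\<mu> i))"
  let ?P2 = "\<lambda>\<mu> j (s' :: state). ?G \<mu> s' \<and> (\<forall>i<d. mem s' i = (if i < j then ?u \<mu> i else w i)) \<and> (\<forall>i<d. mem s' (d + i) = \<mu> i) \<and>
     rvar s' 3 = dot j (?u \<mu>) (?u \<mu>)"
  let ?P3 = "\<lambda>\<mu> j (s' :: state). ?G \<mu> s' \<and> (\<forall>i<d. mem s' i = (if i < j then ?u \<mu> i / norm_dim d (?u \<mu>) else ?u \<mu> i)) \<and>
     rvar s' 3 = dot d (?u \<mu>) (?u \<mu>)"
  have 1: "runs ans (for_loop 1 (Seq (Ask 2 (filter_prog, probe_prog)) (Store (IAdd (IVar 0) (IVar 1)) (RVar 2))))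
      s (d * (2 + 2) + 2) (\<lambda>s'. ivar s' 0 = d \<and> ?P1 d s')"
  proof (rule runs_for_loop[where P="?P1"])
    fix j s' assume j: "j < ivar s' 0" "ivar s' 0 = d" "ivar s' 1 = j" and P: "?P1 j s'"
    then obtain \<mu> where \<mu>: "ans (filter_prog, probe_prog) s' \<mu>" "good j \<mu>"
      using ans[of j s'] by auto
    show "runs ans (Seq (Ask 2 (filter_prog, probe_prog)) (Store (IAdd (IVar 0) (IVar 1)) (RVar 2))) s' 2
      (\<lambda>s'. ivar s' 0 = d \<and> ivar s' 1 = j \<and> ?P1 (Suc j) (s'\<lparr>ivar := (ivar s')(1 := Suc j)\<rparr>))"
      apply (rule runs_mono)
        apply (rule runs_Seq[where ?Q1.0="\<lambda>s''. s'' = s'\<lparr>rvar := (rvar s')(2 := \<mu>), asked := Suc (asked s')\<rparr>"])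
         apply (rule runs_Ask)
          apply (rule \<mu>(1))
         apply (rule refl)
        apply simp
        apply (rule runs_Store)
        apply (use j P \<mu>(2) in \<open>auto simp: less_Suc_eq\<close>)
      done
  qed (use d e w in auto)
  have 2: "runs ans (for_loop 1 (Seq
       (Store (IVar 1) (RAdd (Mem (IVar 1)) (RMul (RMul (RNum 100) (RVar 1)) (Mem (IAdd (IVar 0) (IVar 1))))))
       (RSet 3 (RAdd (RVar 3) (RMul (Mem (IVar 1)) (Mem (IVar 1))))))) s' (d * (2 + 2) + 2)
     (\<lambda>s'. ivar s' 0 = d \<and> ?P2 \<mu> d s')" if "ivar s' 0 = d" "?P2 \<mu> 0 s'" for s' \<mu>
  proof (rule runs_for_loop[where P="?P2 \<mu>"])
    fix j s' assume j: "j < ivar s' 0" "ivar s' 0 = d" "ivar s' 1 = j" and P: "?P2 \<mu> j s'"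
    show "runs ans (Seq
       (Store (IVar 1) (RAdd (Mem (IVar 1)) (RMul (RMul (RNum 100) (RVar 1)) (Mem (IAdd (IVar 0) (IVar 1))))))
       (RSet 3 (RAdd (RVar 3) (RMul (Mem (IVar 1)) (Mem (IVar 1)))))) s' 2
      (\<lambda>s'. ivar s' 0 = d \<and> ivar s' 1 = j \<and> ?P2 \<mu> (Suc j) (s'\<lparr>ivar := (ivar s')(1 := Suc j)\<rparr>))"
      apply (rule runs_mono)
        apply (rule runs_Seq_Store)
        apply (rule runs_RSet)
        apply (use j P in \<open>auto simp: dot_def\<close>)
      done
  qed (use that in \<open>auto simp: dot_def\<close>)
  have 3: "runs ans (for_loop 1 (Store (IVar 1) (RDiv (Mem (IVar 1)) (RSqrt (RVar 3))))) s' (d * (1 + 2) + 2)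
     (\<lambda>s'. ivar s' 0 = d \<and> ?P3 \<mu> d s')" if "ivar s' 0 = d" "?P3 \<mu> 0 s'" for s' \<mu>
  proof (rule runs_for_loop[where P="?P3 \<mu>"])
    fix j s' assume j: "j < ivar s' 0" "ivar s' 0 = d" "ivar s' 1 = j" and P: "?P3 \<mu> j s'"
    show "runs ans (Store (IVar 1) (RDiv (Mem (IVar 1)) (RSqrt (RVar 3)))) s' 1
      (\<lambda>s'. ivar s' 0 = d \<and> ivar s' 1 = j \<and> ?P3 \<mu> (Suc j) (s'\<lparr>ivar := (ivar s')(1 := Suc j)\<rparr>))"
      by (rule runs_Store) (use j P in \<open>auto simp: norm_dim_eq less_Suc_eq\<close>)
  qed (use that in auto)
  show ?thesis unfolding round_prog_def seq.simps
  proof (rule runs_mono, rule runs_Seq[OF 1], rule runs_Seq_RSet)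
    fix s1 assume s1: "ivar s1 0 = d \<and> ?P1 d s1"
    \<comment> \<open>The vector of answers is recovered from the memory, as it arises one query at
      a time.\<close>
    define \<mu> where "\<mu> i = mem s1 (d + i)" for i
    let ?s2 = "s1\<lparr>rvar := (rvar s1)(3 := reval (RNum 0) s1)\<rparr>"
    show "runs ans (Seq (for_loop 1 (Seq
       (Store (IVar 1) (RAdd (Mem (IVar 1)) (RMul (RMul (RNum 100) (RVar 1)) (Mem (IAdd (IVar 0) (IVar 1))))))
       (RSet 3 (RAdd (RVar 3) (RMul (Mem (IVar 1)) (Mem (IVar 1)))))))
     (Seq (for_loop 1 (Store (IVar 1) (RDiv (Mem (IVar 1)) (RSqrt (RVar 3)))))
       (RSet 1 (RDiv (RVar 1) (RNum 2))))) ?s2 ((d * (2 + 2) + 2) + ((d * (1 + 2) + 2) + 1))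
      ?Q"
    proof (rule runs_Seq[OF 2[of _ \<mu>]])
      fix s3 assume s3: "ivar s3 0 = d \<and> ?P2 \<mu> d s3"
      show "runs ans (Seq (for_loop 1 (Store (IVar 1) (RDiv (Mem (IVar 1)) (RSqrt (RVar 3)))))
         (RSet 1 (RDiv (RVar 1) (RNum 2)))) s3 ((d * (1 + 2) + 2) + 1)
        ?Q"
        by (rule runs_Seq[OF 3[of _ \<mu>]], use s3 in simp, use s3 in simp, rule runs_RSet)
          (auto intro!: exI[of _ \<mu>])
    qed (use s1 in \<open>auto simp: \<mu>_def dot_def\<close>)
  qed auto
qed

section \<open>Progress of a round\<close>

text \<open>Positive factors disappear in the normalisation. Passing from \<open>v\<close> to
  \<open>a\<close> costs \<open>\<delta>\<close>, and normalising \<open>a\<close> moves it by its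
  distance from norm one, again at most \<open>\<delta>\<close>.\<close>

lemma normalised_close:
  assumes v: "norm_dim d v = 1" and u: "\<And>i. i < d \<Longrightarrow> u i = r * a i" and r: "r > 0"
    and close: "norm_dim d (\<lambda>i. a i - v i) \<le> \<delta>" and \<delta>: "\<delta> < 1"
  shows "norm_dim d (\<lambda>i. u i / norm_dim d u) = 1"
    and "norm_dim d (\<lambda>i. v i - u i / norm_dim d u) \<le> 2 * \<delta>"
proof -
  have cong: "norm_dim d x = norm_dim d y" if "\<And>i. i < d \<Longrightarrow> x i = y i" for x y
    using that by (simp add: norm_dim_def)
  define A where "A = norm_dim d a"
  have 1: "norm_dim d v \<le> norm_dim d a + norm_dim d (\<lambda>i. a i - v i)"
    using norm_dim_triangle[of d a "\<lambda>i. -1 * (a i - v i)"] unfolding norm_dim_scale by simp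
  have 2: "A \<le> norm_dim d v + norm_dim d (\<lambda>i. a i - v i)"
    using norm_dim_triangle[of d v "\<lambda>i. a i - v i"] by (simp add: A_def)
  have A: "A > 0" "\<bar>A - 1\<bar> \<le> \<delta>" using 1 2 v close \<delta> by (auto simp: A_def)
  have "norm_dim d u = r * A"
    using cong[of u "\<lambda>i. r * a i"] u r unfolding norm_dim_scale A_def by simp
  then have ua: "u i / norm_dim d u = 1 / A * a i" if "i < d" for i
    using u[OF that] r by simp
  show "norm_dim d (\<lambda>i. u i / norm_dim d u) = 1"
    using cong[of "\<lambda>i. u i / norm_dim d u" "\<lambda>i. 1 / A * a i"] ua A unfolding norm_dim_scale by (simp add: A_def)
  have "norm_dim d (\<lambda>i. v i - u i / norm_dim d u) = norm_dim d (\<lambda>i. -1 * (a i - v i) + (1 - 1 / A) * a i)"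
    by (rule cong) (simp add: ua algebra_simps)
  also have "\<dots> \<le> \<delta> + \<bar>1 - 1 / A\<bar> * A"
    using norm_dim_triangle[of d "\<lambda>i. -1 * (a i - v i)" "\<lambda>i. (1 - 1 / A) * a i"] close
    unfolding norm_dim_scale A_def[symmetric] by simp
  also have "\<bar>1 - 1 / A\<bar> * A = \<bar>A - 1\<bar>"
    using A(1) by (simp add: abs_if field_simps)
  finally show "norm_dim d (\<lambda>i. v i - u i / norm_dim d u) \<le> 2 * \<delta>" using A(2) by simp
qed

text \<open>Relative errors pass to the norm unchanged, while an absolute error in every coordinate
  gains a factor \<open>sqrt d\<close>. This is the reason for a tolerance of order
  \<open>1 / sqrt d\<close>.\<close>

lemma norm_dim_affine_bound:
  assumes "\<And>i. i < d \<Longrightarrow> \<bar>y i\<bar> \<le> \<alpha> * \<bar>x i\<bar> + b" "0 \<le> \<alpha>" "0 \<le> b"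
  shows "norm_dim d y \<le> \<alpha> * norm_dim d x + b * sqrt d"
proof -
  have "norm_dim d y \<le> norm_dim d (\<lambda>i. \<alpha> * \<bar>x i\<bar> + b * 1)"
    unfolding norm_dim_def using assms
    by (intro real_sqrt_le_mono sum_mono) (simp add: abs_le_square_iff[symmetric])
  also have "\<dots> \<le> \<alpha> * norm_dim d (\<lambda>i. \<bar>x i\<bar>) + b * norm_dim d (\<lambda>_. 1)"
    using norm_dim_triangle[of d "\<lambda>i. \<alpha> * \<bar>x i\<bar>" "\<lambda>i. b * 1"] assms unfolding norm_dim_scale by simp
  finally show ?thesis by (simp add: norm_dim_def)
qed

text \<open>After division by \<open>\<kappa>\<close> the clipping leaves
  \<open>1.6 / 10 ^ 5\<close> and the tolerance at most \<open>4 / 10 ^ 6\<close>, together below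
  half of the required distance, as \<open>normalised_close\<close> doubles it. The factor 1 in
  \<open>u\<close> is the value of \<open>e\<close> in the first round.\<close>

lemma first_step:
  assumes d: "d \<ge> 1" and v: "v \<in> unit_sphere d" and w: "\<And>j. j < d \<Longrightarrow> w j = 0"
    and \<mu>: "\<And>i. i < d \<Longrightarrow> \<bar>\<mu> i - (LINT x|filtered (uniform_sphere d) (band d g w). halfspace d v x * probe d 1000 w i x)\<bar>
      \<le> 1 / 10 ^ 9 / sqrt d"
  defines "u \<equiv> \<lambda>i. w i + 100 * 1 * \<mu> i"
  shows "norm_dim d (\<lambda>i. u i / norm_dim d u) = 1"
    and "norm_dim d (\<lambda>i. v i - u i / norm_dim d u) \<le> 1 / 2 / 10 ^ 4"
proof -
  let ?E = "\<lambda>i. LINT x|filtered (uniform_sphere d) (band d g w). halfspace d v x * probe d 1000 w i x"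
  have K: "(100 :: real) \<le> 1000" by simp
  obtain \<kappa> where \<kappa>: "\<kappa> \<ge> 1 / 4" "\<And>i. i < d \<Longrightarrow> \<bar>1000 * ?E i - \<kappa> * v i\<bar> \<le> 16 / 1000\<^sup>2 * \<kappa> * \<bar>v i\<bar>"
    using first_round(1)[OF d v _ K, of w] w by blast
  define E where "E i = ?E i" for i
  note \<kappa> = \<kappa>[folded E_def] and \<mu> = \<mu>[folded E_def]
  have v1: "norm_dim d v = 1" using v by (simp add: unit_sphere_iff norm_dim_eq_1_iff)
  define a where "a = (\<lambda>i. 1000 * \<mu> i / \<kappa>)"
  have "\<bar>a i - v i\<bar> \<le> 16 / 1000\<^sup>2 * \<bar>v i\<bar> + 4000 * (1 / 10 ^ 9 / sqrt d)" if i: "i < d" for i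
  proof -
    have "\<bar>1000 * \<mu> i - \<kappa> * v i\<bar> \<le> 1000 * \<bar>\<mu> i - E i\<bar> + \<bar>1000 * E i - \<kappa> * v i\<bar>"
    proof -
      have "1000 * \<mu> i - \<kappa> * v i = 1000 * (\<mu> i - E i) + (1000 * E i - \<kappa> * v i)" by (simp add: algebra_simps)
      then show ?thesis
        using abs_triangle_ineq[of "1000 * (\<mu> i - E i)" "1000 * E i - \<kappa> * v i"] by (simp only: abs_mult abs_numeral)
    qed
    also have "\<dots> \<le> 1000 * (1 / 10 ^ 9 / sqrt d) + 16 / 1000\<^sup>2 * \<kappa> * \<bar>v i\<bar>"
      by (intro add_mono mult_left_mono \<mu> \<kappa> i) simp
    also have "1000 * (1 / 10 ^ 9 / sqrt d) \<le> \<kappa> * (4000 * (1 / 10 ^ 9 / sqrt d))"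
      using mult_right_mono[OF \<kappa>(1), of "4000 * (1 / 10 ^ 9 / sqrt d)"] by simp
    finally have "\<bar>1000 * \<mu> i - \<kappa> * v i\<bar> \<le> (16 / 1000\<^sup>2 * \<bar>v i\<bar> + 4000 * (1 / 10 ^ 9 / sqrt d)) * \<kappa>"
      by (simp add: algebra_simps)
    moreover have "\<bar>a i - v i\<bar> = \<bar>1000 * \<mu> i - \<kappa> * v i\<bar> / \<kappa>"
    proof -
      have "a i - v i = (1000 * \<mu> i - \<kappa> * v i) / \<kappa>" using \<kappa>(1) by (simp add: a_def field_simps)
      then show ?thesis using \<kappa>(1) by simp
    qed
    ultimately show ?thesis using \<kappa>(1) by (simp add: pos_divide_le_eq)
  qed
  then have "norm_dim d (\<lambda>i. a i - v i) \<le> 16 / 1000\<^sup>2 * norm_dim d v + 4000 * (1 / 10 ^ 9 / sqrt d) * sqrt d"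
    by (rule norm_dim_affine_bound) auto
  also have "\<dots> \<le> 1 / 4 / 10 ^ 4"
    using d v1 by (simp add: power2_eq_square)
  finally have "norm_dim d (\<lambda>i. a i - v i) \<le> 1 / 4 / 10 ^ 4" .
  moreover have "u i = (\<kappa> / 10) * a i" if "i < d" for i using \<kappa>(1) w[OF that] by (simp add: u_def a_def)
  ultimately show "norm_dim d (\<lambda>i. u i / norm_dim d u) = 1"
    "norm_dim d (\<lambda>i. v i - u i / norm_dim d u) \<le> 1 / 2 / 10 ^ 4"
    using normalised_close[OF v1, of u "\<kappa> / 10" a "1 / 4 / 10 ^ 4"] \<kappa>(1) by auto
qed

lemma norm_diff_unit:
  assumes "norm_dim d v = 1" "norm_dim d w = 1"
  shows "(norm_dim d (\<lambda>i. v i - w i))\<^sup>2 = 2 * (1 - dot d w v)"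
  unfolding norm_dim_square dot_linear using assms by (simp add: norm_dim_eq_1_iff dot_commute[of d v w])

text \<open>The chord dominates the sine: \<open>1 - c^2 <= 2 * (1 - c)\<close>, which is the
  squared distance.\<close>

lemma close_dot:
  assumes v: "norm_dim d v = 1" and w: "norm_dim d w = 1" and close: "norm_dim d (\<lambda>i. v i - w i) \<le> \<beta>" and \<beta>: "\<beta> \<le> 1 / 10"
  shows "dot d w v \<ge> 9 / 10" "dot d w v \<le> 1" "1 - (dot d w v)\<^sup>2 \<le> \<beta>\<^sup>2"
proof -
  have sq: "2 * (1 - dot d w v) \<le> \<beta>\<^sup>2"
    using power_mono[OF close, of 2] norm_diff_unit[OF v w] by simp
  have "\<beta> \<ge> 0" using close norm_dim_nonneg order_trans by blast
  then have "\<beta>\<^sup>2 \<le> (1 / 10)\<^sup>2" using \<beta> by (intro power_mono) auto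
  then show "dot d w v \<ge> 9 / 10" using sq by (simp add: power_divide)
  show le: "dot d w v \<le> 1" using abs_dot_le[of d w v] v w by simp
  have "(1 - dot d w v) * (1 + dot d w v) \<le> (1 - dot d w v) * 2" using le by (intro mult_left_mono) auto
  then show "1 - (dot d w v)\<^sup>2 \<le> \<beta>\<^sup>2" using sq by (simp add: power2_eq_square algebra_simps)
qed

text \<open>The unnormalised update is close to \<open>v / co\<close>, so \<open>co * u\<close> is
  compared with \<open>v\<close>. The systematic error is a hundredth of the sine of the angle, at
  most \<open>e / 10 ^ 6\<close>, and the tolerance adds \<open>e / 10 ^ 7\<close> in norm; both are
  far below the \<open>e / 4 / 10 ^ 4\<close> that \<open>normalised_close\<close> doubles.\<close>

lemma refined_step:
  assumes n: "n \<ge> 1" and d: "d = Suc n" and v: "v \<in> unit_sphere d" and w: "w \<in> unit_sphere d"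
    and e: "0 < e" "e \<le> 1 / 2" and close: "norm_dim d (\<lambda>i. v i - w i) \<le> e / 10 ^ 4"
  shows "(LINT x|uniform_sphere d. band d (e / 10) w x) \<ge> e / 100"
    and "(\<And>i. i < d \<Longrightarrow> \<bar>\<mu> i - (LINT x|filtered (uniform_sphere d) (band d (e / 10) w). halfspace d v x * probe d 1000 w i x)\<bar>
      \<le> 1 / 10 ^ 9 / sqrt d) \<Longrightarrow>
      norm_dim d (\<lambda>i. (w i + 100 * e * \<mu> i) / norm_dim d (\<lambda>i. w i + 100 * e * \<mu> i)) = 1 \<and>
      norm_dim d (\<lambda>i. v i - (w i + 100 * e * \<mu> i) / norm_dim d (\<lambda>i. w i + 100 * e * \<mu> i)) \<le> e / 2 / 10 ^ 4"
proof -
  let ?E = "\<lambda>i. LINT x|filtered (uniform_sphere d) (band d (e / 10) w). halfspace d v x * probe d 1000 w i x"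
  define co where "co = dot d w v"
  have v1: "norm_dim d v = 1" and w1: "norm_dim d w = 1"
    using v w by (simp_all add: unit_sphere_iff norm_dim_eq_1_iff)
  have "e / 10 ^ 4 \<le> 1 / 10" using e by simp
  note co = close_dot[OF v1 w1 close this, folded co_def]
  have "1 - co\<^sup>2 \<le> (e / 10 / 100)\<^sup>2"
  proof -
    have "(e / 10 ^ 4)\<^sup>2 \<le> (e / 10 / 100)\<^sup>2" using e by (intro power_mono) auto
    then show ?thesis using co(3) by linarith
  qed
  note R = refined_round[where g="e / 10" and K=1000, OF n v[unfolded d] w[unfolded d] _ _ _ _ co(1)[unfolded co_def d] this[unfolded co_def d], folded d co_def]
  show "(LINT x|uniform_sphere d. band d (e / 10) w x) \<ge> e / 100"
    \<comment> \<open>The filter is the same for all coordinates, so any valid index will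
      do.\<close>
    using R(1)[of 0] e d by simp
  assume \<mu>: "\<And>i. i < d \<Longrightarrow> \<bar>\<mu> i - ?E i\<bar> \<le> 1 / 10 ^ 9 / sqrt d"
  define E where "E i = ?E i" for i
  note \<mu> = \<mu>[folded E_def]
  define u where "u = (\<lambda>i. w i + 100 * e * \<mu> i)"
  have E_close: "\<bar>100 * e * E i - (v i / co - w i)\<bar> \<le> 1 / 100 * \<bar>v i / co - w i\<bar>" if "i < d" for i
    using R(2)[of i] that e by (simp add: mult.commute co_def E_def)
  have "\<bar>co * u i - v i\<bar> \<le> 1 / 100 * \<bar>v i - co * w i\<bar> + e / 10 ^ 7 / sqrt d" if i: "i < d" for i
  proof -
    have "co * u i - v i = co * (100 * e * (\<mu> i - E i)) + co * (100 * e * E i - (v i / co - w i))"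
      using co(1) by (simp add: u_def field_simps)
    also have "\<bar>\<dots>\<bar> \<le> co * (100 * e * \<bar>\<mu> i - E i\<bar>) + co * \<bar>100 * e * E i - (v i / co - w i)\<bar>"
      by (rule order_trans[OF abs_triangle_ineq]) (use co(1) e in \<open>simp add: abs_mult\<close>)
    also have "\<dots> \<le> 1 * (100 * e * (1 / 10 ^ 9 / sqrt d)) + co * (1 / 100 * \<bar>v i / co - w i\<bar>)"
      using co e by (intro add_mono mult_mono \<mu> E_close i) auto
    also have "co * (1 / 100 * \<bar>v i / co - w i\<bar>) = 1 / 100 * \<bar>v i - co * w i\<bar>"
    proof -
      have "v i - co * w i = co * (v i / co - w i)" using co(1) by (simp add: field_simps)
      then show ?thesis using co(1) by (simp add: abs_mult)
    qed
    finally show ?thesis by simp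
  qed
  then have "norm_dim d (\<lambda>i. co * u i - v i) \<le> 1 / 100 * norm_dim d (\<lambda>i. v i - co * w i) + e / 10 ^ 7 / sqrt d * sqrt d"
    by (rule norm_dim_affine_bound) (use e in auto)
  also have "norm_dim d (\<lambda>i. v i - co * w i) \<le> e / 10 ^ 4"
  proof (rule power2_le_imp_le)
    have "(norm_dim d (\<lambda>i. v i - co * w i))\<^sup>2 = 1 - co\<^sup>2"
      unfolding norm_dim_square dot_linear using v1 w1
      by (simp add: norm_dim_eq_1_iff dot_commute[of d v w] co_def power2_eq_square)
    then show "(norm_dim d (\<lambda>i. v i - co * w i))\<^sup>2 \<le> (e / 10 ^ 4)\<^sup>2" using co(3) by simp
  qed (use e in simp)
  also have "e / 10 ^ 7 / sqrt d * sqrt d = e / 10 ^ 7" using d by simp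
  finally have "norm_dim d (\<lambda>i. co * u i - v i) \<le> e / 4 / 10 ^ 4" using e by simp
  moreover have "u i = 1 / co * (co * u i)" for i using co(1) by simp
  ultimately have "norm_dim d (\<lambda>i. u i / norm_dim d u) = 1 \<and> norm_dim d (\<lambda>i. v i - u i / norm_dim d u) \<le> 2 * (e / 4 / 10 ^ 4)"
    using normalised_close[OF v1, of u "1 / co" "\<lambda>i. co * u i" "e / 4 / 10 ^ 4"] co(1) e by auto
  then show "norm_dim d (\<lambda>i. (w i + 100 * e * \<mu> i) / norm_dim d (\<lambda>i. w i + 100 * e * \<mu> i)) = 1 \<and>
      norm_dim d (\<lambda>i. v i - (w i + 100 * e * \<mu> i) / norm_dim d (\<lambda>i. w i + 100 * e * \<mu> i)) \<le> e / 2 / 10 ^ 4"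
    unfolding u_def by simp
qed

section \<open>Queries of the learner\<close>

text \<open>The responder sees the functions that the programs compute, made extensional on the
  sphere. They depend on the memory below \<open>d\<close> only, and the restriction changes neither
  the filter mass nor the filtered law. The accuracy stays conditional on the filter mass, which the
  lemmas on progress supply.\<close>

lemma query_answer:
  assumes resp: "valid_responder (uniform_sphere d) (halfspace d v) \<tau>0 \<tau> resp"
    and s: "ivar s 0 = d" "ivar s 1 = i" "ivar s 2 = Suc (d - 2)" "rvar s 1 = e" "\<And>j. j < d \<Longrightarrow> mem s j = w j"
    and i: "i < d" and B: "real (3 * d + 20) \<le> B"
  shows "\<exists>\<mu>. answer (uniform_sphere d) B resp (filter_prog, probe_prog) s \<mu> \<and>
    ((LINT x|uniform_sphere d. band d (e / 10) w x) \<ge> \<tau>0 \<longrightarrow>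
      \<bar>\<mu> - (LINT x|filtered (uniform_sphere d) (band d (e / 10) w). halfspace d v x * probe d 1000 w i x)\<bar> \<le> \<tau>)"
proof -
  let ?D = "uniform_sphere d" and ?b = "band d (e / 10) w" and ?p = "probe d 1000 w i"
  have dots: "dot d (mem s) x = dot d w x" for x by (rule dot_cong) (auto simp: s)
  have b_eq: "band d (e / 10) (mem s) x = ?b x" for x by (simp add: band_def dots)
  have p_eq: "probe d 1000 (mem s) i x = ?p x" for x by (simp add: probe_def dots s(5)[OF i])
  define chi where "chi = restrict ?b (space ?D)"
  define \<phi> where "\<phi> = restrict (\<lambda>z. snd z * ?p (fst z)) (space ?D \<times> {-1, 1})"
  have b_meas: "?b \<in> borel_measurable ?D" by (rule measurable_uniform_sphere) measurable
  have p_meas: "?p \<in> borel_measurable ?D" by (rule measurable_uniform_sphere, rule measurable_probe[OF i])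
  have f_meas: "halfspace d v \<in> borel_measurable ?D" by (rule measurable_uniform_sphere) (rule measurable_halfspace)
  have chi_meas: "chi \<in> borel_measurable ?D"
    unfolding chi_def using b_meas by (subst measurable_cong[where g="?b"]) auto
  have filter: "is_filter ?D chi"
    unfolding is_filter_def using chi_meas band_bounds by (auto simp: chi_def)
  have query: "is_query_fun ?D \<phi>"
    unfolding is_query_fun_def
  proof (intro conjI ballI PiE_I)
    fix z assume z: "z \<in> space ?D \<times> {-1, 1 :: real}"
    then have "\<bar>\<phi> z\<bar> = \<bar>?p (fst z)\<bar>" by (auto simp: \<phi>_def abs_mult)
    then show "\<phi> z \<in> {-1..1}" using abs_probe_le[of 1000 d w i "fst z"] by (auto simp: abs_le_iff)
  next
    fix l assume "l \<in> {-1, 1 :: real}"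
    then show "(\<lambda>x. \<phi> (x, l)) \<in> borel_measurable ?D"
      using p_meas by (subst measurable_cong[where g="\<lambda>x. l * ?p x"]) (auto simp: \<phi>_def)
  qed (auto simp: \<phi>_def)
  let ?\<mu> = "resp (asked s) chi \<phi>"
  have "answer ?D B resp (filter_prog, probe_prog) s ?\<mu>"
    unfolding answer_def
  proof (intro exI[of _ chi] exI[of _ \<phi>] conjI ballI filter query refl)
    fix x assume x: "x \<in> space ?D"
    show "returns B (fst (filter_prog, probe_prog)) s x 0 (chi x)"
      using x runs_filter_prog[of "s\<lparr>point := x, label := 0\<rparr>" d] s B
      by (intro returnsI[where t="3 * d + 20"]) (auto simp: chi_def b_eq)
    fix l assume l: "l \<in> {-1, 1 :: real}"
    then have "\<phi> (x, l) = l * ?p x" using x by (auto simp: \<phi>_def)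
    then show "returns B (snd (filter_prog, probe_prog)) s x l (\<phi> (x, l))"
      using runs_probe_prog[of "s\<lparr>point := x, label := l\<rparr>" d] s B p_eq
      by (intro returnsI[where t="3 * d + 20"]) auto
  qed
  moreover have "(LINT x|?D. ?b x) \<ge> \<tau>0 \<longrightarrow> \<bar>?\<mu> - (LINT x|filtered ?D ?b. halfspace d v x * ?p x)\<bar> \<le> \<tau>"
  proof -
    have int: "(LINT x|?D. chi x) = (LINT x|?D. ?b x)"
      by (rule Bochner_Integration.integral_cong) (auto simp: chi_def)
    have filt: "filtered ?D chi = filtered ?D ?b"
      unfolding filtered_def int using chi_meas b_meas by (intro density_cong) (auto simp: chi_def)
    have "(LINT x|filtered ?D ?b. \<phi> (x, halfspace d v x)) = (LINT x|filtered ?D ?b. halfspace d v x * ?p x)"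
      by (rule Bochner_Integration.integral_cong) (auto simp: filtered_def \<phi>_def halfspace_eq sign_pm_def)
    then show ?thesis
      using resp filter query unfolding valid_responder_def valid_response_def by (metis int filt)
  qed
  ultimately show ?thesis by blast
qed

lemma measurable_halfspace_uniform: "halfspace d w \<in> borel_measurable (uniform_sphere d)"
  by (rule measurable_uniform_sphere) (rule measurable_halfspace)

lemma unit_sphere_0: "unit_sphere 0 = {}"
  by (auto simp: unit_sphere_iff dot_def)

section \<open>Error of the hypothesis, number of rounds and the whole run\<close>

text \<open>In dimension one the sphere has two points, and a hypothesis this close to the target
  equals it. The exact value 0 matters there, because the single round gives no distance that
  shrinks with the desired accuracy.\<close>

lemma final_error:
  assumes v: "v \<in> unit_sphere d" and w: "w \<in> unit_sphere d" and \<beta>: "\<beta> \<le> 1 / 10"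
    and close: "norm_dim d (\<lambda>i. v i - w i) \<le> \<beta>"
  shows "measure (uniform_sphere d) {x \<in> space (uniform_sphere d). halfspace d w x \<noteq> halfspace d v x} \<le> (if d = 1 then 0 else 4 * \<beta>)"
proof -
  have v1: "norm_dim d v = 1" and w1: "norm_dim d w = 1"
    using v w by (simp_all add: unit_sphere_iff norm_dim_eq_1_iff)
  note cd = close_dot[OF v1 w1 close \<beta>]
  have \<beta>0: "\<beta> \<ge> 0" using close norm_dim_nonneg order_trans by blast
  consider "d = 0" | "d = 1" | n where "d = Suc n" "n \<ge> 1" 
  proof (cases d)
    case (Suc m)
    then show ?thesis using that(2) that(3)[of m] by (cases "m = 0") auto
  qed (rule that)
  then show ?thesis
  proof cases
    case 1
    then show ?thesis using v by (simp add: unit_sphere_0)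
  next
    case 2
    have "(v 0 - w 0)\<^sup>2 = 2 * (1 - w 0 * v 0)"
      using norm_diff_unit[OF v1 w1] 2 unfolding norm_dim_square by (simp add: dot_def power2_eq_square)
    moreover have "\<bar>v 0\<bar> = 1" "\<bar>w 0\<bar> = 1"
      using v1 w1 2 by (simp_all add: norm_dim_def)
    ultimately have "w 0 = v 0" using cd(1) 2 by (auto simp: dot_def abs_if split: if_splits)
    then have "dot d w x = dot d v x" for x using 2 by (simp add: dot_def)
    then show ?thesis using 2 by (simp add: halfspace_eq)
  next
    case 3
    have "measure (uniform_sphere d) {x \<in> unit_sphere d. halfspace d w x \<noteq> halfspace d v x} \<le> 4 * sqrt (1 - (dot d w v)\<^sup>2)"
      using halfspace_disagreement[OF 3(2), of v w] v w cd(1) unfolding 3(1) by blast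
    also have "sqrt (1 - (dot d w v)\<^sup>2) \<le> \<beta>"
      using cd(3) \<beta>0 by (intro real_le_lsqrt) auto
    finally show ?thesis using 3 by (simp add: space_uniform_sphere)
  qed
qed

text \<open>Stopping at \<open>2 * \<epsilon>\<close> instead of \<open>\<epsilon>\<close> saves the
  rounding: before the last round \<open>2 * \<epsilon> <= (1 / 2) ^ (k - 1)\<close>, that is
  \<open>2 ^ k <= 1 / \<epsilon>\<close>. For \<open>\<epsilon> <= 1 / 2\<close> at least one round
  takes place.\<close>

lemma number_of_rounds:
  assumes \<epsilon>: "0 < \<epsilon>" "\<epsilon> \<le> 1 / 2" and d: "d \<ge> (1 :: nat)"
  obtains k where "k \<ge> 1" "real k \<le> log 2 (1 / \<epsilon>)" "\<And>j. j < k \<Longrightarrow> 2 * \<epsilon> \<le> (1 / 2) ^ j"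
    "d = 1 \<Longrightarrow> k = 1" "d > 1 \<Longrightarrow> (1 / 2) ^ k < 2 * \<epsilon>"
proof -
  have log: "real k \<le> log 2 (1 / \<epsilon>)" if "2 * \<epsilon> \<le> (1 / 2) ^ (k - 1)" "k \<ge> 1" for k
  proof -
    have "2 * \<epsilon> \<le> 2 * (1 / 2) ^ k" using that by (cases k) auto
    then have "2 ^ k \<le> 1 / \<epsilon>" using \<epsilon> by (simp add: field_simps power_one_over)
    then have "2 powr real k \<le> 1 / \<epsilon>" by (simp add: powr_realpow)
    then show ?thesis using \<epsilon> by (simp add: le_log_iff)
  qed
  show ?thesis
  proof (cases "d = 1")
    case True
    show ?thesis by (rule that[of 1]) (use True \<epsilon> log[of 1] in auto)
  next
    case False
    obtain m where m: "(1 / 2) ^ m < 2 * \<epsilon>"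
      using real_arch_pow_inv[of "2 * \<epsilon>" "1 / 2"] \<epsilon> by auto
    define k where "k = (LEAST m. (1 / 2) ^ m < 2 * \<epsilon>)"
    have k: "(1 / 2) ^ k < 2 * \<epsilon>" unfolding k_def by (rule LeastI[of _ m]) (rule m)
    have lt: "2 * \<epsilon> \<le> (1 / 2) ^ j" if "j < k" for j
      using not_less_Least[of j "\<lambda>m. (1 / 2) ^ m < 2 * \<epsilon>"] that by (simp add: k_def)
    have k1: "k \<ge> 1" using k \<epsilon> by (cases k) auto
    then have "real k \<le> log 2 (1 / \<epsilon>)" using lt[of "k - 1"] by (intro log) auto
    then show ?thesis using that[of k] k lt k1 False d by auto
  qed
qed

lemma runs_learner:
  assumes d: "d \<ge> 1" and \<epsilon>: "0 < \<epsilon>" and v: "v \<in> unit_sphere d"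
    and resp: "valid_responder (uniform_sphere d) (halfspace d v) (\<epsilon> / 100) (1 / 10 ^ 9 / sqrt d) resp"
    and B: "real (3 * d + 20) \<le> B"
    and k: "k \<ge> 1" "\<And>j. j < k \<Longrightarrow> 2 * \<epsilon> \<le> (1 / 2) ^ j" "d = 1 \<Longrightarrow> k = 1" "d > 1 \<Longrightarrow> (1 / 2) ^ k < 2 * \<epsilon>"
    and \<epsilon>2: "\<epsilon> \<le> 1 / 2"
  shows "runs (answer (uniform_sphere d) B resp) learner (init_state d \<epsilon>) (k * (11 * d + 9) + 3)
    (\<lambda>s. asked s = k * d \<and> ivar s 0 = d \<and> restrict (mem s) {..<d} \<in> unit_sphere d \<and>
      norm_dim d (\<lambda>i. v i - mem s i) \<le> (1 / 2) ^ k / 10 ^ 4)"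
proof -
  let ?D = "uniform_sphere d" and ?ans = "answer (uniform_sphere d) B resp"
  let ?\<tau> = "1 / 10 ^ 9 / sqrt (real d)"
  define close where "close j w \<longleftrightarrow> norm_dim d w = 1 \<and> norm_dim d (\<lambda>i. v i - w i) \<le> (1 / 2) ^ j / 10 ^ 4" for j and w :: "nat \<Rightarrow> real"
  have close_cong: "close j w \<longleftrightarrow> close j w'" if "\<And>i. i < d \<Longrightarrow> w i = w' i" for j w w'
    using that by (simp add: close_def norm_dim_def)
  \<comment> \<open>Before the first round the memory is zero and not a unit vector, so closeness is
    claimed only from \<open>j = 1\<close> on.\<close>
  let ?I = "\<lambda>j s. ivar s 0 = d \<and> ivar s 2 = Suc (d - 2) \<and> rvar s 0 = \<epsilon> \<and> rvar s 1 = (1 / 2) ^ j \<and> asked s = j * d \<and>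
     (if j = 0 then \<forall>i<d. mem s i = 0 else close j (mem s))"
  have body: "beval guard s \<and> runs ?ans round_prog s (11 * d + 8) (?I (Suc j))" if j: "j < k" and I: "?I j s" for j s
  proof
    define e :: real where "e = (1 / 2) ^ j"
    have e: "2 * \<epsilon> \<le> e" "e > 0" unfolding e_def using k(2)[OF j] by auto
    \<comment> \<open>In dimension one the guard holds only while \<open>e = 1\<close>.\<close>
    have "d < 2 \<Longrightarrow> j = 0" using k(3) d j by (cases "d = 1") auto
    then show "beval guard s" using I e by (auto simp: guard_def e_def)
    define w where "w = restrict (mem s) {..<d}"
    let ?E = "\<lambda>i. LINT x|filtered ?D (band d (e / 10) w). halfspace d v x * probe d 1000 w i x"
    define u where "u \<mu> = (\<lambda>i. w i + 100 * e * \<mu> i)" for \<mu>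
    \<comment> \<open>Stated for every \<open>\<mu>\<close>, so that the filter mass is available
      for each single query before the answers of the round are known. The mass is 1 in the first
      round and at least \<open>e / 100\<close> in later ones.\<close>
    have step: "(LINT x|?D. band d (e / 10) w x) \<ge> \<epsilon> / 100 \<and> ((\<forall>i<d. \<bar>\<mu> i - ?E i\<bar> \<le> ?\<tau>) \<longrightarrow>
        close (Suc j) (\<lambda>i. u \<mu> i / norm_dim d (u \<mu>)))" for \<mu>
    proof (cases "j = 0")
      case True
      then have w0: "\<And>i. i < d \<Longrightarrow> w i = 0" using I by (auto simp: w_def)
      have e1: "e = 1" using True by (simp add: e_def)
      have "(LINT x|?D. band d (e / 10) w x) = 1"
        using first_round(2)[OF d v _ order_refl, of w "e / 10"] w0 by blast
      then show ?thesis
        using first_step[where w=w and \<mu>=\<mu> and g="e / 10", OF d v w0] \<epsilon>2 True \<open>(LINT x|?D. band d (e / 10) w x) = 1\<close> unfolding close_def u_def e1 by auto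
    next
      case False
      then have w1: "norm_dim d w = 1" "norm_dim d (\<lambda>i. v i - w i) \<le> e / 10 ^ 4"
        using I close_cong[of "mem s" w j] by (auto simp: w_def close_def e_def)
      then have w: "w \<in> unit_sphere d" by (auto simp: unit_sphere_iff norm_dim_eq_1_iff w_def)
      have "d \<noteq> 1" using k(3) j False by auto
      then obtain n where n: "d = Suc n" "n \<ge> 1" using d by (cases d) auto
      have "e \<le> (1 / 2) ^ 1" unfolding e_def by (rule power_decreasing) (use False in auto)
      then have e2: "e \<le> 1 / 2" by simp
      have "(LINT x|?D. band d (e / 10) w x) \<ge> \<epsilon> / 100"
        using refined_step(1)[OF n(2,1) v w e(2) e2 w1(2)] e \<epsilon> by linarith
      then show ?thesis
        using refined_step(2)[OF n(2,1) v w e(2) e2 w1(2), of \<mu>] unfolding close_def u_def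
        by (auto simp: e_def)
    qed
    have "runs ?ans round_prog s (11 * d + 8) (\<lambda>s'. \<exists>\<mu>. (\<forall>i<d. \<bar>\<mu> i - ?E i\<bar> \<le> ?\<tau>) \<and>
       (\<forall>i<d. mem s' i = (w i + 100 * e * \<mu> i) / norm_dim d (\<lambda>i. w i + 100 * e * \<mu> i)) \<and>
       ivar s' 0 = d \<and> ivar s' 2 = Suc (d - 2) \<and> rvar s' 0 = rvar s 0 \<and> rvar s' 1 = e / 2 \<and> asked s' = asked s + d)"
    proof (rule runs_round_prog[where good="\<lambda>i \<mu>. \<bar>\<mu> - ?E i\<bar> \<le> ?\<tau>"])
      fix i and s' :: state
      assume s': "i < d" "ivar s' 0 = d" "ivar s' 1 = i" "ivar s' 2 = Suc (d - 2)" "rvar s' 1 = e"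
        and mem: "\<And>j. j < d \<Longrightarrow> mem s' j = w j"
      have "\<exists>\<mu>. ?ans (filter_prog, probe_prog) s' \<mu> \<and>
        ((LINT x|?D. band d (e / 10) w x) \<ge> \<epsilon> / 100 \<longrightarrow> \<bar>\<mu> - ?E i\<bar> \<le> ?\<tau>)"
        by (rule query_answer[OF resp s'(2-5) mem s'(1) B])
      with step show "\<exists>\<mu>. ?ans (filter_prog, probe_prog) s' \<mu> \<and> \<bar>\<mu> - ?E i\<bar> \<le> ?\<tau>" by blast
    qed (use I in \<open>auto simp: w_def e_def\<close>)
    then show "runs ?ans round_prog s (11 * d + 8) (?I (Suc j))"
    proof (rule runs_weaken)
      fix s' assume "\<exists>\<mu>. (\<forall>i<d. \<bar>\<mu> i - ?E i\<bar> \<le> ?\<tau>) \<and>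
       (\<forall>i<d. mem s' i = (w i + 100 * e * \<mu> i) / norm_dim d (\<lambda>i. w i + 100 * e * \<mu> i)) \<and>
       ivar s' 0 = d \<and> ivar s' 2 = Suc (d - 2) \<and> rvar s' 0 = rvar s 0 \<and> rvar s' 1 = e / 2 \<and> asked s' = asked s + d"
      then obtain \<mu> where \<mu>: "\<forall>i<d. \<bar>\<mu> i - ?E i\<bar> \<le> ?\<tau>" "\<And>i. i < d \<Longrightarrow> mem s' i = u \<mu> i / norm_dim d (u \<mu>)"
        "ivar s' 0 = d" "ivar s' 2 = Suc (d - 2)" "rvar s' 0 = rvar s 0" "rvar s' 1 = e / 2" "asked s' = asked s + d"
        unfolding u_def by blast
      then show "?I (Suc j) s'" using step[of \<mu>] close_cong[of "mem s'" _ "Suc j", OF \<mu>(2)] I by (auto simp: e_def)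
    qed simp
  qed
  have loop: "runs ?ans (While guard round_prog) s (k * ((11 * d + 8) + 1) + 1) (?I k)" if "?I 0 s" for s
  proof (rule runs_While[where I="?I"])
    fix s :: state assume I: "?I k s"
    \<comment> \<open>In dimension one this inequality ends the loop, through the second part of the
      guard.\<close>
    have "(1 / 2) ^ k < (1 :: real)" using k(1) by (simp add: power_one_over)
    then show "\<not> beval guard s" using I k(3,4) d by (cases "d = 1") (auto simp: guard_def)
  qed (use body that in auto)
  have "runs ?ans learner (init_state d \<epsilon>) (1 + (1 + (k * ((11 * d + 8) + 1) + 1))) (?I k)"
    unfolding learner_def seq.simps
    by (rule runs_Seq_ISet, rule runs_Seq_RSet, rule loop) (auto simp: init_state_def)
  then show ?thesis
  proof (rule runs_weaken)
    fix s assume I: "?I k s"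
    then have "close k (mem s)" using k(1) by (auto split: if_splits)
    then show "asked s = k * d \<and> ivar s 0 = d \<and> restrict (mem s) {..<d} \<in> unit_sphere d \<and>
      norm_dim d (\<lambda>i. v i - mem s i) \<le> (1 / 2) ^ k / 10 ^ 4"
      using I by (auto simp: close_def unit_sphere_iff norm_dim_eq_1_iff)
  qed (simp add: algebra_simps)
qed

text \<open>\<open>T\<close> bounds the run as well as every single evaluation. Both take at most
  \<open>23 * d * k\<close> steps for \<open>k\<close> rounds, because \<open>d\<close> and
  \<open>k\<close> are at least one, and \<open>k\<close> is at most
  \<open>log 2 (1 / \<epsilon>)\<close>, hence at most
  \<open>log 2 (d / \<epsilon>)\<close>.\<close>

lemma learns_halfspaces:
  assumes d: "d \<ge> 1" and \<epsilon>: "0 < \<epsilon>" "\<epsilon> \<le> 1 / 2"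
  defines "T \<equiv> real d * (30 * log 2 (real d / \<epsilon>))"
  shows "learns (learner, hypothesis_prog) d (uniform_sphere d) (halfspaces d) \<epsilon> (\<epsilon> / 100) (1 / 10 ^ 9 / sqrt d)
    ((real d + 1) * log 2 (1 / \<epsilon>)) T"
  unfolding learns_def
proof (intro ballI allI impI)
  fix f resp assume "f \<in> halfspaces d" and resp: "valid_responder (uniform_sphere d) f (\<epsilon> / 100) (1 / 10 ^ 9 / sqrt d) resp"
  then obtain v where v: "v \<in> unit_sphere d" and f: "f = halfspace d v"
    by (auto simp: halfspaces_def)
  obtain k where k: "k \<ge> 1" "real k \<le> log 2 (1 / \<epsilon>)" "\<And>j. j < k \<Longrightarrow> 2 * \<epsilon> \<le> (1 / 2) ^ j"
    "d = 1 \<Longrightarrow> k = 1" "d > 1 \<Longrightarrow> (1 / 2) ^ k < 2 * \<epsilon>"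
    using number_of_rounds[OF \<epsilon> d] by blast
  have "log 2 (1 / \<epsilon>) \<le> log 2 (real d / \<epsilon>)"
    using d \<epsilon> by (intro log_mono divide_right_mono) auto
  then have kL: "real k \<le> log 2 (real d / \<epsilon>)" using k(2) by linarith
  have T: "30 * real d * real k \<le> T"
    using mult_left_mono[OF kL, of "30 * real d"] by (simp add: T_def mult_ac)
  have dk: "real d \<le> real d * real k" "1 \<le> real d * real k" "real k \<le> real d * real k"
    using d k(1) mult_left_mono[of 1 "real k" "real d"] mult_right_mono[of 1 "real d" "real k"] mult_mono[of 1 "real d" 1 "real k"] by auto
  have B: "real (3 * d + 20) \<le> T" using T dk by simp
  obtain t s where ts: "exec (answer (uniform_sphere d) T resp) learner (init_state d \<epsilon>) t s" "t \<le> k * (11 * d + 9) + 3"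
    "asked s = k * d" "ivar s 0 = d" "restrict (mem s) {..<d} \<in> unit_sphere d"
    "norm_dim d (\<lambda>i. v i - mem s i) \<le> (1 / 2) ^ k / 10 ^ 4"
    using runs_learner[OF d \<epsilon>(1) v resp[unfolded f] B k(1,3,4,5) \<epsilon>(2)] unfolding runs_def by blast
  define w where "w = restrict (mem s) {..<d}"
  have w: "w \<in> unit_sphere d" using ts(5) by (simp add: w_def)
  have close: "norm_dim d (\<lambda>i. v i - w i) \<le> (1 / 2) ^ k / 10 ^ 4"
    using ts(6) by (simp add: w_def norm_dim_def)
  have tT: "real t \<le> T"
  proof -
    have "real t \<le> real (k * (11 * d + 9) + 3)" using ts(2) by (rule of_nat_mono)
    also have "\<dots> = 11 * (real d * real k) + 9 * real k + 3" by (simp add: algebra_simps)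
    also have "\<dots> \<le> 30 * real d * real k" using dk by simp
    finally show ?thesis using T by simp
  qed
  have asked: "real (asked s) \<le> (real d + 1) * log 2 (1 / \<epsilon>)"
  proof -
    have "real k * real d \<le> log 2 (1 / \<epsilon>) * (real d + 1)" using k(2) by (intro mult_mono) auto
    then show ?thesis unfolding ts(3) by (simp add: mult.commute)
  qed
  have small: "(1 / 2) ^ k / 10 ^ 4 \<le> (1 / 10 :: real)"
    using power_le_one[of "1 / 2 :: real" k] by simp
  have err: "measure (uniform_sphere d) {x \<in> space (uniform_sphere d). halfspace d w x \<noteq> f x} \<le> \<epsilon>"
    using final_error[OF v w small close] k(5) d \<epsilon> unfolding f by (cases "d = 1") auto
  have ret: "returns T (snd (learner, hypothesis_prog)) s x 0 (halfspace d w x)" if "x \<in> space (uniform_sphere d)" for x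
    using runs_hypothesis_prog[of "s\<lparr>point := x, label := 0\<rparr>" d] ts(4) B
    by (intro returnsI[where t="3 * d + 20"]) (auto simp: w_def halfspace_eq)
  show "\<exists>t s h. exec (answer (uniform_sphere d) T resp) (fst (learner, hypothesis_prog)) (init_state d \<epsilon>) t s \<and>
      real t \<le> T \<and> real (asked s) \<le> (real d + 1) * log 2 (1 / \<epsilon>) \<and>
      h \<in> space (uniform_sphere d) \<rightarrow> {-1, 1} \<and> h \<in> borel_measurable (uniform_sphere d) \<and>
      (\<forall>x\<in>space (uniform_sphere d). returns T (snd (learner, hypothesis_prog)) s x 0 (h x)) \<and>
      measure (uniform_sphere d) {x \<in> space (uniform_sphere d). h x \<noteq> f x} \<le> \<epsilon>"
    by (intro exI[of _ t] exI[of _ s] exI[of _ "halfspace d w"] conjI ballI ret asked tT err measurable_halfspace_uniform)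
      (use ts(1) in \<open>auto simp: halfspace_eq sign_pm_def\<close>)
qed

theorem theorem4p9:
  "\<exists>(A :: active_SQ_alg) (\<tau> :: nat \<Rightarrow> real \<Rightarrow> real) (\<tau>0 :: nat \<Rightarrow> real \<Rightarrow> real) (c :: real) (c0 :: real) (p :: real poly).
     c > 0 \<and> c0 > 0 \<and>
     (\<forall>(d::nat) (\<epsilon>::real). d \<ge> 1 \<and> 0 < \<epsilon> \<and> \<epsilon> \<le> 1 / 2 \<longrightarrow>
        \<tau> d \<epsilon> \<ge> c / sqrt (real d) \<and> \<tau>0 d \<epsilon> \<ge> c0 * \<epsilon> \<and>
        learns A d (uniform_sphere d) (halfspaces d) \<epsilon> (\<tau>0 d \<epsilon>) (\<tau> d \<epsilon>)
          ((real d + 1) * log 2 (1 / \<epsilon>))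
          (real d * poly p (log 2 (real d / \<epsilon>))))"
proof (intro exI conjI allI impI)
  fix d :: nat and \<epsilon> :: real
  assume "d \<ge> 1 \<and> 0 < \<epsilon> \<and> \<epsilon> \<le> 1 / 2"
  then show "learns (learner, hypothesis_prog) d (uniform_sphere d) (halfspaces d) \<epsilon>
      ((\<lambda>_ \<epsilon>. \<epsilon> / 100) d \<epsilon>) ((\<lambda>d _. 1 / 10 ^ 9 / sqrt d) d \<epsilon>)
      ((real d + 1) * log 2 (1 / \<epsilon>)) (real d * poly [:0, 30:] (log 2 (real d / \<epsilon>)))"
    using learns_halfspaces[of d \<epsilon>] by (simp add: mult_ac)
  show "1 / 10 ^ 9 / sqrt (real d) \<le> 1 / 10 ^ 9 / sqrt (real d)" by simp
  show "1 / 100 * \<epsilon> \<le> \<epsilon> / 100" by simp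
qed simp_all

end
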